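(* Let $B_p^0(\mu)=p+V^0(J^0(\mu,p),p)-V^0(\mu,p)$ and $\Gamma^0(\mu,p)=D^0(\mu,p)B^0_p(\mu)$. Fix a zero-quality state $\mu_0$ at which the desk uniquely resets to $p^r\in\mathcal P$ (i.e. $p^r$ is the unique maximizer of $\widetilde U^0(\mu_0,\cdot)$ over $\mathcal P$), and let $p^i\in\mathcal P$ be an inherited current price. If $$p^r<p^i\le p_D(\mu_0),\qquad B^0_{p^i}(\mu_0)\ge B^0_{p^r}(\mu_0)>0,\qquad(\ast)$$ then $$\Gamma^0(\mu_0,p^i)>\Gamma^0(\mu_0,p^r).\qquad(\ast\ast)$$ Consequently, every cost $c$ strictly between these two gains makes quality profitable at the inherited price ($\Gamma^0(\mu_0,p^i)>c$) and unprofitable immediately after a reset at the same reputation ($\Gamma^0(\mu_0,p^r)<c$). If $p^i$ is uniquely reset-optimal (the unique maximizer of $\widetilde U^0(\mu',\cdot)$ over $\mathcal P$) at an upstream belief $\mu'$ whose zero-quality silence path (at current price $p^i$) passes through $\mu_0$, then every neighborhood of the active inherited state $(\mu_0,p^i)$ is reached with positive probability (starting from $(\mu',p^i)$). The conditions describe an open set of economies. In particular, suppose the myopic expected-revenue maximizer (the maximizer of $p\bar A^0(\mu,p)$ over $p\in\mathcal P$) is $p^i$ at an upstream belief $\mu'$ and $p^r$ at $\mu_0$, with $p^r<p^i\le p_D(\mu_0)$. Then for all sufficiently large but finite discount rates $\rho$, the zero-quality desk preserves these strict rankings (the unique maximizer of $\widetilde U^0(\mu',\cdot)$ is $p^i$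 and that of $\widetilde U^0(\mu_0,\cdot)$ is $p^r$) and $(\ast\ast)$ holds.
   Context: **Model.** Constants: $\rho,\nu,\kappa,v,\zeta>0$ (discount rate, customer arrival rate, price-reset rate, value of high quality, logit scale), quality cost $c>0$, signal precision $q\in(1/2,1)$, $d=2q-1$. Finite price menu $\mathcal P\subset(0,\infty)$. An economy is a specification of these primitives. $\mu\in[0,1]$ is the public probability that the firm is the commitment type (always high quality) rather than the strategic type. $\pi_H(\lambda)=\frac{q\lambda}{(1-q)+d\lambda}$, $\pi_L(\lambda)=\frac{(1-q)\lambda}{q-d\lambda}$, $\Lambda(z)=e^z/(1+e^z)$, $b_s(\lambda,p)=\Lambda((v\pi_s(\lambda)-p)/\zeta)$, $s\in\{H,L\}$, and $p_D(\mu)=\frac v2\{\pi_H(\mu)+\pi_L(\mu)\}$. **Zero-quality objects:** $A_H^0(\mu,p)=qb_H(\mu,p)+(1-q)b_L(\mu,p)$, $A_L^0=(1-q)b_H+qb_L$, $D^0=A_H^0-A_L^0=d(b_H-b_L)$, $\bar A^0=A_L^0+\mu D^0$, $\beta^0=-\nu\mu(1-\mu)D^0$, $J^0=\mu A_H^0/\bar A^0$; $\phi^p_t(\mu)$ is the flow of $\dot\mu=\beta^0(\mu,p)$ with $p$ fixed (the silence path). In the zero-quality process, $\mu$ follows the silence path between events with $p$ fixed; purchases arrive at rate $\nu\bar A^0$ and move $\mu$ to $J^0$; resets arrive at rate $\kappa$ and change only the price. $\widetilde U^0$ (gross aggregate value) is the unique bounded fixed point of $$(\mathcal Tf)(\mu,p)=\int_0^\infty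 e^{-\rho t-\int_0^t[\kappa+\nu\bar A^0(\phi_s,p)]ds}\big[\nu p\bar A^0(\phi_t,p)+\kappa\max_{p'\in\mathcal P}f(\phi_t,p')+\nu\bar A^0(\phi_t,p)f(J^0(\phi_t,p),p)\big]dt,\quad \phi_t=\phi^p_t(\mu).$$ Fix an exact zero-quality desk selector $r(\cdot\mid\mu,p)$, i.e. a probability kernel supported on $\arg\max_{p'\in\mathcal P}\widetilde U^0(\mu,p')$. $V^0=V^{0,r}$ (strategic type's value) is the unique bounded solution of $$V(\mu,p)=\int_0^\infty e^{-\rho t-\int_0^t[\kappa+\nu A_L^0(\phi_s,p)]ds}\Big[\nu pA_L^0(\phi_t,p)+\kappa\sum_{p'}r(p'\mid\phi_t,p)V(\phi_t,p')+\nu A_L^0(\phi_t,p)V(J^0(\phi_t,p),p)\Big]dt.$$ High quality at $(\mu,p)$ is profitable for the strategic type if $\Gamma^0(\mu,p)>c$ and unprofitable if $\Gamma^0(\mu,p)<c$. A belief is upstream of $\mu_0$ if its zero-quality silence path (at price $p^i$) passes through $\mu_0$.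
   Formalization: The gain comparison is stated for μ0<1 (at μ0=1 both gains vanish although (∗) can hold); the open set is that of the conditions with p^i<p_D(μ0) and B_{p^i}>B_{p^r} strict, required for every exact selector, since with equality allowed the set is not open. *)

theory Defs
  imports "HOL-Probability.Probability"
begin

record economy =
  disc :: real        \<comment> \<open>discount rate \<open>\<rho>\<close>\<close>
  arrival :: real     \<comment> \<open>customer arrival rate \<open>\<nu>\<close>\<close>
  reset :: real       \<comment> \<open>price-reset rate \<open>\<kappa>\<close>\<close>
  hval :: real        \<comment> \<open>value of high quality \<open>v\<close>\<close>
  scale :: real       \<comment> \<open>logit scale \<open>\<zeta>\<close>\<close>
  cost :: real        \<comment> \<open>quality cost \<open>c\<close>\<close>
  precision :: real   \<comment> \<open>signal precision \<open>q\<close>\<close>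
  menu :: "real set"  \<comment> \<open>price menu\<close>

definition valid_economy :: "economy \<Rightarrow> bool" where
  "valid_economy E \<longleftrightarrow>
     0 < disc E \<and> 0 < arrival E \<and> 0 < reset E \<and> 0 < hval E \<and> 0 < scale E \<and> 0 < cost E \<and>
     1/2 < precision E \<and> precision E < 1 \<and>
     finite (menu E) \<and> menu E \<noteq> {} \<and> menu E \<subseteq> {0<..}"

section \<open>Static zero-quality objects\<close>

definition sig_gap :: "economy \<Rightarrow> real" where
  "sig_gap E = 2 * precision E - 1"

definition post_H :: "economy \<Rightarrow> real \<Rightarrow> real" where
  "post_H E l = precision E * l / ((1 - precision E) + sig_gap E * l)"

definition post_L :: "economy \<Rightarrow> real \<Rightarrow> real" where
  "post_L E l = (1 - precision E) * l / (precision E - sig_gap E * l)"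

definition logistic :: "real \<Rightarrow> real" where
  "logistic z = exp z / (1 + exp z)"

definition buy_H :: "economy \<Rightarrow> real \<Rightarrow> real \<Rightarrow> real" where
  "buy_H E l p = logistic ((hval E * post_H E l - p) / scale E)"

definition buy_L :: "economy \<Rightarrow> real \<Rightarrow> real \<Rightarrow> real" where
  "buy_L E l p = logistic ((hval E * post_L E l - p) / scale E)"

definition price_D :: "economy \<Rightarrow> real \<Rightarrow> real" where
  "price_D E \<mu> = hval E / 2 * (post_H E \<mu> + post_L E \<mu>)"

definition A_H :: "economy \<Rightarrow> real \<Rightarrow> real \<Rightarrow> real" where
  "A_H E \<mu> p = precision E * buy_H E \<mu> p + (1 - precision E) * buy_L E \<mu> p"

definition A_L :: "economy \<Rightarrow> real \<Rightarrow> real \<Rightarrow> real" where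
  "A_L E \<mu> p = (1 - precision E) * buy_H E \<mu> p + precision E * buy_L E \<mu> p"

definition D0 :: "economy \<Rightarrow> real \<Rightarrow> real \<Rightarrow> real" where
  "D0 E \<mu> p = A_H E \<mu> p - A_L E \<mu> p"

definition A_bar :: "economy \<Rightarrow> real \<Rightarrow> real \<Rightarrow> real" where
  "A_bar E \<mu> p = A_L E \<mu> p + \<mu> * D0 E \<mu> p"

definition drift :: "economy \<Rightarrow> real \<Rightarrow> real \<Rightarrow> real" where
  "drift E \<mu> p = - arrival E * \<mu> * (1 - \<mu>) * D0 E \<mu> p"

definition J0 :: "economy \<Rightarrow> real \<Rightarrow> real \<Rightarrow> real" where
  "J0 E \<mu> p = \<mu> * A_H E \<mu> p / A_bar E \<mu> p"

section \<open>The silence path\<close>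

definition silence_solution :: "economy \<Rightarrow> real \<Rightarrow> real \<Rightarrow> (real \<Rightarrow> real) \<Rightarrow> bool" where
  "silence_solution E p \<mu> x \<longleftrightarrow>
     x 0 = \<mu> \<and>
     (\<forall>t\<ge>0. x t \<in> {0..1} \<and> (x has_real_derivative drift E (x t) p) (at t within {0..}))"

text \<open>\<open>silence E p t \<mu>\<close> is meaningful for \<open>t \<ge> 0\<close> and \<open>\<mu> \<in> {0..1}\<close>. Taking the description
  over values rather than over functions avoids a convention for solutions at negative times;
  the two value functions below are treated in the same way off \<open>{0..1} \<times> menu E\<close>.\<close>

definition silence :: "economy \<Rightarrow> real \<Rightarrow> real \<Rightarrow> real \<Rightarrow> real" where
  "silence E p t \<mu> = (THE y. \<exists>x. silence_solution E p \<mu> x \<and> y = x t)"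

definition upstream :: "economy \<Rightarrow> real \<Rightarrow> real \<Rightarrow> real \<Rightarrow> bool" where
  "upstream E p \<mu>' \<mu>\<^sub>0 \<longleftrightarrow> \<mu>' \<in> {0..1} \<and> (\<exists>t\<ge>0. silence E p t \<mu>' = \<mu>\<^sub>0)"

section \<open>Values\<close>

text \<open>Bounded fixed points are taken among functions that are Borel in the belief, so that the
  integrals in the fixed-point equations are genuine Lebesgue integrals (Isabelle's integral of a
  non-measurable function is \<open>0\<close> by convention).\<close>

definition bounded_value :: "economy \<Rightarrow> (real \<Rightarrow> real \<Rightarrow> real) \<Rightarrow> bool" where
  "bounded_value E f \<longleftrightarrow>
     (\<exists>K. \<forall>\<mu>\<in>{0..1}. \<forall>p\<in>menu E. \<bar>f \<mu> p\<bar> \<le> K) \<and>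
     (\<forall>p\<in>menu E. set_borel_measurable borel {0..1} (\<lambda>\<mu>. f \<mu> p))"

definition gross_op :: "economy \<Rightarrow> (real \<Rightarrow> real \<Rightarrow> real) \<Rightarrow> real \<Rightarrow> real \<Rightarrow> real" where
  "gross_op E f \<mu> p =
     (LBINT t:{0..}.
        exp (- disc E * t - (LBINT s:{0..t}. reset E + arrival E * A_bar E (silence E p s \<mu>) p)) *
        (let \<phi> = silence E p t \<mu> in
           arrival E * p * A_bar E \<phi> p
           + reset E * Max ((\<lambda>p'. f \<phi> p') ` menu E)
           + arrival E * A_bar E \<phi> p * f (J0 E \<phi> p) p))"

definition gross_value :: "economy \<Rightarrow> real \<Rightarrow> real \<Rightarrow> real" where
  "gross_value E \<mu> p =
     (THE y. \<exists>f. bounded_value E f \<and>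
        (\<forall>\<mu>\<in>{0..1}. \<forall>p\<in>menu E. f \<mu> p = gross_op E f \<mu> p) \<and> y = f \<mu> p)"

definition argmax_on :: "('a \<Rightarrow> real) \<Rightarrow> 'a set \<Rightarrow> 'a set" where
  "argmax_on f S = {x. is_arg_max f (\<lambda>y. y \<in> S) x}"

definition uniquely_reset_optimal :: "economy \<Rightarrow> real \<Rightarrow> real \<Rightarrow> bool" where
  "uniquely_reset_optimal E \<mu> p \<longleftrightarrow> argmax_on (gross_value E \<mu>) (menu E) = {p}"

definition uniquely_myopic_optimal :: "economy \<Rightarrow> real \<Rightarrow> real \<Rightarrow> bool" where
  "uniquely_myopic_optimal E \<mu> p \<longleftrightarrow> argmax_on (\<lambda>p'. p' * A_bar E \<mu> p') (menu E) = {p}"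

definition desk_selector :: "economy \<Rightarrow> (real \<Rightarrow> real \<Rightarrow> real pmf) \<Rightarrow> bool" where
  "desk_selector E r \<longleftrightarrow>
     (\<forall>p\<in>menu E.
        (\<forall>\<mu>\<in>{0..1}. set_pmf (r \<mu> p) \<subseteq> argmax_on (gross_value E \<mu>) (menu E)) \<and>
        (\<forall>p'\<in>menu E. set_borel_measurable borel {0..1} (\<lambda>\<mu>. pmf (r \<mu> p) p')))"

definition strategic_op ::
  "economy \<Rightarrow> (real \<Rightarrow> real \<Rightarrow> real pmf) \<Rightarrow> (real \<Rightarrow> real \<Rightarrow> real) \<Rightarrow> real \<Rightarrow> real \<Rightarrow> real" where
  "strategic_op E r f \<mu> p =
     (LBINT t:{0..}.
        exp (- disc E * t - (LBINT s:{0..t}. reset E + arrival E * A_L E (silence E p s \<mu>) p)) *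
        (let \<phi> = silence E p t \<mu> in
           arrival E * p * A_L E \<phi> p
           + reset E * (\<Sum>p'\<in>menu E. pmf (r \<phi> p) p' * f \<phi> p')
           + arrival E * A_L E \<phi> p * f (J0 E \<phi> p) p))"

definition strategic_value ::
  "economy \<Rightarrow> (real \<Rightarrow> real \<Rightarrow> real pmf) \<Rightarrow> real \<Rightarrow> real \<Rightarrow> real" where
  "strategic_value E r \<mu> p =
     (THE y. \<exists>f. bounded_value E f \<and>
        (\<forall>\<mu>\<in>{0..1}. \<forall>p\<in>menu E. f \<mu> p = strategic_op E r f \<mu> p) \<and> y = f \<mu> p)"

definition B0 :: "economy \<Rightarrow> (real \<Rightarrow> real \<Rightarrow> real pmf) \<Rightarrow> real \<Rightarrow> real \<Rightarrow> real" where
  "B0 E r p \<mu> = p + strategic_value E r (J0 E \<mu> p) p - strategic_value E r \<mu> p"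

definition Gain0 :: "economy \<Rightarrow> (real \<Rightarrow> real \<Rightarrow> real pmf) \<Rightarrow> real \<Rightarrow> real \<Rightarrow> real" where
  "Gain0 E r \<mu> p = D0 E \<mu> p * B0 E r p \<mu>"

definition profitable :: "economy \<Rightarrow> (real \<Rightarrow> real \<Rightarrow> real pmf) \<Rightarrow> real \<Rightarrow> real \<Rightarrow> bool" where
  "profitable E r \<mu> p \<longleftrightarrow> Gain0 E r \<mu> p > cost E"

definition unprofitable :: "economy \<Rightarrow> (real \<Rightarrow> real \<Rightarrow> real pmf) \<Rightarrow> real \<Rightarrow> real \<Rightarrow> bool" where
  "unprofitable E r \<mu> p \<longleftrightarrow> Gain0 E r \<mu> p < cost E"

definition inherited_price_cond ::
  "economy \<Rightarrow> (real \<Rightarrow> real \<Rightarrow> real pmf) \<Rightarrow> real \<Rightarrow> real \<Rightarrow> real \<Rightarrow> bool" where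
  "inherited_price_cond E r \<mu>\<^sub>0 p_i p_r \<longleftrightarrow>
     p_r < p_i \<and> p_i \<le> price_D E \<mu>\<^sub>0 \<and> B0 E r p_i \<mu>\<^sub>0 \<ge> B0 E r p_r \<mu>\<^sub>0 \<and> B0 E r p_r \<mu>\<^sub>0 > 0"

definition strict_inherited_price_cond ::
  "economy \<Rightarrow> (real \<Rightarrow> real \<Rightarrow> real pmf) \<Rightarrow> real \<Rightarrow> real \<Rightarrow> real \<Rightarrow> bool" where
  "strict_inherited_price_cond E r \<mu>\<^sub>0 p_i p_r \<longleftrightarrow>
     p_r < p_i \<and> p_i < price_D E \<mu>\<^sub>0 \<and> B0 E r p_i \<mu>\<^sub>0 > B0 E r p_r \<mu>\<^sub>0 \<and> B0 E r p_r \<mu>\<^sub>0 > 0"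

section \<open>The zero-quality process\<close>

text \<open>The process on states \<open>(\<mu>, p)\<close> is built from independent noise. The \<open>n\<close>-th inter-event
  period uses \<open>\<omega> n = (\<tau>, e, u)\<close>: \<open>\<tau>\<close>, exponential of rate \<open>\<kappa>\<close>, is the time to the next reset;
  \<open>e\<close>, unit exponential, is the cumulated intensity at which the next purchase arrives, so that
  purchases have intensity \<open>\<nu> A_bar\<close> along the silence path; the earlier of the two occurs.
  The uniform \<open>u\<close> draws the price at a reset by inverting the distribution function of the desk
  selector.\<close>

type_synonym noise = "nat \<Rightarrow> real \<times> real \<times> real"

definition noise_space :: "economy \<Rightarrow> noise measure" where
  "noise_space E = PiM UNIV (\<lambda>_.
     density lborel (exponential_density (reset E)) \<Otimes>\<^sub>M
     (density lborel (exponential_density 1) \<Otimes>\<^sub>M uniform_measure lborel {0<..<1}))"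

definition purchase_time :: "economy \<Rightarrow> real \<times> real \<Rightarrow> real \<Rightarrow> real" where
  "purchase_time E z e =
     (case z of (\<mu>, p) \<Rightarrow>
        Inf {t. 0 \<le> t \<and> e \<le> (LBINT s:{0..t}. arrival E * A_bar E (silence E p s \<mu>) p)})"

definition draw_price ::
  "economy \<Rightarrow> (real \<Rightarrow> real \<Rightarrow> real pmf) \<Rightarrow> real \<Rightarrow> real \<Rightarrow> real \<Rightarrow> real" where
  "draw_price E r \<mu> p u = Min {p' \<in> menu E. u \<le> measure_pmf.prob (r \<mu> p) {..p'}}"

definition holding_time :: "economy \<Rightarrow> real \<times> real \<Rightarrow> real \<times> real \<times> real \<Rightarrow> real" where
  "holding_time E z w = (case w of (\<tau>, e, u) \<Rightarrow> min \<tau> (purchase_time E z e))"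

definition after_event ::
  "economy \<Rightarrow> (real \<Rightarrow> real \<Rightarrow> real pmf) \<Rightarrow> real \<times> real \<Rightarrow> real \<times> real \<times> real \<Rightarrow> real \<times> real" where
  "after_event E r z w =
     (case z of (\<mu>, p) \<Rightarrow> case w of (\<tau>, e, u) \<Rightarrow>
        let \<mu>' = silence E p (holding_time E z w) \<mu> in
          if \<tau> \<le> purchase_time E z e then (\<mu>', draw_price E r \<mu>' p u) else (J0 E \<mu>' p, p))"

primrec event ::
  "economy \<Rightarrow> (real \<Rightarrow> real \<Rightarrow> real pmf) \<Rightarrow> real \<times> real \<Rightarrow> noise \<Rightarrow> nat \<Rightarrow> real \<times> (real \<times> real)" where
  "event E r z \<omega> 0 = (0, z)"
| "event E r z \<omega> (Suc n) =
     (case event E r z \<omega> n of (T, y) \<Rightarrow> (T + holding_time E y (\<omega> n), after_event E r y (\<omega> n)))"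

text \<open>Event intensities are at most \<open>\<kappa> + \<nu>\<close>, so that almost surely every \<open>t \<ge> 0\<close> precedes some
  event and the least number below exists.\<close>

definition zq_process ::
  "economy \<Rightarrow> (real \<Rightarrow> real \<Rightarrow> real pmf) \<Rightarrow> real \<times> real \<Rightarrow> real \<Rightarrow> noise \<Rightarrow> real \<times> real" where
  "zq_process E r z t \<omega> =
     (case event E r z \<omega> (LEAST n. t < fst (event E r z \<omega> (Suc n))) of
        (T, (\<mu>, p)) \<Rightarrow> (silence E p (t - T) \<mu>, p))"

text \<open>The hitting event contains a measurable event of positive probability; this does not
  presuppose that the hitting event itself, which involves uncountably many times, is measurable.\<close>

definition reached_with_positive_prob ::
  "economy \<Rightarrow> (real \<Rightarrow> real \<Rightarrow> real pmf) \<Rightarrow> real \<times> real \<Rightarrow> (real \<times> real) set \<Rightarrow> bool" where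
  "reached_with_positive_prob E r z N \<longleftrightarrow>
     (\<exists>S\<in>sets (noise_space E). measure (noise_space E) S > 0 \<and>
        (\<forall>\<omega>\<in>S. \<exists>t\<ge>0. zq_process E r z t \<omega> \<in> N))"

section \<open>The space of economies\<close>

text \<open>Economies with an \<open>n\<close>-element menu are parametrised by their seven scalar primitives and
  the vector of prices, with \<open>n = CARD('k)\<close>; the topology is the Euclidean one. Perturbations
  therefore move every primitive, prices included, while the number of prices is fixed.\<close>

type_synonym 'k econ_param =
  "real \<times> real \<times> real \<times> real \<times> real \<times> real \<times> real \<times> (real ^ 'k)"

definition econ_prices :: "'k::finite econ_param \<Rightarrow> real ^ 'k" where
  "econ_prices e = (case e of (\<rho>, \<nu>, \<kappa>, v, \<zeta>, c, q, x) \<Rightarrow> x)"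

definition economy_of :: "'k::finite econ_param \<Rightarrow> economy" where
  "economy_of e = (case e of (\<rho>, \<nu>, \<kappa>, v, \<zeta>, c, q, x) \<Rightarrow>
     \<lparr>disc = \<rho>, arrival = \<nu>, reset = \<kappa>, hval = v, scale = \<zeta>, cost = c, precision = q,
      menu = range (\<lambda>k. x $ k)\<rparr>)"

definition valid_param :: "'k::finite econ_param \<Rightarrow> bool" where
  "valid_param e \<longleftrightarrow> valid_economy (economy_of e) \<and> inj (\<lambda>k. econ_prices e $ k)"

text \<open>The conditions, with the weak inequalities made strict (in case of equality they need
  not be stable under perturbation), and for every exact selector, since the selector varies with
  the economy.\<close>

definition robust_conditions ::
  "'k::finite econ_param \<Rightarrow> real \<Rightarrow> 'k \<Rightarrow> 'k \<Rightarrow> bool" where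
  "robust_conditions e \<mu>\<^sub>0 i j \<longleftrightarrow>
     (let E = economy_of e; p_i = econ_prices e $ i; p_r = econ_prices e $ j in
        valid_param e \<and> uniquely_reset_optimal E \<mu>\<^sub>0 p_r \<and>
        (\<forall>r. desk_selector E r \<longrightarrow> strict_inherited_price_cond E r \<mu>\<^sub>0 p_i p_r))"

definition robust_upstream_conditions ::
  "'k::finite econ_param \<Rightarrow> real \<Rightarrow> real \<Rightarrow> 'k \<Rightarrow> 'k \<Rightarrow> bool" where
  "robust_upstream_conditions e \<mu>' \<mu>\<^sub>0 i j \<longleftrightarrow>
     (let E = economy_of e; p_i = econ_prices e $ i in
        robust_conditions e \<mu>\<^sub>0 i j \<and> upstream E p_i \<mu>' \<mu>\<^sub>0 \<and> uniquely_reset_optimal E \<mu>' p_i)"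

end

theory Submission
  imports Defs "HOL-Complex_Analysis.Great_Picard"
begin

text \<open>Writing both purchase probabilities through half-sums and half-differences of the two utilities,
  \<open>D0 = d sinh \<delta> / (cosh m + cosh \<delta>)\<close>, where \<open>\<delta>\<close> does not depend on the price and
  \<open>m = (price_D - p) / \<zeta>\<close>; hence \<open>D0\<close> increases in the price up to \<open>price_D\<close>, which gives the
  gain comparison. The silence path is solved by separation of variables, and both values are fixed
  points of contractions along it. Openness rests on the continuity of the gross value in the
  primitives and on the weak-* compactness of desk selectors: a sequence of violating selectors has a
  limit selector of the limit economy, along which the strategic values converge. For large
  \<open>\<rho>\<close>, \<open>\<rho>\<close> times the gross value tends to the flow revenue and strategic values vanish.\<close>


section \<open>Purchase probabilities\<close>

text \<open>The obstacle is openness. Selectors may jump wherever prices tie, so strategic values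
  need not be continuous in the belief, and selectors of nearby economies need not be close at a
  given belief. Yet a selector enters a value only through time integrals along silence paths.
  Interior paths move, and the clock converts time into belief with density 1 / speed; weak
  convergence in the belief therefore suffices even though the path itself varies with the economy.
  At a resting belief this conversion breaks down. Belief 0 is excluded because
  \<open>price_D\<close> vanishes there while prices are positive; at belief 1 a purchase leaves the
  belief unchanged, so under every selector the benefit of a purchase is the price itself. Hence
  stability is proved separately on the open unit interval and on {1}. Since strategic values are
  compared along sequences only, the contraction argument runs on asymptotic gaps instead of a
  supremum norm. Compactness is called for by the quantifier over all selectors: when the conditions
  fail, each economy supplies its own violating selector.\<close>

lemma valid_economyD:
  assumes "valid_economy E"
  shows "0 < disc E" "0 < arrival E" "0 < reset E" "0 < hval E" "0 < scale E" "0 < cost E"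
    "1/2 < precision E" "precision E < 1" "finite (menu E)" "menu E \<noteq> {}"
    "\<And>p. p \<in> menu E \<Longrightarrow> 0 < p" "0 < precision E" "0 < sig_gap E" "sig_gap E < 1"
  using assms unfolding valid_economy_def sig_gap_def by (auto simp: subset_iff)

lemma logistic_pos: "0 < logistic z" and logistic_less_1: "logistic z < 1"
  unfolding logistic_def by (auto simp: divide_simps add_pos_pos)

lemma logistic_strict_mono: "x < y \<Longrightarrow> logistic x < logistic y"
  unfolding logistic_def by (simp add: divide_simps add_pos_pos algebra_simps)

text \<open>In x = exp (a/2) and y = exp (b/2) both sides are rational, and the denominator on the
  right is (1 + x^2) (1 + y^2) / (2 x y). The identity separates half-sum from half-difference: a
  common shift of a and b, such as a price, enters only the half-sum.\<close>

lemma logistic_diff: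
  "logistic a - logistic b = sinh ((a - b)/2) / (cosh ((a + b)/2) + cosh ((a - b)/2))"
proof -
  define x y where "x = exp (a/2)" and "y = exp (b/2)"
  have [simp]: "x > 0" "y > 0" by (auto simp: x_def y_def)
  have a: "exp a = x^2" "exp b = y^2"
    by (auto simp: x_def y_def power2_eq_square simp flip: exp_add)
  have e: "exp ((a-b)/2) = x/y" "exp ((a+b)/2) = x*y" "exp (-((a-b)/2)) = y/x" "exp (-((a+b)/2)) = 1/(x*y)"
    by (auto simp: x_def y_def exp_minus field_simps simp flip: exp_add exp_diff)
  have "cosh ((a + b)/2) + cosh ((a - b)/2) = (1 + x^2) * (1 + y^2) / (2*x*y)"
  proof -
    have nz: "x \<noteq> 0" "y \<noteq> 0" by (simp_all add: less_imp_neq[symmetric])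
    have "x * y + 1/(x*y) + (x/y + y/x) = (1 + x^2) * (1 + y^2) / (x*y)"
      using nz by (simp add: divide_simps power2_eq_square) (simp add: algebra_simps)
    then have "(x * y + 1/(x*y) + (x/y + y/x)) / 2 = (1 + x^2) * (1 + y^2) / (2*x*y)" by simp
    then show ?thesis unfolding cosh_def e by (simp add: add_divide_distrib)
  qed
  moreover have "sinh ((a - b)/2) = (x^2 - y^2) / (2*x*y)"
  proof -
    have nz: "x \<noteq> 0" "y \<noteq> 0" by (simp_all add: less_imp_neq[symmetric])
    have "x / y - y / x = (x^2 - y^2) / (x*y)"
      using nz by (simp add: divide_simps power2_eq_square)
    then have "(x / y - y / x) / 2 = (x^2 - y^2) / (2*x*y)" by simp
    then show ?thesis unfolding sinh_def e by (simp add: diff_divide_distrib)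
  qed
  moreover have "1 + x^2 \<noteq> 0" "1 + y^2 \<noteq> 0" by (simp_all add: add_pos_nonneg less_imp_neq[symmetric])
  moreover from calculation(3,4)
  have "x\<^sup>2 / (1 + x\<^sup>2) - y\<^sup>2 / (1 + y\<^sup>2) = (x\<^sup>2 - y\<^sup>2) / ((1 + x\<^sup>2) * (1 + y\<^sup>2))"
    by (simp add: divide_simps) (simp add: algebra_simps)
  moreover have "u / (2*x*y) / (w / (2*x*y)) = u / w" for u w :: real
    by (simp add: less_imp_neq[symmetric])
  ultimately show ?thesis unfolding logistic_def a by (simp only: not_False_eq_True)
qed

lemma sinh_real_ge: "0 \<le> x \<Longrightarrow> x \<le> sinh x" for x :: real
proof -
  assume "0 \<le> x"
  then have "sinh 0 - 0 \<le> sinh x - x"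
  proof (rule DERIV_nonneg_imp_nondecreasing[of 0 x "\<lambda>x. sinh x - x"])
    fix t :: real
    have "((\<lambda>x. sinh x - x) has_real_derivative cosh t - 1) (at t)"
      by (auto intro!: derivative_eq_intros)
    then show "\<exists>y. ((\<lambda>x. sinh x - x) has_real_derivative y) (at t) \<and> 0 \<le> y"
      using cosh_real_ge_1[of t] by (intro exI conjI) auto
  qed
  then show ?thesis by simp
qed

section \<open>The demand gap and its dependence on belief and price\<close>

lemma D0_alt: "D0 E \<mu> p = sig_gap E * (buy_H E \<mu> p - buy_L E \<mu> p)"
  unfolding D0_def A_H_def A_L_def sig_gap_def by (simp add: algebra_simps)

context
  fixes E and \<mu> :: real assumes E: "valid_economy E" and \<mu>: "\<mu> \<in> {0..1}"
begin

text \<open>The denominators are the total probabilities of the two signals: they sum to 1 and are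
  affine in \<mu>, with values between 1 - q and q.\<close>

lemma post_denominators:
  "0 < (1 - precision E) + sig_gap E * \<mu>" "0 < precision E - sig_gap E * \<mu>"
proof -
  have "sig_gap E * \<mu> \<le> sig_gap E" using \<mu> valid_economyD(13)[OF E] by (simp add: mult_left_le)
  moreover have "0 \<le> sig_gap E * \<mu>" using \<mu> valid_economyD(13)[OF E] by simp
  ultimately show "0 < (1 - precision E) + sig_gap E * \<mu>" "0 < precision E - sig_gap E * \<mu>"
    using valid_economyD(8)[OF E] by (auto simp: sig_gap_def)
qed

lemma post_gap:
  "post_H E \<mu> - post_L E \<mu> =
     sig_gap E * \<mu> * (1 - \<mu>) / (((1 - precision E) + sig_gap E * \<mu>) * (precision E - sig_gap E * \<mu>))"
proof -
  define X where "X = (1 - precision E) + sig_gap E * \<mu>"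
  define Y where "Y = precision E - sig_gap E * \<mu>"
  have "X \<noteq> 0" "Y \<noteq> 0" using post_denominators by (auto simp: X_def Y_def)
  then have "post_H E \<mu> - post_L E \<mu> = (precision E * \<mu> * Y - (1 - precision E) * \<mu> * X) / (X * Y)"
    unfolding post_H_def post_L_def X_def[symmetric] Y_def[symmetric] by (simp add: field_simps)
  also have "precision E * \<mu> * Y - (1 - precision E) * \<mu> * X = sig_gap E * \<mu> * (1 - \<mu>)"
    unfolding X_def Y_def sig_gap_def by (simp add: algebra_simps)
  finally show ?thesis by (simp add: X_def Y_def)
qed

text \<open>The denominator in \<open>post_gap\<close> is a product of two positive numbers with sum
  1, hence at most 1/4.\<close>

lemma post_gap_ge: "4 * sig_gap E * \<mu> * (1 - \<mu>) \<le> post_H E \<mu> - post_L E \<mu>"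
proof -
  define X where "X = (1 - precision E) + sig_gap E * \<mu>"
  have X: "precision E - sig_gap E * \<mu> = 1 - X" "0 < X" "0 < 1 - X"
    using post_denominators by (auto simp: X_def)
  have "0 \<le> (1 - 2*X)^2" by simp
  then have "4 * (X * (1 - X)) \<le> 1" by (simp add: power2_eq_square algebra_simps)
  moreover have "0 \<le> sig_gap E * \<mu> * (1 - \<mu>)" using \<mu> valid_economyD[OF E] by simp
  ultimately have "(sig_gap E * \<mu> * (1 - \<mu>)) * (4 * (X * (1 - X))) \<le> sig_gap E * \<mu> * (1 - \<mu>)"
    by (simp add: mult_left_le)
  then have "4 * sig_gap E * \<mu> * (1 - \<mu>) * (X * (1 - X)) \<le> sig_gap E * \<mu> * (1 - \<mu>)"
    by (simp only: mult_ac)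
  then show ?thesis
    unfolding post_gap X X_def[symmetric] using X by (subst pos_le_divide_eq) auto
qed

lemma post_H_range: "post_H E \<mu> \<in> {0..1}" and post_L_range: "post_L E \<mu> \<in> {0..1}"
proof -
  have "precision E * \<mu> \<le> (1 - precision E) + sig_gap E * \<mu>"
    using mult_nonneg_nonneg[of "1 - precision E" "1 - \<mu>"] \<mu> valid_economyD(8)[OF E]
    by (simp add: sig_gap_def algebra_simps)
  then show "post_H E \<mu> \<in> {0..1}"
    using post_denominators \<mu> valid_economyD[OF E] by (auto simp: post_H_def)
  have "(1 - precision E) * \<mu> \<le> precision E - sig_gap E * \<mu>"
    using mult_nonneg_nonneg[of "precision E" "1 - \<mu>"] \<mu> valid_economyD(12)[OF E]
    by (simp add: sig_gap_def algebra_simps)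
  then show "post_L E \<mu> \<in> {0..1}"
    using post_denominators \<mu> valid_economyD[OF E] by (auto simp: post_L_def)
qed

lemma D0_eq:
  "D0 E \<mu> p = sig_gap E * (sinh (hval E * (post_H E \<mu> - post_L E \<mu>) / (2 * scale E)) /
     (cosh ((price_D E \<mu> - p) / scale E) + cosh (hval E * (post_H E \<mu> - post_L E \<mu>) / (2 * scale E))))"
proof -
  have "scale E \<noteq> 0" using valid_economyD(5)[OF E] by simp
  then have "((hval E * post_H E \<mu> - p) / scale E - (hval E * post_L E \<mu> - p) / scale E) / 2
      = hval E * (post_H E \<mu> - post_L E \<mu>) / (2 * scale E)"
    "((hval E * post_H E \<mu> - p) / scale E + (hval E * post_L E \<mu> - p) / scale E) / 2
      = (price_D E \<mu> - p) / scale E"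
    by (simp_all add: field_simps price_D_def)
  then show ?thesis
    unfolding D0_alt buy_H_def buy_L_def logistic_diff by (simp only:)
qed

text \<open>\<open>price_D\<close> lies in [0, v], so both hyperbolic cosines in the formula for
  \<open>D0\<close> are bounded uniformly in the belief; with sinh \<delta> \<ge> \<delta> and
  \<open>post_gap_ge\<close> only the factor \<mu> (1 - \<mu>) still depends on the belief.\<close>

lemma D0_lower:
  "2 * (sig_gap E)\<^sup>2 * hval E / (scale E * (cosh ((hval E + \<bar>p\<bar>) / scale E) + cosh (hval E / (2 * scale E))))
     * (\<mu> * (1 - \<mu>)) \<le> D0 E \<mu> p"
proof -
  note v = valid_economyD[OF E]
  define \<delta> where "\<delta> = hval E * (post_H E \<mu> - post_L E \<mu>) / (2 * scale E)"
  define C where "C = cosh ((hval E + \<bar>p\<bar>) / scale E) + cosh (hval E / (2 * scale E))"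
  have g0: "0 \<le> post_H E \<mu> - post_L E \<mu>"
    by (rule order_trans[OF _ post_gap_ge]) (use \<mu> v in simp)
  have \<delta>0: "0 \<le> \<delta>" using g0 v by (simp add: \<delta>_def)
  have pd: "0 \<le> price_D E \<mu>" "price_D E \<mu> \<le> hval E"
  proof -
    have "0 \<le> post_H E \<mu> + post_L E \<mu>" "post_H E \<mu> + post_L E \<mu> \<le> 2"
      using post_H_range post_L_range by auto
    then have "hval E * (post_H E \<mu> + post_L E \<mu>) \<le> hval E * 2" "0 \<le> hval E * (post_H E \<mu> + post_L E \<mu>)"
      using v by (auto intro: mult_left_mono)
    then show "0 \<le> price_D E \<mu>" "price_D E \<mu> \<le> hval E" by (auto simp: price_D_def)
  qed
  have c1: "cosh ((price_D E \<mu> - p) / scale E) \<le> cosh ((hval E + \<bar>p\<bar>) / scale E)"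
  proof -
    have "\<bar>price_D E \<mu> - p\<bar> \<le> hval E + \<bar>p\<bar>" using pd by simp
    then have "\<bar>(price_D E \<mu> - p) / scale E\<bar> \<le> (hval E + \<bar>p\<bar>) / scale E"
      using v by (simp add: divide_right_mono)
    then have "cosh \<bar>(price_D E \<mu> - p) / scale E\<bar> \<le> cosh ((hval E + \<bar>p\<bar>) / scale E)"
      using v by (subst cosh_real_nonneg_le_iff) auto
    then show ?thesis by (simp only: cosh_real_abs)
  qed
  have c2: "cosh \<delta> \<le> cosh (hval E / (2 * scale E))"
  proof -
    have "hval E * (post_H E \<mu> - post_L E \<mu>) \<le> hval E * 1"
      using post_H_range post_L_range v by (intro mult_left_mono) auto
    then have "\<delta> \<le> hval E / (2 * scale E)" unfolding \<delta>_def using v by (intro divide_right_mono) auto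
    then show ?thesis using \<delta>0 by (subst cosh_real_nonneg_le_iff) auto
  qed
  have s: "\<delta> \<le> sinh \<delta>"
    by (rule sinh_real_ge) (use \<delta>0 in simp)
  have Cp: "0 < cosh ((price_D E \<mu> - p) / scale E) + cosh \<delta>" by (intro add_pos_pos) auto
  have "2 * sig_gap E * hval E / scale E * (\<mu> * (1-\<mu>)) / C \<le> \<delta> / C"
  proof (rule divide_right_mono)
    have "hval E / (2 * scale E) * (4 * sig_gap E * \<mu> * (1 - \<mu>)) \<le> hval E / (2 * scale E) * (post_H E \<mu> - post_L E \<mu>)"
      using post_gap_ge v by (intro mult_left_mono) auto
    moreover have "hval E / (2 * scale E) * (4 * sig_gap E * \<mu> * (1 - \<mu>)) = 2 * sig_gap E * hval E / scale E * (\<mu> * (1-\<mu>))"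
      by simp
    ultimately show "2 * sig_gap E * hval E / scale E * (\<mu> * (1-\<mu>)) \<le> \<delta>"
      by (simp only: \<delta>_def times_divide_eq_left)
  qed (simp add: C_def)
  also have "\<delta> / C \<le> sinh \<delta> / (cosh ((price_D E \<mu> - p) / scale E) + cosh \<delta>)"
    by (rule frac_le) (use \<delta>0 s Cp c1 c2 in \<open>auto simp: C_def\<close>)
  finally have "sig_gap E * (2 * sig_gap E * hval E / scale E * (\<mu> * (1-\<mu>)) / C) \<le> D0 E \<mu> p"
    unfolding D0_eq \<delta>_def[symmetric] using v by (intro mult_left_mono) auto
  then show ?thesis by (simp add: C_def power2_eq_square mult_ac)
qed

end

text \<open>The belief-free factor of \<open>D0_lower\<close>. It depends continuously on economy
  and price, which makes bounds on 1 / speed uniform along convergent sequences of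
  economies.\<close>

definition gap_const :: "economy \<Rightarrow> real \<Rightarrow> real" where
  "gap_const E p = 2 * (sig_gap E)\<^sup>2 * hval E /
     (scale E * (cosh ((hval E + \<bar>p\<bar>) / scale E) + cosh (hval E / (2 * scale E))))"

lemma gap_const_pos: "valid_economy E \<Longrightarrow> 0 < gap_const E p"
  unfolding gap_const_def using valid_economyD[of E]
  by (intro divide_pos_pos mult_pos_pos add_pos_pos) auto

lemma D0_ge_gap_const:
  "valid_economy E \<Longrightarrow> \<mu> \<in> {0..1} \<Longrightarrow> gap_const E p * (\<mu> * (1 - \<mu>)) \<le> D0 E \<mu> p"
  unfolding gap_const_def by (rule D0_lower)

text \<open>Below \<open>price_D\<close>, a higher price moves the mean utility towards 0, where
  purchases respond most strongly to the signal. An interior belief makes \<delta> positive, hence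
  the inequality strict.\<close>

lemma D0_strict_mono_price:
  assumes E: "valid_economy E" and \<mu>: "0 < \<mu>" "\<mu> < 1" and p: "p < p'" "p' \<le> price_D E \<mu>"
  shows "D0 E \<mu> p < D0 E \<mu> p'"
proof -
  note v = valid_economyD[OF E]
  have \<mu>': "\<mu> \<in> {0..1}" using \<mu> by simp
  define \<delta> where "\<delta> = hval E * (post_H E \<mu> - post_L E \<mu>) / (2 * scale E)"
  have "0 < 4 * sig_gap E * \<mu> * (1 - \<mu>)" using v \<mu> by simp
  also note post_gap_ge[OF E \<mu>']
  finally have \<delta>0: "0 < \<delta>" using v by (simp add: \<delta>_def)
  have "(price_D E \<mu> - p') / scale E < (price_D E \<mu> - p) / scale E" "0 \<le> (price_D E \<mu> - p') / scale E"
    using v p by (auto simp: divide_strict_right_mono)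
  then have "cosh ((price_D E \<mu> - p') / scale E) < cosh ((price_D E \<mu> - p) / scale E)"
    by (subst cosh_real_nonneg_less_iff) auto
  then have "sinh \<delta> / (cosh ((price_D E \<mu> - p) / scale E) + cosh \<delta>) < sinh \<delta> / (cosh ((price_D E \<mu> - p') / scale E) + cosh \<delta>)"
    using \<delta>0 by (intro divide_strict_left_mono mult_pos_pos add_pos_pos) auto
  then show ?thesis
    unfolding D0_eq[OF E \<mu>'] \<delta>_def[symmetric] using v by (intro mult_strict_left_mono) auto
qed

lemma D0_pos: "valid_economy E \<Longrightarrow> 0 < \<mu> \<Longrightarrow> \<mu> < 1 \<Longrightarrow> 0 < D0 E \<mu> p"
  by (rule less_le_trans[OF _ D0_ge_gap_const]) (auto simp: gap_const_pos)

lemma D0_nonneg: "valid_economy E \<Longrightarrow> \<mu> \<in> {0..1} \<Longrightarrow> 0 \<le> D0 E \<mu> p"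
  by (rule order_trans[OF _ D0_ge_gap_const]) (auto simp: gap_const_pos less_imp_le)

section \<open>Bounds on demands and on the belief after a purchase\<close>

lemma buy_bounds: "0 < buy_H E \<mu> p" "buy_H E \<mu> p < 1" "0 < buy_L E \<mu> p" "buy_L E \<mu> p < 1"
  unfolding buy_H_def buy_L_def using logistic_pos logistic_less_1 by auto

lemma A_bounds:
  assumes E: "valid_economy E"
  shows "0 < A_H E \<mu> p" "A_H E \<mu> p < 1" "0 < A_L E \<mu> p" "A_L E \<mu> p < 1" "D0 E \<mu> p < 1"
proof -
  note v = valid_economyD[OF E] and b = buy_bounds[of E \<mu> p]
  have *: "w * x + (1 - w) * y < 1" if "0 < w" "w < 1" "x < 1" "y < 1" for w x y :: real
  proof -
    have "w * x + (1 - w) * y < w * 1 + (1 - w) * 1"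
      using that by (intro add_strict_mono mult_strict_left_mono) auto
    then show ?thesis by simp
  qed
  show "0 < A_H E \<mu> p" "0 < A_L E \<mu> p"
    unfolding A_H_def A_L_def using v b by (auto intro!: add_pos_pos mult_pos_pos)
  then show "A_H E \<mu> p < 1" "A_L E \<mu> p < 1" "D0 E \<mu> p < 1"
    unfolding A_H_def A_L_def D0_def
    using *[of "precision E" "buy_H E \<mu> p" "buy_L E \<mu> p"] *[of "precision E" "buy_L E \<mu> p" "buy_H E \<mu> p"] v b
    by (auto simp: add.commute)
qed

lemma A_bar_alt: "A_bar E \<mu> p = (1 - \<mu>) * A_L E \<mu> p + \<mu> * A_H E \<mu> p"
  unfolding A_bar_def D0_def by (simp add: algebra_simps)

lemma A_bar_ge:
  assumes "valid_economy E" "\<mu> \<in> {0..1}"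
  shows "A_L E \<mu> p \<le> A_bar E \<mu> p"
  unfolding A_bar_def using D0_nonneg[OF assms] assms(2) by simp

lemma A_bar_bounds:
  assumes "valid_economy E" "\<mu> \<in> {0..1}"
  shows "0 < A_bar E \<mu> p" "A_bar E \<mu> p < 1"
proof -
  show "0 < A_bar E \<mu> p" using A_bar_ge[OF assms, of p] A_bounds(3)[OF assms(1), of \<mu> p] by linarith
  have "\<mu> * D0 E \<mu> p \<le> D0 E \<mu> p" using D0_nonneg[OF assms] assms by (simp add: mult_left_le_one_le)
  then show "A_bar E \<mu> p < 1" using A_bounds(2)[OF assms(1), of \<mu> p] unfolding A_bar_def D0_def by linarith
qed

lemma J0_range:
  assumes "valid_economy E" "\<mu> \<in> {0..1}"
  shows "J0 E \<mu> p \<in> {0..1}"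
proof -
  have "\<mu> * A_H E \<mu> p \<le> A_bar E \<mu> p"
    unfolding A_bar_alt using assms A_bounds[OF assms(1), of \<mu> p] by simp
  then show ?thesis
    unfolding J0_def using A_bar_bounds[OF assms, of p] A_bounds[OF assms(1), of \<mu> p] assms by auto
qed

lemma J0_interior:
  assumes "valid_economy E" "0 < \<mu>" "\<mu> < 1"
  shows "0 < J0 E \<mu> p" "J0 E \<mu> p < 1"
proof -
  have "\<mu> * A_H E \<mu> p < A_bar E \<mu> p"
    unfolding A_bar_alt using assms A_bounds[OF assms(1), of \<mu> p] by simp
  then show "0 < J0 E \<mu> p" "J0 E \<mu> p < 1"
    unfolding J0_def using A_bar_bounds[OF assms(1), of \<mu> p] A_bounds[OF assms(1), of \<mu> p] assms by auto
qed

lemma J0_endpoints: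
  assumes "valid_economy E"
  shows "J0 E 0 p = 0" "J0 E 1 p = 1"
  using A_bounds[OF assms, of 1 p] by (auto simp: J0_def A_bar_alt)

text \<open>Rules out belief 0 in the gain comparison, since no positive price is at most 0.\<close>

lemma price_D_0: "price_D E 0 = 0"
  by (simp add: price_D_def post_H_def post_L_def)

section \<open>Continuity in the primitives\<close>

text \<open>The scalars that enter the zero-quality objects are compared one by one; prices converge
  separately, by index, because a menu is a bare set.\<close>

definition econ_tendsto :: "('a \<Rightarrow> economy) \<Rightarrow> economy \<Rightarrow> 'a filter \<Rightarrow> bool" where
  "econ_tendsto Es E F \<longleftrightarrow>
     ((\<lambda>n. disc (Es n)) \<longlongrightarrow> disc E) F \<and> ((\<lambda>n. arrival (Es n)) \<longlongrightarrow> arrival E) F \<and>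
     ((\<lambda>n. reset (Es n)) \<longlongrightarrow> reset E) F \<and> ((\<lambda>n. hval (Es n)) \<longlongrightarrow> hval E) F \<and>
     ((\<lambda>n. scale (Es n)) \<longlongrightarrow> scale E) F \<and> ((\<lambda>n. precision (Es n)) \<longlongrightarrow> precision E) F"

lemma econ_tendsto_const [intro, simp]: "econ_tendsto (\<lambda>_. E) E F"
  by (simp add: econ_tendsto_def)

lemma econ_tendstoD:
  assumes "econ_tendsto Es E F"
  shows "((\<lambda>n. disc (Es n)) \<longlongrightarrow> disc E) F" "((\<lambda>n. arrival (Es n)) \<longlongrightarrow> arrival E) F"
     "((\<lambda>n. reset (Es n)) \<longlongrightarrow> reset E) F" "((\<lambda>n. hval (Es n)) \<longlongrightarrow> hval E) F"
     "((\<lambda>n. scale (Es n)) \<longlongrightarrow> scale E) F" "((\<lambda>n. precision (Es n)) \<longlongrightarrow> precision E) F"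
     "((\<lambda>n. sig_gap (Es n)) \<longlongrightarrow> sig_gap E) F"
  using assms unfolding econ_tendsto_def sig_gap_def by (auto intro!: tendsto_intros)

lemma tendsto_logistic [tendsto_intros]: "(f \<longlongrightarrow> l) F \<Longrightarrow> ((\<lambda>x. logistic (f x)) \<longlongrightarrow> logistic l) F"
  unfolding logistic_def by (intro tendsto_intros) (auto simp: add_pos_pos less_imp_neq[symmetric])

context
  fixes Es :: "'a \<Rightarrow> economy" and E F and \<mu>s :: "'a \<Rightarrow> real" and \<mu> :: real and ps :: "'a \<Rightarrow> real" and p :: real
  assumes Es: "econ_tendsto Es E F" and E: "valid_economy E"
    and \<mu>s: "(\<mu>s \<longlongrightarrow> \<mu>) F" and \<mu>: "\<mu> \<in> {0..1}"
begin

text \<open>In this context economy, belief and (from \<open>tendsto_buy\<close> on) price move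
  together along an arbitrary filter, so one family of lemmas yields both continuity in the belief,
  with constant economy, and continuity in the primitives.\<close>

lemma tendsto_post:
  "((\<lambda>n. post_H (Es n) (\<mu>s n)) \<longlongrightarrow> post_H E \<mu>) F" "((\<lambda>n. post_L (Es n) (\<mu>s n)) \<longlongrightarrow> post_L E \<mu>) F"
  unfolding post_H_def post_L_def
  by (intro tendsto_intros econ_tendstoD[OF Es] \<mu>s; use post_denominators[OF E \<mu>] in simp)+

lemma tendsto_price_D: "((\<lambda>n. price_D (Es n) (\<mu>s n)) \<longlongrightarrow> price_D E \<mu>) F"
  unfolding price_D_def by (intro tendsto_intros econ_tendstoD[OF Es] tendsto_post) auto

context
  assumes ps: "(ps \<longlongrightarrow> p) F"
begin

lemma tendsto_buy:
  "((\<lambda>n. buy_H (Es n) (\<mu>s n) (ps n)) \<longlongrightarrow> buy_H E \<mu> p) F"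
  "((\<lambda>n. buy_L (Es n) (\<mu>s n) (ps n)) \<longlongrightarrow> buy_L E \<mu> p) F"
  unfolding buy_H_def buy_L_def
  by (intro tendsto_intros econ_tendstoD[OF Es] tendsto_post ps; use valid_economyD(5)[OF E] in simp)+

lemma tendsto_A:
  "((\<lambda>n. A_H (Es n) (\<mu>s n) (ps n)) \<longlongrightarrow> A_H E \<mu> p) F"
  "((\<lambda>n. A_L (Es n) (\<mu>s n) (ps n)) \<longlongrightarrow> A_L E \<mu> p) F"
  unfolding A_H_def A_L_def
  by (intro tendsto_intros econ_tendstoD[OF Es] tendsto_buy)+

lemma tendsto_D0: "((\<lambda>n. D0 (Es n) (\<mu>s n) (ps n)) \<longlongrightarrow> D0 E \<mu> p) F"
  unfolding D0_def by (intro tendsto_intros tendsto_A)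

lemma tendsto_A_bar: "((\<lambda>n. A_bar (Es n) (\<mu>s n) (ps n)) \<longlongrightarrow> A_bar E \<mu> p) F"
  unfolding A_bar_def by (intro tendsto_intros tendsto_A tendsto_D0 \<mu>s)

lemma tendsto_J0: "((\<lambda>n. J0 (Es n) (\<mu>s n) (ps n)) \<longlongrightarrow> J0 E \<mu> p) F"
  unfolding J0_def using A_bar_bounds[OF E \<mu>, of p]
  by (intro tendsto_intros tendsto_A tendsto_A_bar \<mu>s) auto

lemma tendsto_gap_const: "((\<lambda>n. gap_const (Es n) (ps n)) \<longlongrightarrow> gap_const E p) F"
proof -
  have "cosh x + cosh y \<noteq> 0" for x y :: real
    by (intro less_imp_neq[symmetric] add_pos_pos) auto
  then show ?thesis
    unfolding gap_const_def using valid_economyD(5)[OF E]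
    by (intro tendsto_intros econ_tendstoD[OF Es] ps) auto
qed

end
end


section \<open>The silence flow\<close>

definition speed :: "economy \<Rightarrow> real \<Rightarrow> real \<Rightarrow> real" where
  "speed E p \<mu> = arrival E * \<mu> * (1 - \<mu>) * D0 E \<mu> p"

lemma drift_eq_speed: "drift E \<mu> p = - speed E p \<mu>"
  by (simp add: drift_def speed_def)

text \<open>Separation of variables: along an interior silence path the clock decreases at unit speed.\<close>

definition clock :: "economy \<Rightarrow> real \<Rightarrow> real \<Rightarrow> real" where
  "clock E p \<mu> = (LBINT z=ereal (1/2)..ereal \<mu>. 1 / speed E p z)"

lemma tendsto_speed:
  assumes "econ_tendsto Es E F" "valid_economy E" "(\<mu>s \<longlongrightarrow> \<mu>) F" "\<mu> \<in> {0..1}" "(ps \<longlongrightarrow> p) F"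
  shows "((\<lambda>n. speed (Es n) (ps n) (\<mu>s n)) \<longlongrightarrow> speed E p \<mu>) F"
  unfolding speed_def
  by (intro tendsto_intros tendsto_D0 econ_tendstoD[OF assms(1)] assms)

lemma speed_pos: "valid_economy E \<Longrightarrow> 0 < \<mu> \<Longrightarrow> \<mu> < 1 \<Longrightarrow> 0 < speed E p \<mu>"
  unfolding speed_def using D0_pos[of E \<mu> p] valid_economyD(2)[of E] by simp

lemma speed_nonneg: "valid_economy E \<Longrightarrow> \<mu> \<in> {0..1} \<Longrightarrow> 0 \<le> speed E p \<mu>"
  unfolding speed_def using D0_nonneg[of E \<mu> p] valid_economyD(2)[of E] by simp

lemma speed_endpoints [simp]: "speed E p 0 = 0" "speed E p 1 = 0"
  by (simp_all add: speed_def)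

text \<open>Dropping factors of at most 1 leaves one linearly vanishing factor at each end. These
  bounds yield the divergence of the clock and the growth estimates behind uniqueness.\<close>

lemma speed_le:
  assumes "valid_economy E" "\<mu> \<in> {0..1}"
  shows "speed E p \<mu> \<le> arrival E * \<mu>" "speed E p \<mu> \<le> arrival E * (1 - \<mu>)"
proof -
  have D: "0 \<le> D0 E \<mu> p" "D0 E \<mu> p \<le> 1"
    using D0_nonneg[OF assms] A_bounds(5)[OF assms(1), of \<mu> p] by (auto simp: less_imp_le)
  have "arrival E * \<mu> * ((1 - \<mu>) * D0 E \<mu> p) \<le> arrival E * \<mu> * 1"
    using assms valid_economyD(2)[OF assms(1)] D by (intro mult_left_mono mult_le_one) auto
  then show "speed E p \<mu> \<le> arrival E * \<mu>" by (simp add: speed_def mult.assoc)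
  have "arrival E * (1 - \<mu>) * (\<mu> * D0 E \<mu> p) \<le> arrival E * (1 - \<mu>) * 1"
    using assms valid_economyD(2)[OF assms(1)] D by (intro mult_left_mono mult_le_one) auto
  then show "speed E p \<mu> \<le> arrival E * (1 - \<mu>)" by (simp add: speed_def mult_ac)
qed

text \<open>One factor \<mu> (1 - \<mu>) comes from Bayesian updating, the other from
  \<open>D0_ge_gap_const\<close>. On compact subsets of (0, 1) this bounds 1 / speed.\<close>

lemma speed_ge:
  assumes "valid_economy E" "\<mu> \<in> {0..1}"
  shows "arrival E * gap_const E p * (\<mu> * (1 - \<mu>))\<^sup>2 \<le> speed E p \<mu>"
proof -
  have "(arrival E * \<mu> * (1 - \<mu>)) * (gap_const E p * (\<mu> * (1 - \<mu>))) \<le> (arrival E * \<mu> * (1 - \<mu>)) * D0 E \<mu> p"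
    using assms valid_economyD(2)[OF assms(1)] D0_ge_gap_const[OF assms] by (intro mult_left_mono) auto
  then show ?thesis by (simp add: speed_def power2_eq_square mult_ac)
qed

lemma continuous_on_speed:
  assumes "valid_economy E" "S \<subseteq> {0..1}"
  shows "continuous_on S (speed E p)"
  unfolding continuous_on_def
  by (auto intro!: tendsto_speed[of "\<lambda>_. E"] assms(1) subsetD[OF assms(2)] simp: tendsto_ident_at)

lemma continuous_on_inverse_speed:
  assumes "valid_economy E" "S \<subseteq> {0<..<1}"
  shows "continuous_on S (\<lambda>z. 1 / speed E p z)"
proof (intro continuous_intros continuous_on_speed assms)
  show "S \<subseteq> {0..1}" using assms(2) by force
  show "\<forall>x\<in>S. speed E p x \<noteq> 0"
  proof
    fix x assume "x \<in> S"
    then have "0 < x" "x < 1" using assms(2) by auto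
    then show "speed E p x \<noteq> 0" using speed_pos[OF assms(1), of x p] by simp
  qed
qed

lemma DERIV_clock:
  assumes E: "valid_economy E" and x: "0 < x" "x < 1"
  shows "(clock E p has_real_derivative 1 / speed E p x) (at x)"
proof -
  \<comment> \<open>A compact subinterval of (0, 1) having x in its interior and containing the base
    point 1/2 of the integral.\<close>
  define a b where "a = min x (1/2) / 2" and "b = (1 + max x (1/2)) / 2"
  have ab: "0 < a" "a < x" "x < b" "a \<le> 1/2" "1/2 \<le> b" "b < 1"
    using x by (auto simp: a_def b_def)
  have "((\<lambda>u. LBINT y=ereal (1/2)..ereal u. 1 / speed E p y) has_vector_derivative 1 / speed E p x) (at x within {a..b})"
    by (rule interval_integral_FTC2) (use ab in \<open>auto intro!: continuous_on_inverse_speed E\<close>)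
  moreover have "at x within {a..b} = at x"
    using ab by (intro at_within_interior) (auto simp: interior_atLeastAtMost_real)
  ultimately show ?thesis
    unfolding clock_def[abs_def] has_real_derivative_iff_has_vector_derivative by simp
qed

lemma clock_strict_mono:
  assumes E: "valid_economy E" and x: "0 < x" "x < y" "y < 1"
  shows "clock E p x < clock E p y"
proof (rule DERIV_pos_imp_increasing[OF x(2)])
  fix z assume "x \<le> z" "z \<le> y"
  then have z: "0 < z" "z < 1" using x by auto
  show "\<exists>d. (clock E p has_real_derivative d) (at z) \<and> 0 < d"
    using DERIV_clock[OF E z, of p] speed_pos[OF E z, of p] by (intro exI[of _ "1 / speed E p z"]) simp
qed

lemma clock_less_iff:
  assumes "valid_economy E" "0 < x" "x < 1" "0 < y" "y < 1"
  shows "clock E p x < clock E p y \<longleftrightarrow> x < y"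
  using clock_strict_mono[OF assms(1), of x y p] clock_strict_mono[OF assms(1), of y x p] assms
  by (cases x y rule: linorder_cases) auto

lemma continuous_on_clock: "valid_economy E \<Longrightarrow> continuous_on {0<..<1} (clock E p)"
  by (intro continuous_at_imp_continuous_on ballI DERIV_isCont[OF DERIV_clock]) auto

lemma clock_half [simp]: "clock E p (1/2) = 0"
  by (simp add: clock_def)

text \<open>The clock diverges at both ends because the speed vanishes at least linearly there.\<close>

lemma clock_surj:
  assumes E: "valid_economy E"
  shows "\<exists>x. 0 < x \<and> x < 1 \<and> clock E p x = s"
proof -
  note v = valid_economyD(2)[OF E]
  define \<nu> where "\<nu> = arrival E"
  \<comment> \<open>\<open>lo\<close> solves ln (2 lo) = - \<nu> |s|: comparing the clock with ln (2
    x) / \<nu> to the left of 1/2 gives a value of at most - |s| at \<open>lo\<close>, and the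
    mirror image gives at least |s| at 1 - \<open>lo\<close>.\<close>
  define lo where "lo = exp (- \<nu> * \<bar>s\<bar>) / 2"
  have lo: "0 < lo" "lo \<le> 1/2" using v by (auto simp: lo_def \<nu>_def)
  have hi1: "1 - lo < 1" "1/2 \<le> 1 - lo" using lo by auto
  have lnlo: "ln (2 * lo) = - \<nu> * \<bar>s\<bar>" by (simp add: lo_def)
  have "clock E p lo - ln (2 * lo) / \<nu> \<le> clock E p (1/2) - ln (2 * (1/2)) / \<nu>"
  proof (rule DERIV_nonneg_imp_nondecreasing[OF lo(2)])
    fix x assume x: "lo \<le> x" "x \<le> 1/2"
    have "((\<lambda>x. clock E p x - ln (2 * x) / \<nu>) has_real_derivative 1 / speed E p x - 1 / (\<nu> * x)) (at x)"
      using x lo v by (auto intro!: derivative_eq_intros DERIV_clock[OF E] simp: \<nu>_def field_simps)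
    moreover have "1 / (\<nu> * x) \<le> 1 / speed E p x"
      using speed_le(1)[OF E, of x p] speed_pos[OF E, of x p] x lo by (intro frac_le) (auto simp: \<nu>_def)
    ultimately show "\<exists>y. ((\<lambda>x. clock E p x - ln (2 * x) / \<nu>) has_real_derivative y) (at x) \<and> 0 \<le> y"
      by (intro exI conjI) auto
  qed
  then have l: "clock E p lo \<le> s" using v lnlo by (simp add: \<nu>_def)
  have "clock E p (1/2) + ln (2 * (1 - 1/2)) / \<nu> \<le> clock E p (1 - lo) + ln (2 * (1 - (1 - lo))) / \<nu>"
  proof (rule DERIV_nonneg_imp_nondecreasing[OF hi1(2)])
    fix x assume x: "1/2 \<le> x" "x \<le> 1 - lo"
    have "((\<lambda>x. clock E p x + ln (2 * (1 - x)) / \<nu>) has_real_derivative 1 / speed E p x + (- 2) / (2 * (1 - x)) / \<nu>) (at x)"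
      using x lo v by (auto intro!: derivative_eq_intros DERIV_clock[OF E] simp: \<nu>_def)
    moreover have "(- 2) / (2 * (1 - x)) / \<nu> = - (1 / (\<nu> * (1 - x)))"
    proof -
      have "(- 2) / (2 * (1 - x)) / \<nu> = (- 2) / (2 * (\<nu> * (1 - x)))" by (simp add: mult_ac)
      also have "\<dots> = - (1 / (\<nu> * (1 - x)))"
        using mult_divide_mult_cancel_left[of 2 "-1" "\<nu> * (1 - x)"] by (simp only: mult_minus_right mult_1_right minus_divide_left)
      finally show ?thesis .
    qed
    moreover have "1 / (\<nu> * (1 - x)) \<le> 1 / speed E p x"
      using speed_le(2)[OF E, of x p] speed_pos[OF E, of x p] x lo by (intro frac_le) (auto simp: \<nu>_def)
    ultimately show "\<exists>y. ((\<lambda>x. clock E p x + ln (2 * (1 - x)) / \<nu>) has_real_derivative y) (at x) \<and> 0 \<le> y"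
      by (intro exI[of _ "1 / speed E p x + (- 2) / (2 * (1 - x)) / \<nu>"] conjI) linarith+
  qed
  then have h: "s \<le> clock E p (1 - lo)" using v lnlo by (simp add: \<nu>_def)
  have "\<exists>x\<ge>lo. x \<le> 1 - lo \<and> clock E p x = s"
    by (rule IVT') (use l h lo hi1 in \<open>auto intro!: continuous_on_subset[OF continuous_on_clock[OF E]]\<close>)
  then obtain x where "lo \<le> x" "x \<le> 1 - lo" "clock E p x = s" by auto
  then show ?thesis using lo by (intro exI[of _ x]) auto
qed

definition unclock :: "economy \<Rightarrow> real \<Rightarrow> real \<Rightarrow> real" where
  "unclock E p s = (SOME x. 0 < x \<and> x < 1 \<and> clock E p x = s)"

lemma unclock:
  assumes E: "valid_economy E"
  shows "0 < unclock E p s" "unclock E p s < 1" "clock E p (unclock E p s) = s"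
  using someI_ex[OF clock_surj[OF E, of p s]] unfolding unclock_def by auto

lemma unclock_clock:
  assumes E: "valid_economy E" and "0 < x" "x < 1"
  shows "unclock E p (clock E p x) = x"
  using unclock[OF E, of p "clock E p x"] clock_less_iff[OF E] assms
  by (metis linorder_neqE_linordered_idom order_less_irrefl)

text \<open>Dominated convergence. Between 1/2 and x beliefs stay away from 0 and 1, so
  \<open>speed_ge\<close> bounds 1 / speed, uniformly in n because the reciprocals of
  \<open>g n\<close> converge to a finite limit.\<close>

lemma clock_tendsto_param:
  assumes Es: "econ_tendsto Es E sequentially" and vEs: "\<And>n. valid_economy (Es n)" and E: "valid_economy E"
    and ps: "ps \<longlonglongrightarrow> p" and x: "0 < x" "x < 1"
  shows "(\<lambda>n. clock (Es n) (ps n) x) \<longlonglongrightarrow> clock E p x"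
proof -
  define a b where "a = min x (1/2)" and "b = max x (1/2)"
  have ab: "0 < a" "a \<le> b" "b < 1" using x by (auto simp: a_def b_def)
  define g where "g n = arrival (Es n) * gap_const (Es n) (ps n)" for n
  have gp: "g n > 0" for n
    unfolding g_def using gap_const_pos[OF vEs] valid_economyD(2)[OF vEs] by simp
  have "g \<longlonglongrightarrow> arrival E * gap_const E p"
    unfolding g_def by (intro tendsto_intros econ_tendstoD[OF Es] tendsto_gap_const[OF Es E tendsto_const _ ps, of 0]) auto
  then have "(\<lambda>n. inverse (g n)) \<longlonglongrightarrow> inverse (arrival E * gap_const E p)"
    using gap_const_pos[OF E, of p] valid_economyD(2)[OF E] by (intro tendsto_inverse) auto
  then have "Bseq (\<lambda>n. inverse (g n))" using convergentI convergent_imp_Bseq by blast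
  then obtain K where K: "K > 0" "\<And>n. norm (inverse (g n)) \<le> K" by (auto simp: Bseq_def)
  have bound: "1 / speed (Es n) (ps n) z \<le> K / (a * (1 - b))\<^sup>2" if "z \<in> {a..b}" for n z
  proof -
    have z: "0 < z" "z < 1" using that ab by auto
    have "g n * (a * (1 - b))\<^sup>2 \<le> g n * (z * (1 - z))\<^sup>2"
      using gp[of n] that ab by (intro mult_left_mono power_mono mult_mono) auto
    also have "\<dots> \<le> speed (Es n) (ps n) z"
      using speed_ge[OF vEs, of z n "ps n"] z by (simp add: g_def)
    finally have "1 / speed (Es n) (ps n) z \<le> 1 / (g n * (a * (1 - b))\<^sup>2)"
      using gp[of n] ab by (intro frac_le) auto
    also have "\<dots> = inverse (g n) / (a * (1 - b))\<^sup>2" by (simp add: field_simps)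
    also have "\<dots> \<le> K / (a * (1 - b))\<^sup>2"
      using K(2)[of n] gp[of n] by (intro divide_right_mono) (auto simp: less_imp_le)
    finally show ?thesis .
  qed
  have sub: "{a..b} \<subseteq> {0<..<1}" using ab by auto
  have lim: "(\<lambda>n. LBINT z:{a..b}. 1 / speed (Es n) (ps n) z) \<longlonglongrightarrow> (LBINT z:{a..b}. 1 / speed E p z)"
    unfolding set_lebesgue_integral_def
  proof (rule integral_dominated_convergence[where w = "\<lambda>z. indicator {a..b} z * (K / (a * (1 - b))\<^sup>2)"])
    show "(\<lambda>z. indicator {a..b} z *\<^sub>R (1 / speed E p z)) \<in> borel_measurable lborel"
      using borel_measurable_continuous_on_indicator[OF _ continuous_on_inverse_speed[OF E sub], of p] by auto
    show "(\<lambda>z. indicator {a..b} z *\<^sub>R (1 / speed (Es n) (ps n) z)) \<in> borel_measurable lborel" for n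
      using borel_measurable_continuous_on_indicator[OF _ continuous_on_inverse_speed[OF vEs sub], of n "ps n"] by auto
    show "integrable lborel (\<lambda>z. indicator {a..b} z * (K / (a * (1 - b))\<^sup>2))"
      by (intro integrable_mult_left integrable_real_indicator) (auto simp: emeasure_lborel_Icc_eq)
    show "AE z in lborel. (\<lambda>n. indicator {a..b} z *\<^sub>R (1 / speed (Es n) (ps n) z)) \<longlonglongrightarrow> indicator {a..b} z *\<^sub>R (1 / speed E p z)"
    proof (intro AE_I2)
      fix z :: real
      show "(\<lambda>n. indicator {a..b} z *\<^sub>R (1 / speed (Es n) (ps n) z)) \<longlonglongrightarrow> indicator {a..b} z *\<^sub>R (1 / speed E p z)"
      proof (cases "z \<in> {a..b}")
        case True
        then have z: "0 < z" "z < 1" using ab by auto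
        have "(\<lambda>n. 1 / speed (Es n) (ps n) z) \<longlonglongrightarrow> 1 / speed E p z"
          by (rule tendsto_divide[OF tendsto_const tendsto_speed[OF Es E tendsto_const _ ps]])
             (use z speed_pos[OF E z, of p] in simp_all)
        then show ?thesis by (intro tendsto_scaleR tendsto_const)
      qed simp
    qed
    show "AE z in lborel. norm (indicator {a..b} z *\<^sub>R (1 / speed (Es n) (ps n) z)) \<le> indicator {a..b} z * (K / (a * (1 - b))\<^sup>2)" for n
      using bound speed_nonneg[OF vEs, of _ n "ps n"] ab by (auto simp: indicator_def)
  qed
  \<comment> \<open>For x < 1/2 the oriented integral changes sign, while {a..b} is
    unoriented.\<close>
  have *: "clock E' p' x = (if x \<ge> 1/2 then 1 else -1) * (LBINT z:{a..b}. 1 / speed E' p' z)" for E' p'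
  proof (cases "1/2 \<le> x")
    case True
    then show ?thesis
      unfolding clock_def using interval_integral_Icc[of "1/2" x "\<lambda>z. 1 / speed E' p' z"]
      by (simp add: a_def b_def min_absorb2 max_absorb1)
  next
    case False
    then show ?thesis
      unfolding clock_def using interval_integral_Icc[of x "1/2" "\<lambda>z. 1 / speed E' p' z"]
        interval_integral_endpoints_reverse[of "ereal (1/2)" "ereal x" "\<lambda>z. 1 / speed E' p' z"]
      by (simp add: a_def b_def min_absorb1 max_absorb2)
  qed
  show ?thesis unfolding * by (intro tendsto_intros lim)
qed

text \<open>Monotonicity in the belief upgrades pointwise convergence of the clocks to joint convergence.\<close>

lemma tendsto_clock:
  assumes Es: "econ_tendsto Es E sequentially" and vEs: "\<And>n. valid_economy (Es n)" and E: "valid_economy E"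
    and ps: "ps \<longlonglongrightarrow> p" and x: "0 < x" "x < 1" and xs: "xs \<longlonglongrightarrow> x"
  shows "(\<lambda>n. clock (Es n) (ps n) (xs n)) \<longlonglongrightarrow> clock E p x"
proof (rule order_tendstoI)
  have cont: "isCont (clock E p) x" by (rule DERIV_isCont[OF DERIV_clock[OF E x]])
  have ev: "eventually (\<lambda>n. 0 < xs n \<and> xs n < 1) sequentially"
    using order_tendstoD(1)[OF xs x(1)] order_tendstoD(2)[OF xs x(2)] by eventually_elim simp
  fix a assume a: "a < clock E p x"
  \<comment> \<open>Move to a nearby y on the left where the limit clock still exceeds a:
    convergence at this fixed y together with y < \<open>xs n\<close> then suffices.\<close>
  have "eventually (\<lambda>y. a < clock E p y \<and> 0 < y) (at_left x)"
    using order_tendstoD(1)[OF cont[unfolded isCont_def] a] eventually_at_left_real[OF x(1)]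
    by (intro eventually_conj) (auto simp: eventually_at_split elim: eventually_mono)
  then have "eventually (\<lambda>y. (a < clock E p y \<and> 0 < y) \<and> y < x) (at_left x)"
    by (auto simp: eventually_at_filter elim: eventually_mono)
  then obtain y where y: "a < clock E p y" "0 < y" "y < x"
    using eventually_happens'[of "at_left x"] by auto
  have "eventually (\<lambda>n. a < clock (Es n) (ps n) y) sequentially"
    using order_tendstoD(1)[OF clock_tendsto_param[OF Es vEs E ps y(2)] y(1)] y x by simp
  with order_tendstoD(1)[OF xs y(3)] ev
  show "eventually (\<lambda>n. a < clock (Es n) (ps n) (xs n)) sequentially"
  proof eventually_elim
    fix n assume "a < clock (Es n) (ps n) y" "y < xs n" "0 < xs n \<and> xs n < 1"
    with clock_strict_mono[OF vEs y(2), of "xs n" n "ps n"] show "a < clock (Es n) (ps n) (xs n)" by linarith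
  qed
next
  have cont: "isCont (clock E p) x" by (rule DERIV_isCont[OF DERIV_clock[OF E x]])
  have ev: "eventually (\<lambda>n. 0 < xs n \<and> xs n < 1) sequentially"
    using order_tendstoD(1)[OF xs x(1)] order_tendstoD(2)[OF xs x(2)] by eventually_elim simp
  fix a assume a: "clock E p x < a"
  have "eventually (\<lambda>y. clock E p y < a \<and> y < 1) (at_right x)"
    using order_tendstoD(2)[OF cont[unfolded isCont_def] a] eventually_at_right_real[OF x(2)]
    by (intro eventually_conj) (auto simp: eventually_at_split elim: eventually_mono)
  then have "eventually (\<lambda>y. (clock E p y < a \<and> y < 1) \<and> x < y) (at_right x)"
    by (auto simp: eventually_at_filter elim: eventually_mono)
  then obtain y where y: "clock E p y < a" "y < 1" "x < y"
    using eventually_happens'[of "at_right x"] by auto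
  have "eventually (\<lambda>n. clock (Es n) (ps n) y < a) sequentially"
    using order_tendstoD(2)[OF clock_tendsto_param[OF Es vEs E ps _ y(2)] y(1)] y x by simp
  with order_tendstoD(2)[OF xs y(3)] ev
  show "eventually (\<lambda>n. clock (Es n) (ps n) (xs n) < a) sequentially"
  proof eventually_elim
    fix n assume "clock (Es n) (ps n) y < a" "xs n < y" "0 < xs n \<and> xs n < 1"
    with clock_strict_mono[OF vEs _ _ y(2), of "xs n" n "ps n"] show "clock (Es n) (ps n) (xs n) < a" by linarith
  qed
qed

lemma eventually_less_of_tendsto:
  fixes f g :: "'a \<Rightarrow> real"
  assumes "(f \<longlongrightarrow> a) F" "(g \<longlongrightarrow> b) F" "a < b"
  shows "eventually (\<lambda>x. f x < g x) F"
proof -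
  obtain c where c: "a < c" "c < b" using dense[OF assms(3)] by auto
  from order_tendstoD(2)[OF assms(1) c(1)] order_tendstoD(1)[OF assms(2) c(2)]
  show ?thesis by eventually_elim simp
qed

text \<open>Inverses of increasing functions converge when the functions do so pointwise: whether a
  fixed y lies below the inverse is decided by the clock at y.\<close>

lemma tendsto_unclock:
  assumes Es: "econ_tendsto Es E sequentially" and vEs: "\<And>n. valid_economy (Es n)" and E: "valid_economy E"
    and ps: "ps \<longlonglongrightarrow> p" and ss: "ss \<longlonglongrightarrow> s"
  shows "(\<lambda>n. unclock (Es n) (ps n) (ss n)) \<longlonglongrightarrow> unclock E p s"
proof (rule order_tendstoI)
  note u = unclock[OF E, of p s]
  fix a assume "a < unclock E p s"
  \<comment> \<open>The maximum with half the limit keeps y inside (0, 1), where clocks can be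
    compared.\<close>
  define y where "y = max a (unclock E p s / 2)"
  have y: "0 < y" "y < unclock E p s" "a \<le> y" using u \<open>a < _\<close> by (auto simp: y_def)
  have "clock E p y < s" using clock_strict_mono[OF E y(1) y(2) u(2), of p] u by simp
  then have "eventually (\<lambda>n. clock (Es n) (ps n) y < ss n) sequentially"
    by (intro eventually_less_of_tendsto[OF clock_tendsto_param[OF Es vEs E ps] ss]) (use y u in auto)
  then show "eventually (\<lambda>n. a < unclock (Es n) (ps n) (ss n)) sequentially"
  proof (rule eventually_mono)
    fix n assume "clock (Es n) (ps n) y < ss n"
    then have "y < unclock (Es n) (ps n) (ss n)"
      using clock_less_iff[OF vEs, of y "unclock (Es n) (ps n) (ss n)" n "ps n"] unclock[OF vEs, of n "ps n" "ss n"] y u by auto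
    with y show "a < unclock (Es n) (ps n) (ss n)" by simp
  qed
next
  note u = unclock[OF E, of p s]
  fix a assume "unclock E p s < a"
  define y where "y = min a ((1 + unclock E p s) / 2)"
  have y: "y < 1" "unclock E p s < y" "y \<le> a" using u \<open>_ < a\<close> by (auto simp: y_def min_less_iff_disj)
  have "s < clock E p y" using clock_strict_mono[OF E u(1) y(2) y(1), of p] u by simp
  then have "eventually (\<lambda>n. ss n < clock (Es n) (ps n) y) sequentially"
    by (intro eventually_less_of_tendsto[OF ss clock_tendsto_param[OF Es vEs E ps]]) (use y u in auto)
  then show "eventually (\<lambda>n. unclock (Es n) (ps n) (ss n) < a) sequentially"
  proof (rule eventually_mono)
    fix n assume "ss n < clock (Es n) (ps n) y"
    then have "unclock (Es n) (ps n) (ss n) < y"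
      using clock_less_iff[OF vEs, of "unclock (Es n) (ps n) (ss n)" y n "ps n"] unclock[OF vEs, of n "ps n" "ss n"] y u by auto
    with y show "unclock (Es n) (ps n) (ss n) < a" by simp
  qed
qed

lemma isCont_unclock: "valid_economy E \<Longrightarrow> isCont (unclock E p) s"
  unfolding continuous_at_sequentially o_def
  by (intro allI impI tendsto_unclock[of "\<lambda>_. E"] econ_tendsto_const tendsto_const)

lemma DERIV_unclock:
  assumes E: "valid_economy E"
  shows "(unclock E p has_real_derivative speed E p (unclock E p s)) (at s)"
proof -
  note u = unclock[OF E, of p s]
  have "(unclock E p has_real_derivative inverse (1 / speed E p (unclock E p s))) (at s)"
  proof (rule DERIV_inverse_function[where f = "clock E p" and a = "s - 1" and b = "s + 1"])
    show "(clock E p has_real_derivative 1 / speed E p (unclock E p s)) (at (unclock E p s))"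
      by (rule DERIV_clock[OF E u(1,2)])
    show "1 / speed E p (unclock E p s) \<noteq> 0" using speed_pos[OF E u(1,2), of p] by simp
  qed (simp_all add: unclock(3)[OF E] isCont_unclock[OF E])
  then show ?thesis by simp
qed

text \<open>An explicit form of the silence path, at negative times too, so that its time derivative
  at 0 is two-sided. The endpoints rest; the clock is used only between them.\<close>

definition flow :: "economy \<Rightarrow> real \<Rightarrow> real \<Rightarrow> real \<Rightarrow> real" where
  "flow E p t \<mu> = (if 0 < \<mu> \<and> \<mu> < 1 then unclock E p (clock E p \<mu> - t) else \<mu>)"

lemma flow_interior:
  assumes "valid_economy E" "0 < \<mu>" "\<mu> < 1"
  shows "0 < flow E p t \<mu>" "flow E p t \<mu> < 1"
  using unclock(1,2)[OF assms(1), of p "clock E p \<mu> - t"] assms(2,3) by (simp_all add: flow_def)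

lemma flow_range: "valid_economy E \<Longrightarrow> \<mu> \<in> {0..1} \<Longrightarrow> flow E p t \<mu> \<in> {0..1}"
proof (cases "0 < \<mu> \<and> \<mu> < 1")
  case True
  assume "valid_economy E"
  from flow_interior[OF this, of \<mu> p t] True show ?thesis by simp
next
  case False
  assume "\<mu> \<in> {0..1}"
  moreover from False have "flow E p t \<mu> = \<mu>" by (simp only: flow_def if_False)
  ultimately show ?thesis by simp
qed

lemma flow_0: "valid_economy E \<Longrightarrow> flow E p 0 \<mu> = \<mu>"
  using unclock_clock[of E \<mu> p] by (simp add: flow_def)

lemma flow_endpoints [simp]: "flow E p t 0 = 0" "flow E p t 1 = 1"
  by (simp_all add: flow_def)

lemma tendsto_flow:
  assumes Es: "econ_tendsto Es E sequentially" and vEs: "\<And>n. valid_economy (Es n)" and E: "valid_economy E"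
    and ps: "ps \<longlonglongrightarrow> p" and x: "0 < x" "x < 1" and xs: "xs \<longlonglongrightarrow> x" and ts: "ts \<longlonglongrightarrow> t"
  shows "(\<lambda>n. flow (Es n) (ps n) (ts n) (xs n)) \<longlonglongrightarrow> flow E p t x"
proof -
  \<comment> \<open>Finitely many \<open>xs n\<close> may lie outside (0, 1), where
    \<open>flow\<close> takes its other branch.\<close>
  have ev: "eventually (\<lambda>n. unclock (Es n) (ps n) (clock (Es n) (ps n) (xs n) - ts n) = flow (Es n) (ps n) (ts n) (xs n)) sequentially"
    using order_tendstoD(1)[OF xs x(1)] order_tendstoD(2)[OF xs x(2)] by eventually_elim (simp add: flow_def)
  have "(\<lambda>n. unclock (Es n) (ps n) (clock (Es n) (ps n) (xs n) - ts n)) \<longlonglongrightarrow> unclock E p (clock E p x - t)"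
    by (intro tendsto_unclock[OF Es vEs E ps] tendsto_intros tendsto_clock[OF Es vEs E ps x xs] ts)
  then show ?thesis using Lim_transform_eventually[OF _ ev] x by (simp add: flow_def)
qed

lemma DERIV_flow:
  assumes E: "valid_economy E"
  shows "((\<lambda>t. flow E p t \<mu>) has_real_derivative
    (if 0 < \<mu> \<and> \<mu> < 1 then - speed E p (flow E p t \<mu>) else 0)) (at t)"
proof (cases "0 < \<mu> \<and> \<mu> < 1")
  case True
  have "((\<lambda>t. unclock E p (clock E p \<mu> - t)) has_real_derivative
      speed E p (unclock E p (clock E p \<mu> - t)) * (- 1)) (at t)"
    by (rule DERIV_chain2[OF DERIV_unclock[OF E]]) (auto intro!: derivative_eq_intros)
  then show ?thesis using True by (simp add: flow_def)
qed (auto simp: flow_def)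

lemma isCont_flow: "valid_economy E \<Longrightarrow> isCont (\<lambda>t. flow E p t \<mu>) t"
  by (rule DERIV_isCont[OF DERIV_flow])

lemma flow_measurable:
  assumes E: "valid_economy E"
  shows "(\<lambda>(t, \<mu>). flow E p t \<mu>) \<in> borel_measurable (borel \<Otimes>\<^sub>M borel)"
proof -
  have [measurable]: "unclock E p \<in> borel_measurable borel"
    by (intro borel_measurable_continuous_onI continuous_at_imp_continuous_on) (simp add: isCont_unclock[OF E])
  \<comment> \<open>Continuity of the clock is available on (0, 1) only, so it is cut off there
    before measurability is derived.\<close>
  have [measurable]: "(\<lambda>x. indicator {0<..<1} x *\<^sub>R clock E p x) \<in> borel_measurable borel"
    by (intro borel_measurable_continuous_on_indicator continuous_on_clock E) auto
  have "(\<lambda>(t, \<mu>). flow E p t \<mu>) = (\<lambda>(t, \<mu>). if 0 < \<mu> \<and> \<mu> < 1 then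
      unclock E p (indicator {0<..<1} \<mu> *\<^sub>R clock E p \<mu> - t) else \<mu>)"
    by (auto simp: flow_def fun_eq_iff)
  also have "\<dots> \<in> borel_measurable (borel \<Otimes>\<^sub>M borel)" by measurable
  finally show ?thesis .
qed

section \<open>Existence and uniqueness of silence paths\<close>

lemma silence_solution_flow:
  assumes E: "valid_economy E" and \<mu>: "\<mu> \<in> {0..1}"
  shows "silence_solution E p \<mu> (\<lambda>t. flow E p t \<mu>)"
proof -
  have "((\<lambda>t. flow E p t \<mu>) has_real_derivative drift E (flow E p t \<mu>) p) (at t within {0..})" for t
  proof -
    have "(if 0 < \<mu> \<and> \<mu> < 1 then - speed E p (flow E p t \<mu>) else 0) = drift E (flow E p t \<mu>) p"
      using \<mu> by (auto simp: drift_eq_speed flow_def)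
    then show ?thesis using DERIV_flow[OF E, of p \<mu> t] by (auto intro: has_field_derivative_at_within)
  qed
  then show ?thesis
    unfolding silence_solution_def using flow_range[OF E \<mu>] flow_0[OF E] by blast
qed

text \<open>Derivatives within {0..} are one-sided at 0, as in \<open>silence_solution\<close>;
  hence the mean value theorem is applied within {0..t}.\<close>

lemma mono_on_half_line:
  fixes f :: "real \<Rightarrow> real"
  assumes "\<And>t. 0 \<le> t \<Longrightarrow> (f has_real_derivative f' t) (at t within {0..})" "\<And>t. 0 \<le> t \<Longrightarrow> 0 \<le> f' t" "0 \<le> t"
  shows "f 0 \<le> f t"
proof -
  have d: "(f has_derivative (\<lambda>h. h * f' x)) (at x within {0..t})" if "0 \<le> x" for x
    using has_field_derivative_subset[OF assms(1)[OF that], of "{0..t}"]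
    by (auto simp: has_field_derivative_def mult_commute_abs)
  show ?thesis
  proof (cases "t = 0")
    case False
    then have "\<exists>x\<in>{0<..<t}. f t - f 0 = (t - 0) * f' x"
      using assms(3) by (intro mvt_simple d) auto
    then obtain x where "0 < x" "f t - f 0 = t * f' x" by auto
    moreover from this have "0 \<le> t * f' x" using assms(2)[of x] assms(3) by simp
    ultimately show ?thesis by linarith
  qed simp
qed

text \<open>Uniqueness needs no Lipschitz estimate: along a solution \<open>exp (\<nu> * t) * x t\<close> is nondecreasing
  and \<open>1 - x t\<close> grows at most exponentially, so that interior paths stay interior, where the clock
  applies, and paths from an endpoint do not move.\<close>

lemma silence_solution_unique:
  assumes E: "valid_economy E" and x: "silence_solution E p \<mu> x" and t: "0 \<le> t"
  shows "x t = flow E p t \<mu>"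
proof -
  define \<nu> where "\<nu> = arrival E"
  have x0: "x 0 = \<mu>" and rng: "\<And>s. 0 \<le> s \<Longrightarrow> x s \<in> {0..1}"
    and der: "\<And>s. 0 \<le> s \<Longrightarrow> (x has_real_derivative - speed E p (x s)) (at s within {0..})"
    using x unfolding silence_solution_def drift_eq_speed by auto
  have \<mu>: "\<mu> \<in> {0..1}" using rng[of 0] x0 by simp
  have 1: "\<mu> \<le> exp (\<nu> * s) * x s" if "0 \<le> s" for s
  proof -
    have "exp (\<nu> * 0) * x 0 \<le> exp (\<nu> * s) * x s"
    proof (rule mono_on_half_line[where f = "\<lambda>s. exp (\<nu> * s) * x s"])
      fix s :: real assume s: "0 \<le> s"
      show "((\<lambda>s. exp (\<nu> * s) * x s) has_real_derivative exp (\<nu> * s) * (\<nu> * x s - speed E p (x s))) (at s within {0..})"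
        by (auto intro!: derivative_eq_intros der s simp: algebra_simps)
      show "0 \<le> exp (\<nu> * s) * (\<nu> * x s - speed E p (x s))"
        using speed_le(1)[OF E rng[OF s], of p] by (simp add: \<nu>_def)
    qed fact
    then show ?thesis by (simp add: x0)
  qed
  have 2: "x s \<le> \<mu>" if "0 \<le> s" for s
  proof -
    have "- x 0 \<le> - x s"
    proof (rule mono_on_half_line[where f = "\<lambda>s. - x s"])
      fix s :: real assume s: "0 \<le> s"
      show "((\<lambda>s. - x s) has_real_derivative speed E p (x s)) (at s within {0..})"
        by (auto intro!: derivative_eq_intros der s)
      show "0 \<le> speed E p (x s)" by (rule speed_nonneg[OF E rng[OF s]])
    qed fact
    then show ?thesis by (simp add: x0)
  qed
  have 3: "1 - \<mu> \<ge> exp (- \<nu> * s) * (1 - x s)" if "0 \<le> s" for s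
  proof -
    have "- (exp (- \<nu> * 0) * (1 - x 0)) \<le> - (exp (- \<nu> * s) * (1 - x s))"
    proof (rule mono_on_half_line[where f = "\<lambda>s. - (exp (- \<nu> * s) * (1 - x s))"])
      fix s :: real assume s: "0 \<le> s"
      show "((\<lambda>s. - (exp (- \<nu> * s) * (1 - x s))) has_real_derivative exp (- \<nu> * s) * (\<nu> * (1 - x s) - speed E p (x s))) (at s within {0..})"
        by (auto intro!: derivative_eq_intros der s simp: algebra_simps)
      show "0 \<le> exp (- \<nu> * s) * (\<nu> * (1 - x s) - speed E p (x s))"
        using speed_le(2)[OF E rng[OF s], of p] by (simp add: \<nu>_def)
    qed fact
    then show ?thesis by (simp add: x0)
  qed
  consider "\<mu> = 0" | "\<mu> = 1" | "0 < \<mu>" "\<mu> < 1" using \<mu> by fastforce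
  then show ?thesis
  proof cases
    case 1
    then show ?thesis using 2[OF t] rng[OF t] by simp
  next
    case 2
    then have "exp (- \<nu> * t) * (1 - x t) \<le> 0" using 3[OF t] by simp
    then show ?thesis using 2 rng[OF t] by (auto simp: mult_le_0_iff)
  next
    case 3
    have int: "0 < x s" "x s < 1" if "0 \<le> s" for s
    proof -
      have "0 < exp (\<nu> * s) * x s" using 1[OF that] 3 by linarith
      then show "0 < x s" by (simp add: zero_less_mult_iff)
      show "x s < 1" using 2[OF that] 3 by linarith
    qed
    \<comment> \<open>Clock plus elapsed time is conserved; applying monotonicity to it and to its
      negative determines the clock at time t.\<close>
    have d: "((\<lambda>s. clock E p (x s) + s) has_real_derivative 0) (at s within {0..})" if s: "0 \<le> s" for s
    proof -
      have "((\<lambda>s. clock E p (x s)) has_real_derivative (1 / speed E p (x s)) * (- speed E p (x s))) (at s within {0..})"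
        by (rule DERIV_chain2[OF DERIV_clock[OF E int[OF s]] der[OF s]])
      then show ?thesis using speed_pos[OF E int[OF s], of p] by (auto intro!: derivative_eq_intros)
    qed
    have "clock E p (x 0) + 0 \<le> clock E p (x t) + t"
      by (rule mono_on_half_line[where f' = "\<lambda>_. 0", OF d _ t]) auto
    moreover have "- (clock E p (x 0) + 0) \<le> - (clock E p (x t) + t)"
      by (rule mono_on_half_line[where f = "\<lambda>s. - (clock E p (x s) + s)" and f' = "\<lambda>_. 0", OF _ _ t])
         (use DERIV_minus[OF d] in \<open>simp_all del: minus_add_distrib\<close>)
    ultimately have "clock E p (x t) = clock E p \<mu> - t" by (simp add: x0)
    then show ?thesis using unclock_clock[OF E int[OF t], of p] 3 by (simp add: flow_def)
  qed
qed

lemma silence_eq_flow: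
  assumes E: "valid_economy E" and \<mu>: "\<mu> \<in> {0..1}" and t: "0 \<le> t"
  shows "silence E p t \<mu> = flow E p t \<mu>"
  unfolding silence_def
proof (rule the_equality)
  show "\<exists>x. silence_solution E p \<mu> x \<and> flow E p t \<mu> = x t"
    using silence_solution_flow[OF E \<mu>] by auto
qed (use silence_solution_unique[OF E _ t] in auto)

text \<open>The clock is a strictly increasing bijection of (0, 1) onto the reals, so a path started
  inside meets exactly the interior beliefs not above its start. The criterion contains neither
  economy nor price, which makes being upstream stable under perturbation.\<close>

lemma upstream_iff:
  assumes E: "valid_economy E" and \<mu>: "0 < \<mu>\<^sub>0" "\<mu>\<^sub>0 < 1"
  shows "upstream E p \<mu>' \<mu>\<^sub>0 \<longleftrightarrow> \<mu>\<^sub>0 \<le> \<mu>' \<and> \<mu>' < 1"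
proof
  assume "upstream E p \<mu>' \<mu>\<^sub>0"
  then obtain t where t: "0 \<le> t" "\<mu>' \<in> {0..1}" "flow E p t \<mu>' = \<mu>\<^sub>0"
    unfolding upstream_def using silence_eq_flow[OF E] by metis
  then have int: "0 < \<mu>' \<and> \<mu>' < 1" using \<mu> unfolding flow_def by (metis order.strict_trans1)
  then have int: "0 < \<mu>'" "\<mu>' < 1" by auto
  have "clock E p \<mu>\<^sub>0 = clock E p \<mu>' - t"
    using t(3) int unclock(3)[OF E] by (auto simp: flow_def)
  with t(1) have "\<not> \<mu>' < \<mu>\<^sub>0" using clock_strict_mono[OF E int(1) _ \<mu>(2), of p] by force
  with int show "\<mu>\<^sub>0 \<le> \<mu>' \<and> \<mu>' < 1" by simp
next
  assume *: "\<mu>\<^sub>0 \<le> \<mu>' \<and> \<mu>' < 1"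
  define t where "t = clock E p \<mu>' - clock E p \<mu>\<^sub>0"
  have "0 \<le> t" using clock_strict_mono[OF E \<mu>(1), of \<mu>' p] * by (cases "\<mu>' = \<mu>\<^sub>0") (auto simp: t_def)
  moreover have "flow E p t \<mu>' = \<mu>\<^sub>0"
    using * \<mu> unclock_clock[OF E \<mu>] by (auto simp: flow_def t_def)
  ultimately show "upstream E p \<mu>' \<mu>\<^sub>0"
    unfolding upstream_def using silence_eq_flow[OF E, of \<mu>' t p] * \<mu> by auto
qed

text \<open>Interior paths stay interior and endpoints rest. This later excludes the target belief
  1: one belief cannot have two different unique optima.\<close>

lemma upstream_1:
  assumes E: "valid_economy E" and "upstream E p \<mu>' 1"
  shows "\<mu>' = 1"
proof -
  obtain t where t: "0 \<le> t" "\<mu>' \<in> {0..1}" "flow E p t \<mu>' = 1"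
    using assms(2) silence_eq_flow[OF E] unfolding upstream_def by metis
  show ?thesis
  proof (cases "0 < \<mu>' \<and> \<mu>' < 1")
    case True
    then show ?thesis using flow_interior(2)[OF E, of \<mu>' p t] t(3) by simp
  next
    case False
    then have "flow E p t \<mu>' = \<mu>'" by (simp only: flow_def if_False)
    with t(3) show ?thesis by simp
  qed
qed


section \<open>Discounted integrals along the silence flow\<close>

text \<open>The common shape of both fixed-point operators at a fixed price: h is the total event
  intensity and \<Psi> the revenue rate plus intensity-weighted continuation values.\<close>

definition path_value :: "economy \<Rightarrow> real \<Rightarrow> (real \<Rightarrow> real) \<Rightarrow> (real \<Rightarrow> real) \<Rightarrow> real \<Rightarrow> real" where
  "path_value E p h \<Psi> \<mu> =
     (LBINT t:{0..}. exp (- disc E * t - (LBINT s:{0..t}. h (flow E p s \<mu>))) * \<Psi> (flow E p t \<mu>))"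

lemma has_real_derivative_interval_integral:
  fixes g :: "real \<Rightarrow> real"
  assumes "continuous_on UNIV g"
  shows "((\<lambda>t. LBINT s=ereal 0..ereal t. g s) has_real_derivative g t) (at t)"
proof -
  define a b where "a = min 0 t - 1" and "b = max 0 t + 1"
  have ab: "a < t" "t < b" "a \<le> 0" "0 \<le> b" by (auto simp: a_def b_def)
  have "((\<lambda>t. LBINT s=ereal 0..ereal t. g s) has_vector_derivative g t) (at t within {a..b})"
    by (rule interval_integral_FTC2) (use ab continuous_on_subset[OF assms] in auto)
  moreover have "at t within {a..b} = at t"
    using ab by (intro at_within_interior) (auto simp: interior_atLeastAtMost_real)
  ultimately show ?thesis
    unfolding has_real_derivative_iff_has_vector_derivative by simp
qed

lemma integrable_exp_decay:
  fixes c :: real assumes "0 < c"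
  shows "integrable lborel (\<lambda>t. indicator {0..} t * (K * exp (- c * t)))"
proof -
  have "integrable lborel (\<lambda>t. exponential_density c t)"
    using prob_space_exponential_density[OF assms] prob_space.emeasure_space_1
    by (intro integrableI_nonneg) (auto simp: emeasure_density exponential_density_nonneg assms less_imp_le
        dest!: prob_space.emeasure_space_1)
  then have "integrable lborel (\<lambda>t. (K / c) * exponential_density c t)" by (rule integrable_mult_right)
  also have "(\<lambda>t. (K / c) * exponential_density c t) = (\<lambda>t. indicator {0..} t * (K * exp (- c * t)))"
    using assms by (auto simp: exponential_density_def indicator_def fun_eq_iff mult_ac)
  finally show ?thesis .
qed

lemma measurable_flow:
  assumes "valid_economy E" "f \<in> borel_measurable M" "g \<in> borel_measurable M"
  shows "(\<lambda>x. flow E p (f x) (g x)) \<in> borel_measurable M"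
proof -
  have "(\<lambda>x. (f x, g x)) \<in> M \<rightarrow>\<^sub>M borel \<Otimes>\<^sub>M borel" using assms by measurable
  from measurable_compose[OF this flow_measurable[OF assms(1), of p]] show ?thesis by simp
qed

lemma set_borel_measurable_continuous:
  fixes f :: "real \<Rightarrow> real"
  assumes "continuous_on {0..1} f"
  shows "set_borel_measurable borel {0..1} f"
  using borel_measurable_continuous_on_indicator[OF _ assms] by (auto simp: set_borel_measurable_def)

locale silence_path =
  fixes E :: economy and p :: real and h :: "real \<Rightarrow> real" and H :: real
  assumes E: "valid_economy E"
    and h_cont: "continuous_on {0..1} h" and h_range: "\<And>x. x \<in> {0..1} \<Longrightarrow> 0 \<le> h x \<and> h x \<le> H"
begin

abbreviation weight :: "real \<Rightarrow> real \<Rightarrow> real" where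
  "weight \<mu> t \<equiv> exp (- disc E * t - (LBINT s:{0..t}. h (flow E p s \<mu>)))"

lemma disc_pos: "0 < disc E" using valid_economyD(1)[OF E] .

lemma H_nonneg: "0 \<le> H" using h_range[of 0] by simp

lemma continuous_on_h_flow: "\<mu> \<in> {0..1} \<Longrightarrow> continuous_on S (\<lambda>t. h (flow E p t \<mu>))"
  by (rule continuous_on_compose2[OF h_cont])
     (use isCont_flow[OF E] flow_range[OF E] in \<open>auto intro: continuous_at_imp_continuous_on\<close>)

lemma h_flow_integrable: "\<mu> \<in> {0..1} \<Longrightarrow> set_integrable lborel {0..t} (\<lambda>s. h (flow E p s \<mu>))"
  by (rule borel_integrable_atLeastAtMost'[OF continuous_on_h_flow])

lemma hazard_bounds:
  assumes "\<mu> \<in> {0..1}" "0 \<le> t"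
  shows "0 \<le> (LBINT s:{0..t}. h (flow E p s \<mu>))" "(LBINT s:{0..t}. h (flow E p s \<mu>)) \<le> H * t"
proof -
  show "0 \<le> (LBINT s:{0..t}. h (flow E p s \<mu>))"
    unfolding set_lebesgue_integral_def
    by (rule integral_nonneg_AE) (use h_range flow_range[OF E assms(1)] in \<open>auto simp: indicator_def\<close>)
  have "(LBINT s:{0..t}. h (flow E p s \<mu>)) \<le> (LBINT s:{0..t}. H)"
    by (rule set_integral_mono[OF h_flow_integrable[OF assms(1)] borel_integrable_atLeastAtMost'[OF continuous_on_const]])
       (use h_range flow_range[OF E assms(1)] in auto)
  also have "\<dots> = H * t" using assms(2) by (simp add: set_lebesgue_integral_def)
  finally show "(LBINT s:{0..t}. h (flow E p s \<mu>)) \<le> H * t" .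
qed

lemma weight_le: "\<mu> \<in> {0..1} \<Longrightarrow> 0 \<le> t \<Longrightarrow> weight \<mu> t \<le> exp (- disc E * t)"
  using hazard_bounds(1)[of \<mu> t] by simp

text \<open>Values are required to be Borel on [0, 1] only. The cut-off gives Borel functions on the
  line without changing compositions with the flow.\<close>

definition trunc :: "(real \<Rightarrow> real) \<Rightarrow> real \<Rightarrow> real" where
  "trunc f x = indicator {0..1} x * f x"

lemma trunc_flow: "\<mu> \<in> {0..1} \<Longrightarrow> trunc f (flow E p t \<mu>) = f (flow E p t \<mu>)"
  using flow_range[OF E, of \<mu> p t] by (simp add: trunc_def)

lemma trunc_measurable: "set_borel_measurable borel {0..1} f \<Longrightarrow> trunc f \<in> borel_measurable borel"
  by (simp add: set_borel_measurable_def trunc_def[abs_def])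

lemma h_measurable: "trunc h \<in> borel_measurable borel"
  by (intro trunc_measurable set_borel_measurable_continuous h_cont)

text \<open>Joint measurability in belief and time, so that the value of a path becomes a measurable
  function of its initial belief.\<close>

lemma integrand_measurable:
  assumes \<Psi>: "set_borel_measurable borel {0..1} \<Psi>"
  shows "(\<lambda>(\<mu>, t). indicator {0..} t * (exp (- disc E * t - (LBINT s. indicator {0..t} s * trunc h (flow E p s \<mu>))) * trunc \<Psi> (flow E p t \<mu>)))
     \<in> borel_measurable (borel \<Otimes>\<^sub>M lborel)"
proof -
  note [measurable] = trunc_measurable[OF \<Psi>] h_measurable measurable_flow[OF E]
  have *: "indicator {0..t} s = (if 0 \<le> s \<and> s \<le> t then 1 else 0 :: real)" for s t :: real
    by (simp add: indicator_def)
  show ?thesis unfolding * by measurable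
qed

lemma path_value_trunc:
  assumes "\<mu> \<in> {0..1}"
  shows "path_value E p h \<Psi> \<mu> =
    (LBINT t. indicator {0..} t * (exp (- disc E * t - (LBINT s. indicator {0..t} s * trunc h (flow E p s \<mu>))) * trunc \<Psi> (flow E p t \<mu>)))"
  by (simp add: path_value_def set_lebesgue_integral_def trunc_flow[OF assms])

lemma path_value_measurable:
  assumes \<Psi>: "set_borel_measurable borel {0..1} \<Psi>"
  shows "set_borel_measurable borel {0..1} (path_value E p h \<Psi>)"
proof -
  have "(\<lambda>\<mu>. indicator {0..1} \<mu> *\<^sub>R (LBINT t. indicator {0..} t * (exp (- disc E * t - (LBINT s. indicator {0..t} s * trunc h (flow E p s \<mu>))) * trunc \<Psi> (flow E p t \<mu>))))
    \<in> borel_measurable borel"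
    by (intro borel_measurable_scaleR borel_measurable_indicator lborel.borel_measurable_lebesgue_integral
        integrand_measurable[OF \<Psi>]) auto
  also have "?this = ?thesis"
    unfolding set_borel_measurable_def
    by (intro arg_cong2[where f = "(\<in>)"] refl ext) (auto simp: path_value_trunc indicator_def)
  finally show ?thesis .
qed

lemma integrand_measurable_fixed:
  assumes \<Psi>: "set_borel_measurable borel {0..1} \<Psi>" and \<mu>: "\<mu> \<in> {0..1}"
  shows "(\<lambda>t. indicator {0..} t *\<^sub>R (weight \<mu> t * \<Psi> (flow E p t \<mu>))) \<in> borel_measurable lborel"
proof -
  have "(\<lambda>t. (\<lambda>(\<mu>, t). indicator {0..} t * (exp (- disc E * t - (LBINT s. indicator {0..t} s * trunc h (flow E p s \<mu>))) * trunc \<Psi> (flow E p t \<mu>))) (\<mu>, t))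
     \<in> borel_measurable lborel"
    by (rule measurable_compose[OF _ integrand_measurable[OF \<Psi>]]) simp
  then show ?thesis by (simp add: set_lebesgue_integral_def trunc_flow[OF \<mu>])
qed

lemma integrand_integrable:
  assumes \<Psi>: "set_borel_measurable borel {0..1} \<Psi>" and \<mu>: "\<mu> \<in> {0..1}"
    and K: "\<And>x. x \<in> {0..1} \<Longrightarrow> \<bar>\<Psi> x\<bar> \<le> K"
  shows "set_integrable lborel {0..} (\<lambda>t. weight \<mu> t * \<Psi> (flow E p t \<mu>))"
  unfolding set_integrable_def
proof (rule Bochner_Integration.integrable_bound[OF integrable_exp_decay[OF disc_pos, of K] integrand_measurable_fixed[OF \<Psi> \<mu>]],
    intro AE_I2)
  fix t :: real
  have "weight \<mu> t * \<bar>\<Psi> (flow E p t \<mu>)\<bar> \<le> exp (- disc E * t) * K" if "0 \<le> t"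
    by (intro mult_mono weight_le \<mu> that K flow_range E) auto
  moreover have "0 \<le> K" using K[of 0] by simp
  ultimately show "norm (indicator {0..} t *\<^sub>R (weight \<mu> t * \<Psi> (flow E p t \<mu>))) \<le> norm (indicator {0..} t * (K * exp (- disc E * t)))"
    by (auto simp: indicator_def abs_mult mult.commute)
qed

text \<open>The weights integrate total discounting plus hazard to one: \<open>weight * (\<rho> + h)\<close> is minus the
  derivative of \<open>weight\<close>.\<close>

lemma path_value_disc_hazard:
  assumes \<mu>: "\<mu> \<in> {0..1}"
  shows "path_value E p h (\<lambda>x. disc E + h x) \<mu> = 1"
proof -
  \<comment> \<open>The oriented integral extends the weight to negative times, which makes the
    derivative at 0 two-sided.\<close>
  define W where "W t = exp (- disc E * t - (LBINT s=ereal 0..ereal t. h (flow E p s \<mu>)))" for t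
  have W: "W t = weight \<mu> t" if "0 \<le> t" for t
    unfolding W_def interval_integral_Icc[OF that] ..
  have dW: "((\<lambda>t. - W t) has_real_derivative W t * (disc E + h (flow E p t \<mu>))) (at t)" for t
    unfolding W_def
    by (auto intro!: derivative_eq_intros has_real_derivative_interval_integral continuous_on_h_flow[OF \<mu>] simp: algebra_simps)
  have "continuous_on UNIV W" unfolding W_def
    by (intro continuous_intros continuous_at_imp_continuous_on ballI DERIV_isCont[OF has_real_derivative_interval_integral] continuous_on_h_flow \<mu>)
  then have meas: "(\<lambda>t. W t * (disc E + h (flow E p t \<mu>))) \<in> borel_measurable borel"
    by (intro borel_measurable_continuous_onI continuous_intros continuous_on_h_flow \<mu>)
  have nn: "0 \<le> W t * (disc E + h (flow E p t \<mu>))" for t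
    using disc_pos h_range[OF flow_range[OF E \<mu>], of p t] by (simp add: W_def)
  have "(W \<longlongrightarrow> 0) at_top"
  proof (rule tendsto_sandwich[where f = "\<lambda>_. 0" and h = "\<lambda>t. exp (- disc E * t)"])
    show "eventually (\<lambda>t. 0 \<le> W t) at_top" by (simp add: W_def)
    have "W t \<le> exp (- disc E * t)" if "0 \<le> t" for t
      using W[OF that] weight_le[OF \<mu> that] by (simp only:)
    then show "eventually (\<lambda>t. W t \<le> exp (- disc E * t)) at_top"
      by (intro eventually_mono[OF eventually_ge_at_top[of 0]]) simp
    show "((\<lambda>t. exp (- disc E * t)) \<longlongrightarrow> 0) at_top"
      by (rule filterlim_compose[OF exp_at_bot filterlim_tendsto_neg_mult_at_bot[OF tendsto_const _ filterlim_ident]])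
         (use disc_pos in simp)
  qed simp
  from nn_integral_FTC_atLeast[OF meas dW nn tendsto_minus[OF this]]
  have *: "(\<integral>\<^sup>+t. ennreal (W t * (disc E + h (flow E p t \<mu>))) * indicator {0..} t \<partial>lborel) = 1"
    by (simp add: W_def)
  have "path_value E p h (\<lambda>x. disc E + h x) \<mu> = (\<integral>t. indicator {0..} t * (W t * (disc E + h (flow E p t \<mu>))) \<partial>lborel)"
    unfolding path_value_def set_lebesgue_integral_def
  proof (intro Bochner_Integration.integral_cong refl)
    fix t :: real
    show "indicator {0..} t *\<^sub>R (exp (- disc E * t - (LBINT s. indicator {0..t} s *\<^sub>R h (flow E p s \<mu>))) * (disc E + h (flow E p t \<mu>)))
        = indicator {0..} t * (W t * (disc E + h (flow E p t \<mu>)))"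
      by (cases "0 \<le> t") (simp_all add: W set_lebesgue_integral_def)
  qed
  also have "\<dots> = enn2real (\<integral>\<^sup>+t. ennreal (indicator {0..} t * (W t * (disc E + h (flow E p t \<mu>)))) \<partial>lborel)"
    by (rule integral_eq_nn_integral) (use meas nn in auto)
  also have "(\<integral>\<^sup>+t. ennreal (indicator {0..} t * (W t * (disc E + h (flow E p t \<mu>)))) \<partial>lborel) = 1"
    unfolding *[symmetric] by (intro nn_integral_cong) (auto simp: indicator_def)
  finally show ?thesis by simp
qed

lemma path_value_mono:
  assumes "set_borel_measurable borel {0..1} \<Psi>" "set_borel_measurable borel {0..1} \<Psi>'" "\<mu> \<in> {0..1}"
    and "\<And>x. x \<in> {0..1} \<Longrightarrow> \<bar>\<Psi> x\<bar> \<le> K" "\<And>x. x \<in> {0..1} \<Longrightarrow> \<bar>\<Psi>' x\<bar> \<le> K'"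
    and le: "\<And>x. x \<in> {0..1} \<Longrightarrow> \<Psi> x \<le> \<Psi>' x"
  shows "path_value E p h \<Psi> \<mu> \<le> path_value E p h \<Psi>' \<mu>"
  unfolding path_value_def
  by (intro set_integral_mono integrand_integrable[OF assms(1,3,4)] integrand_integrable[OF assms(2,3,5)])
     (use le flow_range[OF E assms(3)] in auto)

lemma path_value_cmult: "path_value E p h (\<lambda>x. c * \<Psi> x) \<mu> = c * path_value E p h \<Psi> \<mu>"
  unfolding path_value_def by (simp flip: set_integral_mult_right) (simp add: mult_ac)

lemma path_value_diff:
  assumes "set_borel_measurable borel {0..1} \<Psi>" "set_borel_measurable borel {0..1} \<Psi>'" "\<mu> \<in> {0..1}"
    and "\<And>x. x \<in> {0..1} \<Longrightarrow> \<bar>\<Psi> x\<bar> \<le> K" "\<And>x. x \<in> {0..1} \<Longrightarrow> \<bar>\<Psi>' x\<bar> \<le> K'"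
  shows "path_value E p h (\<lambda>x. \<Psi> x - \<Psi>' x) \<mu> = path_value E p h \<Psi> \<mu> - path_value E p h \<Psi>' \<mu>"
  unfolding path_value_def right_diff_distrib
  by (rule set_integral_diff(2)[OF integrand_integrable[OF assms(1,3,4)] integrand_integrable[OF assms(2,3,5)]])

lemma set_borel_measurable_disc_hazard: "set_borel_measurable borel {0..1} (\<lambda>x. M * (disc E + h x))"
  by (intro set_borel_measurable_continuous continuous_intros h_cont)

text \<open>Comparison with M (\<rho> + h) and - M (\<rho> + h), whose path values are exactly M and
  - M. Bounds on integrands are therefore always brought into the form of a multiple of \<rho> +
  h.\<close>

lemma path_value_abs_le:
  assumes "set_borel_measurable borel {0..1} \<Psi>" "\<mu> \<in> {0..1}"
    and le: "\<And>x. x \<in> {0..1} \<Longrightarrow> \<bar>\<Psi> x\<bar> \<le> M * (disc E + h x)"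
  shows "\<bar>path_value E p h \<Psi> \<mu>\<bar> \<le> M"
proof -
  have K: "\<bar>M' * (disc E + h x)\<bar> \<le> \<bar>M'\<bar> * (disc E + H)" if "x \<in> {0..1}" for x M'
    using h_range[OF that] disc_pos by (auto simp: abs_mult intro!: mult_left_mono)
  have K': "\<bar>\<Psi> x\<bar> \<le> \<bar>M\<bar> * (disc E + H)" if "x \<in> {0..1}" for x
    using le[OF that] K[OF that, of M] by linarith
  have "path_value E p h \<Psi> \<mu> \<le> path_value E p h (\<lambda>x. M * (disc E + h x)) \<mu>"
    by (rule path_value_mono[OF assms(1) set_borel_measurable_disc_hazard assms(2) K' K]) (use le in \<open>auto simp: abs_le_iff\<close>)
  moreover have "path_value E p h (\<lambda>x. (- M) * (disc E + h x)) \<mu> \<le> path_value E p h \<Psi> \<mu>"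
    by (rule path_value_mono[OF set_borel_measurable_disc_hazard assms(1) assms(2) K K']) (use le in \<open>force simp: abs_le_iff\<close>)+
  ultimately show ?thesis
    unfolding path_value_cmult path_value_disc_hazard[OF assms(2)] by simp
qed

text \<open>From h \<le> H follows h \<le> H / (\<rho> + H) * (\<rho> + h), and
  \<open>path_value_abs_le\<close> applies with M = H / (\<rho> + H) * c.\<close>

lemma path_value_contraction:
  assumes \<Psi>: "set_borel_measurable borel {0..1} \<Psi>" "set_borel_measurable borel {0..1} \<Psi>'" "\<mu> \<in> {0..1}"
    and K: "\<And>x. x \<in> {0..1} \<Longrightarrow> \<bar>\<Psi> x\<bar> \<le> K" "\<And>x. x \<in> {0..1} \<Longrightarrow> \<bar>\<Psi>' x\<bar> \<le> K'"
    and c: "0 \<le> c" and le: "\<And>x. x \<in> {0..1} \<Longrightarrow> \<bar>\<Psi> x - \<Psi>' x\<bar> \<le> c * h x"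
  shows "\<bar>path_value E p h \<Psi> \<mu> - path_value E p h \<Psi>' \<mu>\<bar> \<le> H / (disc E + H) * c"
proof -
  have "\<bar>path_value E p h (\<lambda>x. \<Psi> x - \<Psi>' x) \<mu>\<bar> \<le> H / (disc E + H) * c"
  proof (rule path_value_abs_le[OF _ \<Psi>(3)])
  show "set_borel_measurable borel {0..1} (\<lambda>x. \<Psi> x - \<Psi>' x)"
    using \<Psi>(1,2) unfolding set_borel_measurable_def scaleR_diff_right by (rule borel_measurable_diff)
  fix x :: real assume x: "x \<in> {0..1}"
  have "h x * disc E \<le> H * disc E" using h_range[OF x] disc_pos by (intro mult_right_mono) auto
  then have "h x \<le> H / (disc E + H) * (disc E + h x)"
    using disc_pos H_nonneg by (simp add: field_simps add_pos_nonneg)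
  from mult_left_mono[OF this c] le[OF x] show "\<bar>\<Psi> x - \<Psi>' x\<bar> \<le> H / (disc E + H) * c * (disc E + h x)"
    by (simp add: mult_ac)
  qed
  then show ?thesis using path_value_diff[of \<Psi> \<Psi>' \<mu> K K'] \<Psi> K by simp
qed

end


section \<open>Existence and uniqueness of the values\<close>

text \<open>Lets both values be treated together: \<open>A_bar\<close> belongs to the gross value,
  \<open>A_L\<close> to the strategic one.\<close>

definition demand :: "(economy \<Rightarrow> real \<Rightarrow> real \<Rightarrow> real) \<Rightarrow> bool" where
  "demand A \<longleftrightarrow> A = A_bar \<or> A = A_L"

text \<open>Abstracts the reset term, covering the maximum over the menu and the average under a
  desk selector, which depends on current price and belief. Vanishing at 0 and nonexpansiveness give
  the bounds; the last clause keeps iterates measurable.\<close>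

definition aggregator :: "economy \<Rightarrow> (real \<Rightarrow> real \<Rightarrow> (real \<Rightarrow> real) \<Rightarrow> real) \<Rightarrow> bool" where
  "aggregator E G \<longleftrightarrow>
     (\<forall>p\<in>menu E. \<forall>\<phi>\<in>{0..1}. G p \<phi> (\<lambda>_. 0) = 0 \<and>
        (\<forall>u v c. (\<forall>p'\<in>menu E. \<bar>u p' - v p'\<bar> \<le> c) \<longrightarrow> \<bar>G p \<phi> u - G p \<phi> v\<bar> \<le> c)) \<and>
     (\<forall>p\<in>menu E. \<forall>f. (\<forall>p'\<in>menu E. set_borel_measurable borel {0..1} (\<lambda>\<mu>. f \<mu> p')) \<longrightarrow>
        set_borel_measurable borel {0..1} (\<lambda>\<phi>. G p \<phi> (f \<phi>)))"

definition hazard :: "(economy \<Rightarrow> real \<Rightarrow> real \<Rightarrow> real) \<Rightarrow> economy \<Rightarrow> real \<Rightarrow> real \<Rightarrow> real" where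
  "hazard A E p \<phi> = reset E + arrival E * A E \<phi> p"

definition reward ::
  "(economy \<Rightarrow> real \<Rightarrow> real \<Rightarrow> real) \<Rightarrow> (real \<Rightarrow> real \<Rightarrow> (real \<Rightarrow> real) \<Rightarrow> real) \<Rightarrow> economy \<Rightarrow>
    (real \<Rightarrow> real \<Rightarrow> real) \<Rightarrow> real \<Rightarrow> real \<Rightarrow> real" where
  "reward A G E f p \<phi> =
     arrival E * p * A E \<phi> p + reset E * G p \<phi> (f \<phi>) + arrival E * A E \<phi> p * f (J0 E \<phi> p) p"

definition val_op ::
  "(economy \<Rightarrow> real \<Rightarrow> real \<Rightarrow> real) \<Rightarrow> (real \<Rightarrow> real \<Rightarrow> (real \<Rightarrow> real) \<Rightarrow> real) \<Rightarrow> economy \<Rightarrow>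
    (real \<Rightarrow> real \<Rightarrow> real) \<Rightarrow> real \<Rightarrow> real \<Rightarrow> real" where
  "val_op A G E f \<mu> p = path_value E p (hazard A E p) (reward A G E f p) \<mu>"

definition is_value ::
  "(economy \<Rightarrow> real \<Rightarrow> real \<Rightarrow> real) \<Rightarrow> (real \<Rightarrow> real \<Rightarrow> (real \<Rightarrow> real) \<Rightarrow> real) \<Rightarrow> economy \<Rightarrow>
    (real \<Rightarrow> real \<Rightarrow> real) \<Rightarrow> bool" where
  "is_value A G E f \<longleftrightarrow> bounded_value E f \<and> (\<forall>\<mu>\<in>{0..1}. \<forall>p\<in>menu E. f \<mu> p = val_op A G E f \<mu> p)"

lemma tendsto_demand:
  assumes "demand A" "econ_tendsto Es E F" "valid_economy E" "(\<mu>s \<longlongrightarrow> \<mu>) F" "\<mu> \<in> {0..1}" "(ps \<longlongrightarrow> p) F"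
  shows "((\<lambda>n. A (Es n) (\<mu>s n) (ps n)) \<longlongrightarrow> A E \<mu> p) F"
  using assms(1) tendsto_A_bar[OF assms(2-6)] tendsto_A(2)[OF assms(2-6)] by (auto simp: demand_def)

lemma demand_bounds:
  assumes "demand A" "valid_economy E" "\<mu> \<in> {0..1}"
  shows "0 < A E \<mu> p" "A E \<mu> p < 1"
  using assms A_bar_bounds[of E \<mu> p] A_bounds(3,4)[of E \<mu> p] by (auto simp: demand_def)

lemma continuous_on_demand:
  assumes "demand A" "valid_economy E"
  shows "continuous_on {0..1} (\<lambda>\<phi>. A E \<phi> p)"
  unfolding continuous_on_def
  by (intro ballI tendsto_demand[OF assms(1) _ assms(2)] tendsto_ident_at) auto

lemma continuous_on_J0:
  assumes "valid_economy E"
  shows "continuous_on {0..1} (\<lambda>\<phi>. J0 E \<phi> p)"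
  unfolding continuous_on_def
  by (intro ballI tendsto_J0[OF _ assms] tendsto_ident_at) auto

lemma path_hazard:
  assumes "demand A" "valid_economy E"
  shows "silence_path E (hazard A E p) (reset E + arrival E)"
proof
  show "valid_economy E" by fact
  show "continuous_on {0..1} (hazard A E p)"
    unfolding hazard_def by (intro continuous_intros continuous_on_demand assms)
  show "0 \<le> hazard A E p x \<and> hazard A E p x \<le> reset E + arrival E" if "x \<in> {0..1}" for x
    using demand_bounds[OF assms that, of p] valid_economyD(2,3)[OF assms(2)]
    by (auto simp: hazard_def mult_left_le less_imp_le)
qed

lemma set_borel_measurable_compose:
  fixes f g :: "real \<Rightarrow> real"
  assumes f: "set_borel_measurable borel {0..1} f" and g: "continuous_on {0..1} g" "\<And>x. x \<in> {0..1} \<Longrightarrow> g x \<in> {0..1}"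
  shows "set_borel_measurable borel {0..1} (\<lambda>x. f (g x))"
proof -
  have [measurable]: "(\<lambda>x. indicator {0..1} x *\<^sub>R f x) \<in> borel_measurable borel"
    "(\<lambda>x. indicator {0..1} x *\<^sub>R g x) \<in> borel_measurable borel"
    using f set_borel_measurable_continuous[OF g(1)] by (auto simp: set_borel_measurable_def)
  have "(\<lambda>x. indicator {0..1} x *\<^sub>R (\<lambda>y. indicator {0..1} y *\<^sub>R f y) (indicator {0..1} x *\<^sub>R g x)) \<in> borel_measurable borel"
    by measurable
  also have "(\<lambda>x. indicator {0..1} x *\<^sub>R (\<lambda>y. indicator {0..1} y *\<^sub>R f y) (indicator {0..1} x *\<^sub>R g x)) = (\<lambda>x. indicator {0..1} x *\<^sub>R f (g x))"
    using g(2) by (auto simp: fun_eq_iff indicator_def)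
  finally show ?thesis by (simp add: set_borel_measurable_def)
qed

lemma set_borel_measurable_add:
  fixes f g :: "real \<Rightarrow> real"
  assumes "set_borel_measurable borel {0..1} f" "set_borel_measurable borel {0..1} g"
  shows "set_borel_measurable borel {0..1} (\<lambda>x. f x + g x)"
  using assms unfolding set_borel_measurable_def scaleR_add_right by (rule borel_measurable_add)

lemma set_borel_measurable_mult:
  fixes f g :: "real \<Rightarrow> real"
  assumes "set_borel_measurable borel {0..1} f" "set_borel_measurable borel {0..1} g"
  shows "set_borel_measurable borel {0..1} (\<lambda>x. f x * g x)"
proof -
  have "(\<lambda>x. (indicator {0..1} x *\<^sub>R f x) * (indicator {0..1} x *\<^sub>R g x)) \<in> borel_measurable borel"
    using assms unfolding set_borel_measurable_def by (rule borel_measurable_times)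
  also have "(\<lambda>x. (indicator {0..1} x *\<^sub>R f x) * (indicator {0..1} x *\<^sub>R g x)) = (\<lambda>x. indicator {0..1} x *\<^sub>R (f x * g x))"
    by (auto simp: fun_eq_iff indicator_def)
  finally show ?thesis by (simp add: set_borel_measurable_def)
qed

lemma set_borel_measurable_cong':
  fixes f g :: "real \<Rightarrow> real"
  assumes "\<And>x. x \<in> {0..1} \<Longrightarrow> f x = g x"
  shows "set_borel_measurable borel {0..1} f \<longleftrightarrow> set_borel_measurable borel {0..1} g"
  unfolding set_borel_measurable_def
  by (intro arg_cong2[where f = "(\<in>)"] refl ext) (use assms in \<open>auto simp: indicator_def\<close>)

locale valuation =
  fixes A :: "economy \<Rightarrow> real \<Rightarrow> real \<Rightarrow> real" and G and E :: economy
  assumes A: "demand A" and E: "valid_economy E" and G: "aggregator E G"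
begin

definition price_cap :: real where "price_cap = Max (menu E)"

text \<open>An upper bound on the revenue rate, received for ever: \<open>val_op\<close> maps the
  ball of this radius into itself.\<close>

definition bound :: real where "bound = arrival E * price_cap / disc E"

lemma le_price_cap: "p \<in> menu E \<Longrightarrow> p \<le> price_cap"
  unfolding price_cap_def using valid_economyD(9)[OF E] by simp

lemma price_cap_pos: "0 < price_cap"
  using valid_economyD(10,11)[OF E] le_price_cap by (metis all_not_in_conv less_le_trans)

lemma bound_pos: "0 < bound"
  unfolding bound_def using price_cap_pos valid_economyD(1,2)[OF E] by simp

definition modulus :: real where
  "modulus = (reset E + arrival E) / (disc E + (reset E + arrival E))"

lemma modulus: "0 < modulus" "modulus < 1"
  unfolding modulus_def using valid_economyD(1,2,3)[OF E] by (auto simp: add_pos_pos)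

lemma G_nonexp:
  "p \<in> menu E \<Longrightarrow> \<phi> \<in> {0..1} \<Longrightarrow> (\<And>p'. p' \<in> menu E \<Longrightarrow> \<bar>u p' - v p'\<bar> \<le> c) \<Longrightarrow> \<bar>G p \<phi> u - G p \<phi> v\<bar> \<le> c"
  using G unfolding aggregator_def by blast

lemma G_le:
  "p \<in> menu E \<Longrightarrow> \<phi> \<in> {0..1} \<Longrightarrow> (\<And>p'. p' \<in> menu E \<Longrightarrow> \<bar>u p'\<bar> \<le> c) \<Longrightarrow> \<bar>G p \<phi> u\<bar> \<le> c"
  using G_nonexp[of p \<phi> u "\<lambda>_. 0" c] G unfolding aggregator_def by auto

lemma A_E: "\<phi> \<in> {0..1} \<Longrightarrow> 0 < A E \<phi> p" "\<phi> \<in> {0..1} \<Longrightarrow> A E \<phi> p < 1"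
  using demand_bounds[OF A E] by auto

lemma reward_measurable:
  assumes f: "bounded_value E f" and p: "p \<in> menu E"
  shows "set_borel_measurable borel {0..1} (reward A G E f p)"
proof -
  have "set_borel_measurable borel {0..1} (\<lambda>\<phi>. G p \<phi> (f \<phi>))"
    using f G p unfolding bounded_value_def aggregator_def by blast
  moreover have "set_borel_measurable borel {0..1} (\<lambda>\<phi>. f (J0 E \<phi> p) p)"
    by (rule set_borel_measurable_compose[OF _ continuous_on_J0[OF E] J0_range[OF E]])
       (use f p in \<open>auto simp: bounded_value_def\<close>)
  ultimately show ?thesis
    unfolding reward_def[abs_def]
    by (intro set_borel_measurable_add set_borel_measurable_mult set_borel_measurable_continuous[OF continuous_on_const]
        set_borel_measurable_continuous[OF continuous_on_demand[OF A E]])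
qed

text \<open>A continuation gap c is weighted by \<kappa> at resets and by \<nu> A at purchases, and
  these intensities add up to the hazard.\<close>

lemma reward_diff_le:
  assumes fg: "\<And>\<mu> p. \<mu> \<in> {0..1} \<Longrightarrow> p \<in> menu E \<Longrightarrow> \<bar>f \<mu> p - g \<mu> p\<bar> \<le> c" and p: "p \<in> menu E" and \<phi>: "\<phi> \<in> {0..1}"
  shows "\<bar>reward A G E f p \<phi> - reward A G E g p \<phi>\<bar> \<le> c * hazard A E p \<phi>"
proof -
  have "\<bar>reward A G E f p \<phi> - reward A G E g p \<phi>\<bar>
      = \<bar>reset E * (G p \<phi> (f \<phi>) - G p \<phi> (g \<phi>)) + arrival E * A E \<phi> p * (f (J0 E \<phi> p) p - g (J0 E \<phi> p) p)\<bar>"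
    by (simp add: reward_def algebra_simps)
  also have "\<dots> \<le> reset E * \<bar>G p \<phi> (f \<phi>) - G p \<phi> (g \<phi>)\<bar> + arrival E * A E \<phi> p * \<bar>f (J0 E \<phi> p) p - g (J0 E \<phi> p) p\<bar>"
    using valid_economyD(2,3)[OF E] A_E(1)[OF \<phi>, of p] by (intro order_trans[OF abs_triangle_ineq]) (simp add: abs_mult)
  also have "\<dots> \<le> reset E * c + arrival E * A E \<phi> p * c"
    using valid_economyD(2,3)[OF E] A_E(1)[OF \<phi>, of p] fg p \<phi> J0_range[OF E \<phi>]
    by (intro add_mono mult_left_mono G_nonexp) auto
  finally show ?thesis by (simp add: hazard_def algebra_simps)
qed

text \<open>The revenue term is absorbed by M \<rho>, the continuation terms by M times the
  hazard.\<close>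

lemma reward_abs_le:
  assumes f: "\<And>\<mu> p. \<mu> \<in> {0..1} \<Longrightarrow> p \<in> menu E \<Longrightarrow> \<bar>f \<mu> p\<bar> \<le> M" and M: "bound \<le> M" and p: "p \<in> menu E" and \<phi>: "\<phi> \<in> {0..1}"
  shows "\<bar>reward A G E f p \<phi>\<bar> \<le> M * (disc E + hazard A E p \<phi>)"
proof -
  note v = valid_economyD(1,2,3)[OF E]
  have "\<bar>reward A G E f p \<phi> - reward A G E (\<lambda>_ _. 0) p \<phi>\<bar> \<le> M * hazard A E p \<phi>"
    by (rule reward_diff_le) (use f p \<phi> in auto)
  moreover have "reward A G E (\<lambda>_ _. 0) p \<phi> = arrival E * p * A E \<phi> p"
    using G p \<phi> by (simp add: reward_def aggregator_def)
  moreover have "0 \<le> arrival E * p * A E \<phi> p"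
    using v valid_economyD(11)[OF E p] A_E(1)[OF \<phi>, of p] by simp
  moreover have "arrival E * p * A E \<phi> p \<le> M * disc E"
  proof -
    have "arrival E * p * A E \<phi> p \<le> arrival E * price_cap * 1"
      using v valid_economyD(11)[OF E p] A_E[OF \<phi>, of p] le_price_cap[OF p] price_cap_pos
      by (intro mult_mono) auto
    also have "\<dots> = bound * disc E" using v by (simp add: bound_def)
    also have "\<dots> \<le> M * disc E" using M v by (intro mult_right_mono) auto
    finally show ?thesis .
  qed
  ultimately show ?thesis by (simp add: distrib_left)
qed

lemma reward_bounded:
  assumes "bounded_value E f" "p \<in> menu E"
  obtains K where "\<And>\<phi>. \<phi> \<in> {0..1} \<Longrightarrow> \<bar>reward A G E f p \<phi>\<bar> \<le> K"
proof -
  obtain K where K: "\<And>\<mu> p. \<mu> \<in> {0..1} \<Longrightarrow> p \<in> menu E \<Longrightarrow> \<bar>f \<mu> p\<bar> \<le> K"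
    using assms(1) unfolding bounded_value_def by blast
  define M where "M = max bound K"
  have "\<bar>reward A G E f p \<phi>\<bar> \<le> M * (disc E + (reset E + arrival E))" if "\<phi> \<in> {0..1}" for \<phi>
  proof -
    have "\<bar>reward A G E f p \<phi>\<bar> \<le> M * (disc E + hazard A E p \<phi>)"
      by (rule reward_abs_le) (use K assms that in \<open>force simp: M_def\<close>)+
    also have "\<dots> \<le> M * (disc E + (reset E + arrival E))"
      using silence_path.h_range[OF path_hazard[OF A E] that] bound_pos by (intro mult_left_mono) (auto simp: M_def)
    finally show ?thesis .
  qed
  then show ?thesis by (rule that)
qed

lemma val_op_measurable:
  assumes "bounded_value E f" "p \<in> menu E"
  shows "set_borel_measurable borel {0..1} (\<lambda>\<mu>. val_op A G E f \<mu> p)"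
  unfolding val_op_def
  by (rule silence_path.path_value_measurable[OF path_hazard[OF A E] reward_measurable[OF assms]])

lemma val_op_abs_le:
  assumes "bounded_value E f" "\<And>\<mu> p. \<mu> \<in> {0..1} \<Longrightarrow> p \<in> menu E \<Longrightarrow> \<bar>f \<mu> p\<bar> \<le> M" "bound \<le> M" "p \<in> menu E" "\<mu> \<in> {0..1}"
  shows "\<bar>val_op A G E f \<mu> p\<bar> \<le> M"
  unfolding val_op_def
  by (rule silence_path.path_value_abs_le[OF path_hazard[OF A E] reward_measurable[OF assms(1,4)] assms(5) reward_abs_le[OF assms(2,3,4)]])

lemma val_op_contraction:
  assumes f: "bounded_value E f" "bounded_value E g" and p: "p \<in> menu E" and \<mu>: "\<mu> \<in> {0..1}" and c: "0 \<le> c"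
    and fg: "\<And>\<mu> p. \<mu> \<in> {0..1} \<Longrightarrow> p \<in> menu E \<Longrightarrow> \<bar>f \<mu> p - g \<mu> p\<bar> \<le> c"
  shows "\<bar>val_op A G E f \<mu> p - val_op A G E g \<mu> p\<bar> \<le> modulus * c"
proof -
  obtain K where K: "\<And>\<phi>. \<phi> \<in> {0..1} \<Longrightarrow> \<bar>reward A G E f p \<phi>\<bar> \<le> K" using reward_bounded[OF f(1) p] by blast
  obtain K' where K': "\<And>\<phi>. \<phi> \<in> {0..1} \<Longrightarrow> \<bar>reward A G E g p \<phi>\<bar> \<le> K'" using reward_bounded[OF f(2) p] by blast
  show ?thesis unfolding val_op_def modulus_def
    by (rule silence_path.path_value_contraction[OF path_hazard[OF A E] reward_measurable[OF f(1) p] reward_measurable[OF f(2) p] \<mu> K K' c reward_diff_le[OF fg p]])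
qed

text \<open>The reward comparison with gap 0, used along a path that never leaves [0, 1].\<close>

lemma val_op_cong:
  assumes "\<And>\<mu> p. \<mu> \<in> {0..1} \<Longrightarrow> p \<in> menu E \<Longrightarrow> f \<mu> p = g \<mu> p" "p \<in> menu E" "\<mu> \<in> {0..1}"
  shows "val_op A G E f \<mu> p = val_op A G E g \<mu> p"
proof -
  have "reward A G E f p \<phi> = reward A G E g p \<phi>" if "\<phi> \<in> {0..1}" for \<phi>
    using reward_diff_le[of f g 0 p \<phi>] assms(1,2) that by simp
  then show ?thesis
    unfolding val_op_def path_value_def using flow_range[OF E assms(3), of p] by simp
qed

lemma value_unique:
  assumes f: "is_value A G E f" and g: "is_value A G E g" and \<mu>: "\<mu> \<in> {0..1}" and p: "p \<in> menu E"
  shows "f \<mu> p = g \<mu> p"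
proof -
  have bf: "bounded_value E f" "bounded_value E g" using f g by (auto simp: is_value_def)
  then obtain K L where K: "\<And>\<mu> p. \<mu> \<in> {0..1} \<Longrightarrow> p \<in> menu E \<Longrightarrow> \<bar>f \<mu> p\<bar> \<le> K" "\<And>\<mu> p. \<mu> \<in> {0..1} \<Longrightarrow> p \<in> menu E \<Longrightarrow> \<bar>g \<mu> p\<bar> \<le> L"
    unfolding bounded_value_def by metis
  have KL: "0 \<le> K + L" using K(1)[OF \<mu> p] K(2)[OF \<mu> p] by linarith
  have *: "\<bar>f \<mu> p - g \<mu> p\<bar> \<le> modulus ^ n * (K + L)" if "\<mu> \<in> {0..1}" "p \<in> menu E" for n \<mu> p
    using that
  proof (induction n arbitrary: \<mu> p)
    case 0
    then show ?case using K(1)[OF 0] K(2)[OF 0] by simp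
  next
    case (Suc n)
    have "\<bar>val_op A G E f \<mu> p - val_op A G E g \<mu> p\<bar> \<le> modulus * (modulus ^ n * (K + L))"
      by (rule val_op_contraction[OF bf]) (use Suc modulus KL in auto)
    then show ?case using f g Suc.prems by (simp add: is_value_def mult.assoc)
  qed
  have "(\<lambda>n. modulus ^ n * (K + L)) \<longlonglongrightarrow> 0 * (K + L)"
    using modulus by (intro tendsto_mult LIMSEQ_power_zero tendsto_const) auto
  then have "\<bar>f \<mu> p - g \<mu> p\<bar> \<le> 0 * (K + L)"
    by (rule LIMSEQ_le_const) (use *[OF \<mu> p] in blast)
  then show ?thesis by simp
qed

primrec iterate :: "nat \<Rightarrow> real \<Rightarrow> real \<Rightarrow> real" where
  "iterate 0 = (\<lambda>_ _. 0)"
| "iterate (Suc n) = val_op A G E (iterate n)"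

lemma iterate:
  "bounded_value E (iterate n) \<and> (\<forall>\<mu>\<in>{0..1}. \<forall>p\<in>menu E. \<bar>iterate n \<mu> p\<bar> \<le> bound)"
proof (induction n)
  case 0
  then show ?case using bound_pos by (auto simp: bounded_value_def set_borel_measurable_def)
next
  case (Suc n)
  then have b: "\<bar>iterate (Suc n) \<mu> p\<bar> \<le> bound" if "\<mu> \<in> {0..1}" "p \<in> menu E" for \<mu> p
    using that by (auto intro!: val_op_abs_le)
  moreover have "set_borel_measurable borel {0..1} (\<lambda>\<mu>. iterate (Suc n) \<mu> p)" if "p \<in> menu E" for p
    using Suc that by (auto intro!: val_op_measurable)
  ultimately show ?case unfolding bounded_value_def by blast
qed

lemma iterate_step:
  assumes "\<mu> \<in> {0..1}" "p \<in> menu E"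
  shows "\<bar>iterate (Suc n) \<mu> p - iterate n \<mu> p\<bar> \<le> modulus ^ n * bound"
  using assms
proof (induction n arbitrary: \<mu> p)
  case 0
  then show ?case using iterate[of "Suc 0"] by simp
next
  case (Suc n)
  have "\<bar>val_op A G E (iterate (Suc n)) \<mu> p - val_op A G E (iterate n) \<mu> p\<bar> \<le> modulus * (modulus ^ n * bound)"
    by (rule val_op_contraction) (use Suc iterate[of n] iterate[of "Suc n"] modulus bound_pos in auto)
  then show ?case by (simp add: mult.assoc)
qed

text \<open>Picard iteration from 0. The increments are dominated by a geometric series, so the
  limit is uniform over beliefs and prices; it inherits bound and measurability, and the contraction
  lets the operator pass to the limit.\<close>

lemma value_exists:
  "\<exists>f. is_value A G E f \<and> (\<forall>\<mu>\<in>{0..1}. \<forall>p\<in>menu E. \<bar>f \<mu> p\<bar> \<le> bound)"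
proof -
  define g where "g k \<mu> p = iterate (Suc k) \<mu> p - iterate k \<mu> p" for k \<mu> p
  have g_le: "norm (g k \<mu> p) \<le> modulus ^ k * bound" if "\<mu> \<in> {0..1}" "p \<in> menu E" for k \<mu> p
    using iterate_step[OF that] by (simp only: g_def real_norm_def)
  have sm: "summable (\<lambda>k. modulus ^ k * bound)"
    using modulus by (intro summable_mult2 summable_geometric) auto
  have it: "iterate n \<mu> p = (\<Sum>k<n. g k \<mu> p)" for n \<mu> p
    unfolding g_def by (subst sum_lessThan_telescope) simp
  define f where "f \<mu> p = (\<Sum>k. g k \<mu> p)" for \<mu> p
  have uni: "uniform_limit ({0..1} \<times> menu E) (\<lambda>n x. \<Sum>k<n. g k (fst x) (snd x)) (\<lambda>x. \<Sum>k. g k (fst x) (snd x)) sequentially"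
    by (rule Weierstrass_m_test[OF _ sm]) (use g_le in auto)
  have lim: "(\<lambda>n. iterate n \<mu> p) \<longlonglongrightarrow> f \<mu> p" if "\<mu> \<in> {0..1}" "p \<in> menu E" for \<mu> p
    using tendsto_uniform_limitI[OF uni, of "(\<mu>, p)"] that by (simp add: it f_def)
  have fb: "\<bar>f \<mu> p\<bar> \<le> bound" if "\<mu> \<in> {0..1}" "p \<in> menu E" for \<mu> p
    by (rule Lim_bounded[OF tendsto_rabs[OF lim[OF that]], of 0]) (use iterate that in auto)
  have fm: "set_borel_measurable borel {0..1} (\<lambda>\<mu>. f \<mu> p)" if "p \<in> menu E" for p
    unfolding set_borel_measurable_def
  proof (rule borel_measurable_LIMSEQ_real)
    show "(\<lambda>n. indicator {0..1} x *\<^sub>R iterate n x p) \<longlonglongrightarrow> indicator {0..1} x *\<^sub>R f x p" for x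
      using lim[of x p] that by (cases "x \<in> {0..1}") auto
    show "(\<lambda>x. indicator {0..1} x *\<^sub>R iterate n x p) \<in> borel_measurable borel" for n
      using iterate[of n] that by (simp add: bounded_value_def set_borel_measurable_def)
  qed
  have bv: "bounded_value E f" unfolding bounded_value_def using fb fm by blast
  have "f \<mu> p = val_op A G E f \<mu> p" if \<mu>: "\<mu> \<in> {0..1}" and p: "p \<in> menu E" for \<mu> p
  proof -
    have "(\<lambda>n. iterate (Suc n) \<mu> p) \<longlonglongrightarrow> val_op A G E f \<mu> p"
    proof (rule LIMSEQ_I)
      fix e :: real assume e: "0 < e"
      obtain N where N: "\<And>n x. n \<ge> N \<Longrightarrow> x \<in> {0..1} \<times> menu E \<Longrightarrow> dist (\<Sum>k<n. g k (fst x) (snd x)) (\<Sum>k. g k (fst x) (snd x)) < e"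
        using uni[unfolded uniform_limit_sequentially_iff] e by meson
      have "norm (iterate (Suc n) \<mu> p - val_op A G E f \<mu> p) < e" if n: "n \<ge> N" for n
      proof -
        have "\<bar>val_op A G E (iterate n) \<mu> p - val_op A G E f \<mu> p\<bar> \<le> modulus * e"
        proof (rule val_op_contraction[OF _ bv p \<mu>])
          show "\<bar>iterate n \<mu> p - f \<mu> p\<bar> \<le> e" if "\<mu> \<in> {0..1}" "p \<in> menu E" for \<mu> p
            using N[OF n, of "(\<mu>, p)"] that by (simp add: it f_def dist_real_def)
        qed (use e iterate in auto)
        also have "\<dots> < e" using modulus e by simp
        finally show ?thesis by simp
      qed
      then show "\<exists>no. \<forall>n\<ge>no. norm (iterate (Suc n) \<mu> p - val_op A G E f \<mu> p) < e" by blast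
    qed
    with LIMSEQ_Suc[OF lim[OF \<mu> p]] show ?thesis by (rule LIMSEQ_unique)
  qed
  then show ?thesis using bv fb by (auto simp: is_value_def intro!: exI[of _ f])
qed

text \<open>Fixed points agree on [0, 1] times the menu and may differ elsewhere, so the description
  is unique pointwise there, and the function it defines inherits the fixed-point equation by
  \<open>val_op_cong\<close>.\<close>

lemma value_the:
  assumes V: "\<And>\<mu> p. \<mu> \<in> {0..1} \<Longrightarrow> p \<in> menu E \<Longrightarrow> V \<mu> p = (THE y. \<exists>f. is_value A G E f \<and> y = f \<mu> p)"
  shows "is_value A G E V" "\<And>\<mu> p. \<mu> \<in> {0..1} \<Longrightarrow> p \<in> menu E \<Longrightarrow> \<bar>V \<mu> p\<bar> \<le> bound"
proof -
  obtain f where f: "is_value A G E f" "\<And>\<mu> p. \<mu> \<in> {0..1} \<Longrightarrow> p \<in> menu E \<Longrightarrow> \<bar>f \<mu> p\<bar> \<le> bound"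
    using value_exists by blast
  have eq: "V \<mu> p = f \<mu> p" if "\<mu> \<in> {0..1}" "p \<in> menu E" for \<mu> p
    unfolding V[OF that] by (rule the_equality) (use f value_unique that in blast)+
  then show "\<bar>V \<mu> p\<bar> \<le> bound" if "\<mu> \<in> {0..1}" "p \<in> menu E" for \<mu> p
    using f that by simp
  have "bounded_value E V"
    unfolding bounded_value_def
  proof (intro conjI ballI)
    show "\<exists>K. \<forall>\<mu>\<in>{0..1}. \<forall>p\<in>menu E. \<bar>V \<mu> p\<bar> \<le> K"
      using f(2) eq by (intro exI[of _ bound]) auto
    show "set_borel_measurable borel {0..1} (\<lambda>\<mu>. V \<mu> p)" if "p \<in> menu E" for p
      using f(1) that eq set_borel_measurable_cong'[of "\<lambda>\<mu>. V \<mu> p" "\<lambda>\<mu>. f \<mu> p"]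
      by (auto simp: is_value_def bounded_value_def)
  qed
  moreover have "V \<mu> p = val_op A G E V \<mu> p" if "\<mu> \<in> {0..1}" "p \<in> menu E" for \<mu> p
    using f(1) that eq val_op_cong[of V f p \<mu>] by (auto simp: is_value_def)
  ultimately show "is_value A G E V" by (simp add: is_value_def)
qed

end

section \<open>The two aggregators and the two values\<close>

definition max_agg :: "economy \<Rightarrow> real \<Rightarrow> real \<Rightarrow> (real \<Rightarrow> real) \<Rightarrow> real" where
  "max_agg E p \<phi> v = Max (v ` menu E)"

definition sel_agg :: "economy \<Rightarrow> (real \<Rightarrow> real \<Rightarrow> real pmf) \<Rightarrow> real \<Rightarrow> real \<Rightarrow> (real \<Rightarrow> real) \<Rightarrow> real" where
  "sel_agg E r p \<phi> v = (\<Sum>p'\<in>menu E. pmf (r \<phi> p) p' * v p')"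

lemma Max_image_diff_le:
  fixes u v :: "'a \<Rightarrow> real"
  assumes "finite S" "S \<noteq> {}" "\<And>x. x \<in> S \<Longrightarrow> \<bar>u x - v x\<bar> \<le> c"
  shows "\<bar>Max (u ` S) - Max (v ` S)\<bar> \<le> c"
proof -
  have *: "Max (u ` S) \<le> Max (v ` S) + c" if "\<And>x. x \<in> S \<Longrightarrow> \<bar>u x - v x\<bar> \<le> c" for u v :: "'a \<Rightarrow> real"
  proof (rule Max.boundedI)
    fix a assume "a \<in> u ` S"
    then obtain x where x: "x \<in> S" "a = u x" by auto
    have "v x \<le> Max (v ` S)" using x assms(1) by simp
    then show "a \<le> Max (v ` S) + c" using that[OF x(1)] x(2) by linarith
  qed (use assms in auto)
  from *[of u v] *[of v u] assms(3) show ?thesis by (auto simp: abs_minus_commute abs_le_iff)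
qed

lemma aggregator_max:
  assumes "valid_economy E"
  shows "aggregator E (max_agg E)"
  unfolding aggregator_def max_agg_def
proof (intro conjI ballI allI impI)
  note v = valid_economyD(9,10)[OF assms]
  fix p :: real
  show "Max ((\<lambda>_. 0::real) ` menu E) = 0" using v by simp
  show "\<bar>Max (u ` menu E) - Max (w ` menu E)\<bar> \<le> c" if "\<forall>p'\<in>menu E. \<bar>u p' - w p'\<bar> \<le> c" for u w :: "real \<Rightarrow> real" and c
    using Max_image_diff_le[OF v] that by blast
  fix f :: "real \<Rightarrow> real \<Rightarrow> real" assume f: "\<forall>p'\<in>menu E. set_borel_measurable borel {0..1} (\<lambda>\<mu>. f \<mu> p')"
  have "(\<lambda>\<mu>. Max ((\<lambda>p'. indicator {0..1} \<mu> *\<^sub>R f \<mu> p') ` menu E)) \<in> borel_measurable borel"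
    using f v by (intro borel_measurable_Max) (auto simp: set_borel_measurable_def)
  also have "(\<lambda>\<mu>. Max ((\<lambda>p'. indicator {0..1} \<mu> *\<^sub>R f \<mu> p') ` menu E)) = (\<lambda>\<mu>. indicator {0..1} \<mu> *\<^sub>R Max (f \<mu> ` menu E))"
    using v by (auto simp: fun_eq_iff indicator_def)
  finally show "set_borel_measurable borel {0..1} (\<lambda>\<phi>. Max (f \<phi> ` menu E))"
    by (simp add: set_borel_measurable_def)
qed

lemma is_arg_max_on_iff: "p \<in> argmax_on f S \<longleftrightarrow> p \<in> S \<and> (\<forall>y\<in>S. f y \<le> f p)"
  for f :: "'a \<Rightarrow> real"
  by (auto simp: argmax_on_def is_arg_max_def not_less)

lemma sum_pmf_selector:
  assumes "desk_selector E r" "finite (menu E)" "p \<in> menu E" "\<phi> \<in> {0..1}"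
  shows "(\<Sum>p'\<in>menu E. pmf (r \<phi> p) p') = 1"
proof -
  have "set_pmf (r \<phi> p) \<subseteq> menu E"
    using assms(1,3,4) by (force simp: desk_selector_def is_arg_max_on_iff)
  then show ?thesis by (rule sum_pmf_eq_1[OF assms(2)])
qed

lemma aggregator_sel:
  assumes E: "valid_economy E" and r: "desk_selector E r"
  shows "aggregator E (sel_agg E r)"
  unfolding aggregator_def sel_agg_def
proof (intro conjI ballI allI impI)
  fix p \<phi> :: real assume p: "p \<in> menu E"
  show "(\<Sum>p'\<in>menu E. pmf (r \<phi> p) p' * 0) = 0" by simp
  show "\<bar>(\<Sum>p'\<in>menu E. pmf (r \<phi> p) p' * u p') - (\<Sum>p'\<in>menu E. pmf (r \<phi> p) p' * w p')\<bar> \<le> c"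
    if "\<forall>p'\<in>menu E. \<bar>u p' - w p'\<bar> \<le> c" and \<phi>: "\<phi> \<in> {0..1}" for u w :: "real \<Rightarrow> real" and c
  proof -
    have "\<bar>(\<Sum>p'\<in>menu E. pmf (r \<phi> p) p' * u p') - (\<Sum>p'\<in>menu E. pmf (r \<phi> p) p' * w p')\<bar>
        = \<bar>\<Sum>p'\<in>menu E. pmf (r \<phi> p) p' * (u p' - w p')\<bar>"
      by (simp add: sum_subtractf algebra_simps)
    also have "\<dots> \<le> (\<Sum>p'\<in>menu E. \<bar>pmf (r \<phi> p) p' * (u p' - w p')\<bar>)" by (rule sum_abs)
    also have "\<dots> \<le> (\<Sum>p'\<in>menu E. pmf (r \<phi> p) p' * c)"
      using that(1) by (intro sum_mono) (auto simp: abs_mult intro!: mult_left_mono)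
    also have "\<dots> = c"
      using sum_pmf_selector[OF r valid_economyD(9)[OF E] p \<phi>] by (simp flip: sum_distrib_right)
    finally show ?thesis .
  qed
  fix f :: "real \<Rightarrow> real \<Rightarrow> real" assume f: "\<forall>p'\<in>menu E. set_borel_measurable borel {0..1} (\<lambda>\<mu>. f \<mu> p')"
  have "(\<lambda>\<phi>. \<Sum>p'\<in>menu E. indicator {0..1} \<phi> *\<^sub>R (pmf (r \<phi> p) p' * f \<phi> p')) \<in> borel_measurable borel"
    using f r p
    by (intro borel_measurable_sum set_borel_measurable_mult[unfolded set_borel_measurable_def])
       (auto simp: desk_selector_def set_borel_measurable_def)
  then show "set_borel_measurable borel {0..1} (\<lambda>\<phi>. \<Sum>p'\<in>menu E. pmf (r \<phi> p) p' * f \<phi> p')"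
    by (simp add: set_borel_measurable_def sum_distrib_left)
qed

lemma path_value_silence:
  assumes E: "valid_economy E" and \<mu>: "\<mu> \<in> {0..1}"
  shows "path_value E p h \<Psi> \<mu> =
     (LBINT t:{0..}. exp (- disc E * t - (LBINT s:{0..t}. h (silence E p s \<mu>))) * \<Psi> (silence E p t \<mu>))"
  unfolding path_value_def
proof (rule set_lebesgue_integral_cong, simp, intro allI impI)
  fix t :: real assume "t \<in> {0..}"
  have "(LBINT s:{0..t}. h (flow E p s \<mu>)) = (LBINT s:{0..t}. h (silence E p s \<mu>))"
    by (rule set_lebesgue_integral_cong) (auto simp: silence_eq_flow[OF E \<mu>])
  then show "exp (- disc E * t - (LBINT s:{0..t}. h (flow E p s \<mu>))) * \<Psi> (flow E p t \<mu>) =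
      exp (- disc E * t - (LBINT s:{0..t}. h (silence E p s \<mu>))) * \<Psi> (silence E p t \<mu>)"
    using \<open>t \<in> {0..}\<close> by (simp add: silence_eq_flow[OF E \<mu>])
qed

lemma gross_op_eq:
  assumes "valid_economy E" "\<mu> \<in> {0..1}"
  shows "gross_op E f \<mu> p = val_op A_bar (max_agg E) E f \<mu> p"
  unfolding val_op_def path_value_silence[OF assms] gross_op_def
  by (simp add: hazard_def reward_def max_agg_def Let_def)

lemma strategic_op_eq:
  assumes "valid_economy E" "\<mu> \<in> {0..1}"
  shows "strategic_op E r f \<mu> p = val_op A_L (sel_agg E r) E f \<mu> p"
  unfolding val_op_def path_value_silence[OF assms] strategic_op_def
  by (simp add: hazard_def reward_def sel_agg_def Let_def)

lemma valuation_gross: "valid_economy E \<Longrightarrow> valuation A_bar (max_agg E) E"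
  by unfold_locales (auto simp: demand_def aggregator_max)

lemma valuation_strategic: "valid_economy E \<Longrightarrow> desk_selector E r \<Longrightarrow> valuation A_L (sel_agg E r) E"
  by unfold_locales (auto simp: demand_def aggregator_sel)

definition value_bound :: "economy \<Rightarrow> real" where
  "value_bound E = arrival E * Max (menu E) / disc E"

lemma gross_value:
  assumes E: "valid_economy E"
  shows "is_value A_bar (max_agg E) E (gross_value E)"
    "\<And>\<mu> p. \<mu> \<in> {0..1} \<Longrightarrow> p \<in> menu E \<Longrightarrow> \<bar>gross_value E \<mu> p\<bar> \<le> value_bound E"
proof -
  interpret valuation A_bar "max_agg E" E by (rule valuation_gross[OF E])
  have "is_value A_bar (max_agg E) E f \<longleftrightarrow>
      bounded_value E f \<and> (\<forall>\<mu>\<in>{0..1}. \<forall>p\<in>menu E. f \<mu> p = gross_op E f \<mu> p)" for f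
    by (simp add: is_value_def gross_op_eq[OF E])
  then have "gross_value E \<mu> p = (THE y. \<exists>f. is_value A_bar (max_agg E) E f \<and> y = f \<mu> p)" for \<mu> p
    by (simp add: gross_value_def conj_assoc)
  from value_the[OF this] show "is_value A_bar (max_agg E) E (gross_value E)"
    "\<And>\<mu> p. \<mu> \<in> {0..1} \<Longrightarrow> p \<in> menu E \<Longrightarrow> \<bar>gross_value E \<mu> p\<bar> \<le> value_bound E"
    by (auto simp: value_bound_def bound_def price_cap_def)
qed

lemma strategic_value:
  assumes E: "valid_economy E" and r: "desk_selector E r"
  shows "is_value A_L (sel_agg E r) E (strategic_value E r)"
    "\<And>\<mu> p. \<mu> \<in> {0..1} \<Longrightarrow> p \<in> menu E \<Longrightarrow> \<bar>strategic_value E r \<mu> p\<bar> \<le> value_bound E"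
proof -
  interpret valuation A_L "sel_agg E r" E by (rule valuation_strategic[OF E r])
  have "is_value A_L (sel_agg E r) E f \<longleftrightarrow>
      bounded_value E f \<and> (\<forall>\<mu>\<in>{0..1}. \<forall>p\<in>menu E. f \<mu> p = strategic_op E r f \<mu> p)" for f
    by (simp add: is_value_def strategic_op_eq[OF E])
  then have "strategic_value E r \<mu> p = (THE y. \<exists>f. is_value A_L (sel_agg E r) E f \<and> y = f \<mu> p)" for \<mu> p
    by (simp add: strategic_value_def conj_assoc)
  from value_the[OF this] show "is_value A_L (sel_agg E r) E (strategic_value E r)"
    "\<And>\<mu> p. \<mu> \<in> {0..1} \<Longrightarrow> p \<in> menu E \<Longrightarrow> \<bar>strategic_value E r \<mu> p\<bar> \<le> value_bound E"
    by (auto simp: value_bound_def bound_def price_cap_def)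
qed


section \<open>Weak convergence of bounded functions\<close>

lemma bounded_set_integrable:
  fixes u :: "real \<Rightarrow> real"
  assumes "u \<in> borel_measurable borel" "\<And>x. \<bar>u x\<bar> \<le> K" "A \<in> sets borel" "emeasure lborel A < \<infinity>"
  shows "set_integrable lborel A u"
  unfolding set_integrable_def
proof (rule Bochner_Integration.integrable_bound)
  show "integrable lborel (\<lambda>x. indicator A x * K)"
    using assms by (intro integrable_mult_left integrable_real_indicator) auto
  show "(\<lambda>x. indicator A x *\<^sub>R u x) \<in> borel_measurable lborel" using assms by measurable
  show "AE x in lborel. norm (indicator A x *\<^sub>R u x) \<le> norm (indicator A x * K)"
    using assms(2) by (intro AE_I2) (auto simp: indicator_def intro: order_trans[OF _ abs_ge_self])
qed

lemma abs_set_integral_le_measure: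
  fixes u :: "real \<Rightarrow> real"
  assumes "u \<in> borel_measurable borel" "\<And>x. \<bar>u x\<bar> \<le> 1" "A \<in> sets borel" "emeasure lborel A < \<infinity>"
  shows "\<bar>LBINT x:A. u x\<bar> \<le> measure lborel A"
proof -
  have "norm (LBINT x:A. u x) \<le> (LBINT x:A. norm (u x))"
    by (rule set_integral_norm_bound[OF bounded_set_integrable[OF assms]])
  also have "\<dots> \<le> (LBINT x:A. 1)"
    using assms by (intro set_integral_mono set_integrable_norm bounded_set_integrable[OF assms]
        bounded_set_integrable[of "\<lambda>_. 1" 1]) auto
  also have "\<dots> = measure lborel A" using assms(3) by (simp add: set_lebesgue_integral_def)
  finally show ?thesis by simp
qed

text \<open>Half-lines are stable under intersection and generate the Borel sets. Disjoint unions
  pass to the limit by Tannery's theorem, since each integral is bounded by the Lebesgue measure of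
  its domain, whatever i. The filter is arbitrary because Cauchy sequences will be obtained from
  pairs of indices.\<close>

lemma weak_null_borel:
  fixes u :: "'i \<Rightarrow> real \<Rightarrow> real"
  assumes F: "F \<noteq> bot"
    and u: "\<And>i. u i \<in> borel_measurable borel" "\<And>i x. \<bar>u i x\<bar> \<le> 1"
    and box: "\<And>y. ((\<lambda>i. LBINT x:{a..b} \<inter> {..y}. u i x) \<longlongrightarrow> 0) F"
    and A: "A \<in> sets borel"
  shows "((\<lambda>i. LBINT x:{a..b} \<inter> A. u i x) \<longlongrightarrow> 0) F"
proof -
  have fin: "emeasure lborel ({a..b} \<inter> A) < \<infinity>" for A :: "real set"
    by (rule le_less_trans[OF emeasure_mono[of _ "{a..b}"]]) (auto simp: emeasure_lborel_Icc_eq)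
  have int: "set_integrable lborel ({a..b} \<inter> A) (u i)" if "A \<in> sets borel" for A i
    by (rule bounded_set_integrable[OF u]) (use that fin in auto)
  have "Int_stable (range (atMost :: real \<Rightarrow> _))"
    by (auto simp: Int_stable_def intro!: image_eqI[where x = "min _ _"])
  moreover have "range (atMost :: real \<Rightarrow> _) \<subseteq> Pow UNIV" by simp
  moreover have "A \<in> sigma_sets UNIV (range atMost)"
    using A by (simp add: borel_eq_atMost sets_measure_of)
  ultimately show ?thesis
  proof (induction rule: sigma_sets_induct_disjoint)
    show "((\<lambda>i. LBINT x:{a..b} \<inter> A. u i x) \<longlongrightarrow> 0) F" if "A \<in> range atMost" for A
      using that box by auto
    show "((\<lambda>i. LBINT x:{a..b} \<inter> {}. u i x) \<longlongrightarrow> 0) F" by (simp add: set_lebesgue_integral_def)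
  next
    fix A :: "real set" assume A: "A \<in> sigma_sets UNIV (range atMost)" and IH: "((\<lambda>i. LBINT x:{a..b} \<inter> A. u i x) \<longlongrightarrow> 0) F"
    from A have A': "A \<in> sets borel" by (simp add: borel_eq_atMost sets_measure_of)
    \<comment> \<open>The hypothesis at y = b controls the integral over all of {a..b}.\<close>
    have "(LBINT x:{a..b} \<inter> (UNIV - A). u i x) = (LBINT x:{a..b} \<inter> {..b}. u i x) - (LBINT x:{a..b} \<inter> A. u i x)" for i
    proof -
      have "(LBINT x:({a..b} \<inter> (UNIV - A)) \<union> ({a..b} \<inter> A). u i x) = (LBINT x:{a..b} \<inter> (UNIV - A). u i x) + (LBINT x:{a..b} \<inter> A. u i x)"
        by (rule set_integral_Un) (use A' in \<open>auto intro!: int\<close>)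
      moreover have "({a..b} \<inter> (UNIV - A)) \<union> ({a..b} \<inter> A) = {a..b} \<inter> {..b}" by auto
      ultimately show ?thesis by simp
    qed
    then show "((\<lambda>i. LBINT x:{a..b} \<inter> (UNIV - A). u i x) \<longlongrightarrow> 0) F"
      using tendsto_diff[OF box[of b] IH] by simp
  next
    fix A :: "nat \<Rightarrow> real set"
    assume disj: "disjoint_family A" and A: "range A \<subseteq> sigma_sets UNIV (range atMost)"
      and IH: "\<And>k. ((\<lambda>i. LBINT x:{a..b} \<inter> A k. u i x) \<longlongrightarrow> 0) F"
    from A have A': "A k \<in> sets borel" for k by (auto simp: borel_eq_atMost sets_measure_of)
    have eq: "(LBINT x:{a..b} \<inter> (\<Union>k. A k). u i x) = (\<Sum>k. LBINT x:{a..b} \<inter> A k. u i x)" for i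
    proof -
      have "(LBINT x:(\<Union>k. {a..b} \<inter> A k). u i x) = (\<Sum>k. LBINT x:{a..b} \<inter> A k. u i x)"
        by (rule lebesgue_integral_countable_add)
           (use A' disj int[of "\<Union>k. A k"] in \<open>auto simp: disjoint_family_on_def\<close>)
      then show ?thesis by simp
    qed
    have "(\<lambda>k. measure lborel ({a..b} \<inter> A k)) sums measure lborel (\<Union>k. {a..b} \<inter> A k)"
      by (rule measure_UNION) (use A' disj fin[of "\<Union>k. A k"] in \<open>auto simp: disjoint_family_on_def\<close>)
    then have sm: "summable (\<lambda>k. measure lborel ({a..b} \<inter> A k))" by (rule sums_summable)
    have "((\<lambda>i. \<Sum>k. LBINT x:{a..b} \<inter> A k. u i x) \<longlongrightarrow> (\<Sum>k. 0)) F"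
    proof (rule tannerys_theorem[THEN conjunct2, THEN conjunct2, OF IH _ sm F])
      have "norm (LBINT x:{a..b} \<inter> A k. u i x) \<le> measure lborel ({a..b} \<inter> A k)" for k i
        unfolding real_norm_def by (rule abs_set_integral_le_measure[OF u]) (use A' fin in auto)
      then show "eventually (\<lambda>(k, i). norm (LBINT x:{a..b} \<inter> A k. u i x) \<le> measure lborel ({a..b} \<inter> A k)) (at_top \<times>\<^sub>F F)"
        by (intro always_eventually) auto
    qed
    then show "((\<lambda>i. LBINT x:{a..b} \<inter> (\<Union>k. A k). u i x) \<longlongrightarrow> 0) F"
      by (simp add: eq)
  qed
qed

lemma integrable_mult_bounded:
  fixes u w :: "real \<Rightarrow> real"
  assumes "u \<in> borel_measurable borel" "\<And>x. \<bar>u x\<bar> \<le> 1" "integrable lborel w"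
  shows "integrable lborel (\<lambda>x. w x * u x)"
proof (rule Bochner_Integration.integrable_bound[OF assms(3)])
  show "(\<lambda>x. w x * u x) \<in> borel_measurable lborel" using assms by measurable
  show "AE x in lborel. norm (w x * u x) \<le> norm (w x)"
    using assms(2) by (intro AE_I2) (simp add: abs_mult mult_left_le)
qed

lemma abs_integral_mult_bounded:
  fixes u w :: "real \<Rightarrow> real"
  assumes "u \<in> borel_measurable borel" "\<And>x. \<bar>u x\<bar> \<le> 1" "integrable lborel w"
  shows "\<bar>LBINT x. w x * u x\<bar> \<le> (LBINT x. \<bar>w x\<bar>)"
proof -
  have "norm (LBINT x. w x * u x) \<le> (LBINT x. norm (w x * u x))" by (rule integral_norm_bound)
  also have "\<dots> \<le> (LBINT x. \<bar>w x\<bar>)"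
    using assms(2) by (intro integral_mono integrable_norm integrable_mult_bounded assms)
      (auto simp: abs_mult mult_left_le intro: integrable_abs assms(3))
  finally show ?thesis by simp
qed

text \<open>Simple functions are dense in L1, and |u i| \<le> 1 makes the approximation error
  uniform in i.\<close>

lemma weak_null_integrable:
  fixes u :: "'i \<Rightarrow> real \<Rightarrow> real"
  assumes F: "F \<noteq> bot"
    and u: "\<And>i. u i \<in> borel_measurable borel" "\<And>i x. \<bar>u i x\<bar> \<le> 1"
    and supp: "\<And>i x. x \<notin> {a..b} \<Longrightarrow> u i x = 0"
    and box: "\<And>y. ((\<lambda>i. LBINT x:{a..b} \<inter> {..y}. u i x) \<longlongrightarrow> 0) F"
    and w: "integrable lborel w"
  shows "((\<lambda>i. LBINT x. w x * u i x) \<longlongrightarrow> 0) F"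
  using w
proof (induction rule: integrable_induct)
  case (base A c)
  have "(LBINT x. indicator A x *\<^sub>R c * u i x) = c * (LBINT x:{a..b} \<inter> A. u i x)" for i
  proof -
    have "(LBINT x. indicator A x *\<^sub>R c * u i x) = (LBINT x. c * (indicator ({a..b} \<inter> A) x *\<^sub>R u i x))"
      using supp by (intro Bochner_Integration.integral_cong) (auto simp: indicator_def)
    then show ?thesis by (simp add: set_lebesgue_integral_def)
  qed
  then show ?case
    using tendsto_mult_right_zero[OF weak_null_borel[OF F u box], of A c] base by simp
next
  case (add f g)
  have "(LBINT x. (f x + g x) * u i x) = (LBINT x. f x * u i x) + (LBINT x. g x * u i x)" for i
    using integrable_mult_bounded[OF u add.hyps(1)] integrable_mult_bounded[OF u add.hyps(2)]
    by (simp add: distrib_right)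
  then show ?case using tendsto_add[OF add.IH] by simp
next
  case (lim f s)
  \<comment> \<open>The approximating functions satisfy |s j| \<le> 2 |f|, whence the majorant 3
    |f|.\<close>
  have lim0: "(\<lambda>j. LBINT x. \<bar>s j x - f x\<bar>) \<longlonglongrightarrow> (LBINT x::real. 0)"
  proof (rule integral_dominated_convergence[where w = "\<lambda>x. 3 * \<bar>f x\<bar>"])
    show "(\<lambda>x. \<bar>s j x - f x\<bar>) \<in> borel_measurable lborel" for j
      using lim.hyps(1)[of j] lim.hyps(4) by (intro borel_measurable_abs borel_measurable_diff borel_measurable_integrable)
    show "AE x in lborel. norm \<bar>s j x - f x\<bar> \<le> 3 * \<bar>f x\<bar>" for j
    proof (intro AE_I2)
      fix x :: real
      have "\<bar>s j x\<bar> \<le> 2 * \<bar>f x\<bar>" using lim.hyps(3)[of x j] by simp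
      then show "norm \<bar>s j x - f x\<bar> \<le> 3 * \<bar>f x\<bar>" by simp
    qed
    show "AE x in lborel. (\<lambda>j. \<bar>s j x - f x\<bar>) \<longlonglongrightarrow> 0"
    proof (intro AE_I2)
      fix x :: real
      have "(\<lambda>j. \<bar>s j x - f x\<bar>) \<longlonglongrightarrow> \<bar>f x - f x\<bar>" by (intro tendsto_intros lim.hyps(2)) simp
      then show "(\<lambda>j. \<bar>s j x - f x\<bar>) \<longlonglongrightarrow> 0" by simp
    qed
  qed (use lim.hyps(4) in auto)
  show ?case
  proof (rule tendstoI)
    fix e :: real assume e: "0 < e"
    have "eventually (\<lambda>j. (LBINT x. \<bar>s j x - f x\<bar>) < e/2) sequentially"
      using order_tendstoD(2)[OF lim0, of "e/2"] e by simp
    then obtain j where j: "(LBINT x. \<bar>s j x - f x\<bar>) < e/2" by (auto dest: eventually_happens)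
    have "eventually (\<lambda>i. dist (LBINT x. s j x * u i x) 0 < e/2) F"
      using tendstoD[OF lim.IH[of j], of "e/2"] e by simp
    then show "eventually (\<lambda>i. dist (LBINT x. f x * u i x) 0 < e) F"
    proof (rule eventually_mono)
      fix i assume i: "dist (LBINT x. s j x * u i x) 0 < e/2"
      have "(LBINT x. s j x * u i x) - (LBINT x. f x * u i x) = (LBINT x. (s j x - f x) * u i x)"
        using integrable_mult_bounded[OF u lim.hyps(1)[of j]] integrable_mult_bounded[OF u lim.hyps(4)]
        by (simp add: left_diff_distrib)
      moreover have "\<bar>LBINT x. (s j x - f x) * u i x\<bar> \<le> (LBINT x. \<bar>s j x - f x\<bar>)"
        using lim.hyps(1)[of j] lim.hyps(4) by (intro abs_integral_mult_bounded u) auto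
      ultimately show "dist (LBINT x. f x * u i x) 0 < e" using i j by (simp add: dist_real_def)
    qed
  qed
qed

text \<open>The limits define a measure: countable additivity is again Tannery's theorem, and
  domination by Lebesgue measure gives absolute continuity, so Radon-Nikodym applies.\<close>

lemma density_of_setwise_limit:
  fixes u :: "nat \<Rightarrow> real \<Rightarrow> real"
  assumes u: "\<And>i. u i \<in> borel_measurable borel" "\<And>i x. 0 \<le> u i x" "\<And>i x. u i x \<le> 1"
    and conv: "\<And>A. A \<in> sets borel \<Longrightarrow> convergent (\<lambda>i. LBINT x:{a..b} \<inter> A. u i x)"
  shows "\<exists>h. h \<in> borel_measurable borel \<and> (\<forall>x. 0 \<le> h x) \<and> integrable lborel h \<and>
    (\<forall>A\<in>sets borel. (\<lambda>i. LBINT x:{a..b} \<inter> A. u i x) \<longlonglongrightarrow> (LBINT x:A. h x))"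
proof -
  define m where "m A = lim (\<lambda>i. LBINT x:{a..b} \<inter> A. u i x)" for A
  have lim: "(\<lambda>i. LBINT x:{a..b} \<inter> A. u i x) \<longlonglongrightarrow> m A" if "A \<in> sets borel" for A
    using conv[OF that] by (simp add: m_def convergent_LIMSEQ_iff)
  have abs_u: "\<bar>u i x\<bar> \<le> 1" for i x using u(2,3)[of i x] by simp
  have fin: "emeasure lborel ({a..b} \<inter> A) < \<infinity>" for A :: "real set"
    by (rule le_less_trans[OF emeasure_mono[of _ "{a..b}"]]) (auto simp: emeasure_lborel_Icc_eq)
  have int: "set_integrable lborel ({a..b} \<inter> A) (u i)" if "A \<in> sets borel" for A i
    by (rule bounded_set_integrable[OF u(1) abs_u]) (use that fin in auto)
  have nn: "0 \<le> (LBINT x:{a..b} \<inter> A. u i x)" for A i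
    unfolding set_lebesgue_integral_def by (rule integral_nonneg_AE) (use u in auto)
  have m_nn: "0 \<le> m A" if "A \<in> sets borel" for A
    by (rule LIMSEQ_le_const[OF lim[OF that]]) (use nn in blast)
  have le: "(LBINT x:{a..b} \<inter> A. u i x) \<le> measure lborel ({a..b} \<inter> A)" if "A \<in> sets borel" for A i
    using abs_set_integral_le_measure[OF u(1) abs_u, of "{a..b} \<inter> A" i] that fin by auto
  define N where "N = measure_of UNIV (sets borel) (\<lambda>A. ennreal (m A))"
  have sets_N: "sets N = sets borel"
    unfolding N_def by (metis sets.sets_measure_of_eq space_borel)
  have N: "emeasure N A = ennreal (m A)" if A: "A \<in> sets borel" for A
  proof (rule emeasure_measure_of[OF N_def])
    show "sets borel \<subseteq> Pow UNIV" by simp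
    show "A \<in> sets N" using A sets_N by simp
    have "m {} = 0" using LIMSEQ_unique[OF lim[of "{}"], of 0] by (simp add: set_lebesgue_integral_def)
    then show "positive (sets N) (\<lambda>A. ennreal (m A))" by (simp add: positive_def)
    show "countably_additive (sets N) (\<lambda>A. ennreal (m A))"
    proof (rule countably_additiveI)
      fix A :: "nat \<Rightarrow> real set" assume "range A \<subseteq> sets N" and disj: "disjoint_family A"
      then have A: "A k \<in> sets borel" for k using sets_N by auto
      have eq: "(LBINT x:{a..b} \<inter> (\<Union>k. A k). u i x) = (\<Sum>k. LBINT x:{a..b} \<inter> A k. u i x)" for i
      proof -
        have "(LBINT x:(\<Union>k. {a..b} \<inter> A k). u i x) = (\<Sum>k. LBINT x:{a..b} \<inter> A k. u i x)"
          by (rule lebesgue_integral_countable_add)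
             (use A disj int[of "\<Union>k. A k"] in \<open>auto simp: disjoint_family_on_def\<close>)
        then show ?thesis by simp
      qed
      have "(\<lambda>k. measure lborel ({a..b} \<inter> A k)) sums measure lborel (\<Union>k. {a..b} \<inter> A k)"
        by (rule measure_UNION) (use A disj fin[of "\<Union>k. A k"] in \<open>auto simp: disjoint_family_on_def\<close>)
      then have sm: "summable (\<lambda>k. measure lborel ({a..b} \<inter> A k))" by (rule sums_summable)
      have t: "summable (\<lambda>k. norm (m (A k))) \<and> (\<lambda>i. \<Sum>k. LBINT x:{a..b} \<inter> A k. u i x) \<longlonglongrightarrow> (\<Sum>k. m (A k))"
      proof (rule tannerys_theorem[THEN conjunct2, OF lim[OF A] _ sm])
        show "eventually (\<lambda>(k, i). norm (LBINT x:{a..b} \<inter> A k. u i x) \<le> measure lborel ({a..b} \<inter> A k)) (at_top \<times>\<^sub>F sequentially)"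
          using le A nn by (intro always_eventually) auto
      qed simp
      have "m (\<Union>k. A k) = (\<Sum>k. m (A k))"
        using LIMSEQ_unique[OF lim[of "\<Union>k. A k"]] t A by (simp add: eq)
      moreover have "(\<Sum>k. ennreal (m (A k))) = ennreal (\<Sum>k. m (A k))"
        using t m_nn[OF A] summable_norm_cancel by (intro suminf_ennreal2) auto
      ultimately show "(\<Sum>k. ennreal (m (A k))) = ennreal (m (\<Union>k. A k))" by simp
    qed
  qed
  have "absolutely_continuous lborel N"
    unfolding absolutely_continuous_def
  proof
    fix A :: "real set" assume A: "A \<in> null_sets lborel"
    then have A': "A \<in> sets borel" by auto
    have "emeasure lborel ({a..b} \<inter> A) \<le> 0"
      using A emeasure_mono[of "{a..b} \<inter> A" A lborel] by (auto simp: null_sets_def)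
    then have "measure lborel ({a..b} \<inter> A) = 0" by (simp add: measure_def)
    then have "(LBINT x:{a..b} \<inter> A. u i x) = 0" for i using le[OF A', of i] nn[of A i] by simp
    then have "m A = 0" using LIMSEQ_unique[OF lim[OF A']] by simp
    then show "A \<in> null_sets N" using N[OF A'] A' sets_N by (auto simp: null_sets_def)
  qed
  then obtain f where f: "f \<in> borel_measurable lborel" "density lborel f = N"
    using sigma_finite_measure.Radon_Nikodym[OF lborel.sigma_finite_measure_axioms, of N] sets_N by auto
  have fN: "(\<integral>\<^sup>+x. f x * indicator A x \<partial>lborel) = ennreal (m A)" if "A \<in> sets borel" for A
  proof -
    have "emeasure (density lborel f) A = ennreal (m A)" using N[OF that] by (simp only: f(2))
    then show ?thesis by (subst (asm) emeasure_density) (use f(1) that in auto)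
  qed
  \<comment> \<open>The total mass \<open>m UNIV\<close> is finite, so the density can be taken
    real-valued.\<close>
  have "AE x in lborel. f x \<noteq> \<infinity>"
    using fN[of UNIV] f(1) by (intro nn_integral_PInf_AE) auto
  then have ae: "AE x in lborel. ennreal (enn2real (f x)) = f x"
    by eventually_elim (auto simp: less_top)
  define h where "h x = enn2real (f x)" for x
  have hm: "h \<in> borel_measurable borel" using f(1) unfolding h_def by measurable
  have hA: "(\<integral>\<^sup>+x. ennreal (indicator A x * h x) \<partial>lborel) = ennreal (m A)" if "A \<in> sets borel" for A
    unfolding fN[OF that, symmetric] h_def
    by (rule nn_integral_cong_AE) (use ae in \<open>eventually_elim, auto simp: indicator_def\<close>)
  have hint: "integrable lborel h"
    using hm hA[of UNIV] by (intro integrableI_nonneg) (auto simp: h_def)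
  have "(LBINT x:A. h x) = m A" if "A \<in> sets borel" for A
  proof -
    have "(LBINT x:A. h x) = enn2real (\<integral>\<^sup>+x. ennreal (indicator A x * h x) \<partial>lborel)"
      unfolding set_lebesgue_integral_def
      by (subst integral_eq_nn_integral) (use that hm in auto, simp_all add: h_def)
    then show ?thesis using hA[OF that] m_nn[OF that] by simp
  qed
  with lim hint hm show ?thesis by (intro exI[of _ h] conjI allI ballI) (simp_all, simp add: h_def)
qed

text \<open>A selection theorem of Helly type. The integrals over {0..x} are 1-Lipschitz in x in
  every component, so Arzela-Ascoli makes them converge along a subsequence, common to all k because
  they are collected in one vector. \<open>weak_null_borel\<close> then extends the convergence to
  Borel sets.\<close>

lemma weak_star_compact:
  fixes u :: "nat \<Rightarrow> 'k::finite \<Rightarrow> real \<Rightarrow> real"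
  assumes u: "\<And>i k. u i k \<in> borel_measurable borel" "\<And>i k x. 0 \<le> u i k x" "\<And>i k x. u i k x \<le> 1"
  obtains s h where "strict_mono (s :: nat \<Rightarrow> nat)"
    "\<And>k. h k \<in> borel_measurable borel" "\<And>k x. 0 \<le> h k x" "\<And>k. integrable lborel (h k)"
    "\<And>k A. A \<in> sets borel \<Longrightarrow> (\<lambda>i. LBINT x:{0..1} \<inter> A. u (s i) k x) \<longlonglongrightarrow> (LBINT x:A. h k x)"
proof -
  have abs_u: "\<bar>u i k x\<bar> \<le> 1" for i k x using u(2,3)[of i k x] by simp
  have int: "set_integrable lborel A (u i k)" if "A \<in> sets borel" "emeasure lborel A < \<infinity>" for A i k
    by (rule bounded_set_integrable[OF u(1) abs_u that])
  define F where "F i x = (\<chi> k. LBINT y:{0..x}. u i k y)" for i and x :: real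
  have lip: "\<bar>F i x $ k - F i y $ k\<bar> \<le> \<bar>x - y\<bar>" if "0 \<le> x" "0 \<le> y" for i k x y
    using that
  proof (induction x y rule: linorder_wlog)
    case (le x y)
    have "(LBINT z:{0..x} \<union> {x<..y}. u i k z) = (LBINT z:{0..x}. u i k z) + (LBINT z:{x<..y}. u i k z)"
      by (rule set_integral_Un) (use le in \<open>auto intro!: int simp: emeasure_lborel_Icc_eq\<close>)
    moreover have "{0..x} \<union> {x<..y} = {0..y}" using le by auto
    moreover have "\<bar>LBINT z:{x<..y}. u i k z\<bar> \<le> measure lborel {x<..y}"
      by (rule abs_set_integral_le_measure[OF u(1) abs_u]) (use le in auto)
    ultimately show ?case using le by (simp add: F_def abs_minus_commute)
  next
    case (sym x y)
    then show ?case by (simp add: abs_minus_commute)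
  qed
  have F0: "F i 0 $ k = 0" for i k
    using abs_set_integral_le_measure[OF u(1) abs_u, of "{0..0}" i k] by (simp add: F_def)
  have normF: "norm (F i x - F i y) \<le> real CARD('k) * \<bar>x - y\<bar>" if "0 \<le> x" "0 \<le> y" for i x y
  proof -
    have "norm (F i x - F i y) \<le> (\<Sum>k\<in>UNIV. \<bar>(F i x - F i y) $ k\<bar>)" by (rule norm_le_l1_cart)
    also have "\<dots> \<le> (\<Sum>k\<in>(UNIV::'k set). \<bar>x - y\<bar>)" using lip[OF that] by (intro sum_mono) simp
    finally show ?thesis by simp
  qed
  have c: "0 < real CARD('k)" by simp
  obtain g s where s: "strict_mono (s :: nat \<Rightarrow> nat)"
    and g: "\<And>e. 0 < e \<Longrightarrow> \<exists>N. \<forall>n x. n \<ge> N \<and> x \<in> {0..1} \<longrightarrow> norm (F (s n) x - g x) < e"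
  proof (rule Arzela_Ascoli[of "{0..1::real}" F "real CARD('k)"])
    show "norm (F n x) \<le> real CARD('k)" if "x \<in> {0..1}" for n x
    proof -
      have "F n 0 = 0" by (simp add: vec_eq_iff F0)
      then have "norm (F n x) \<le> real CARD('k) * \<bar>x\<bar>" using normF[of x 0 n] that by simp
      also have "\<dots> \<le> real CARD('k)" using that by (simp add: mult_left_le)
      finally show ?thesis .
    qed
    show "\<exists>d>0. \<forall>n y. y \<in> {0..1} \<and> norm (x - y) < d \<longrightarrow> norm (F n x - F n y) < e"
      if "x \<in> {0..1}" "0 < e" for x e :: real
    proof (intro exI[of _ "e / real CARD('k)"] conjI allI impI)
      fix n y assume y: "y \<in> {0..1} \<and> norm (x - y) < e / real CARD('k)"
      have "norm (F n x - F n y) \<le> real CARD('k) * \<bar>x - y\<bar>" using normF[of x y n] that y by simp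
      also have "\<dots> < real CARD('k) * (e / real CARD('k))" using y c by (intro mult_strict_left_mono) auto
      finally show "norm (F n x - F n y) < e" by simp
    qed (use that in simp)
  qed auto
  have boxeq: "(LBINT x:{0..1} \<inter> {..y}. u i k x) = F i (min 1 y) $ k" if "0 \<le> y" for i k y
  proof -
    have "{0..1} \<inter> {..y} = {0..min 1 y}" by auto
    then show ?thesis by (simp add: F_def)
  qed
  have ex: "\<exists>h. h \<in> borel_measurable borel \<and> (\<forall>x. 0 \<le> h x) \<and> integrable lborel h \<and>
      (\<forall>A\<in>sets borel. (\<lambda>i. LBINT x:{0..1} \<inter> A. u (s i) k x) \<longlonglongrightarrow> (LBINT x:A. h x))" for k
  proof -
    have conv: "convergent (\<lambda>i. LBINT x:{0..1} \<inter> A. u (s i) k x)" if A: "A \<in> sets borel" for A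
    proof -
      have finA: "emeasure lborel ({0..1} \<inter> A) < \<infinity>" for A :: "real set"
        by (rule le_less_trans[OF emeasure_mono[of _ "{0..1}"]]) (auto simp: emeasure_lborel_Icc_eq)
      \<comment> \<open>Differences over pairs of indices: null integrals along the product filter
        mean that the original integrals are Cauchy.\<close>
      define d where "d = (\<lambda>(i, j) x. u (s i) k x - u (s j) k x)"
      have deq: "(LBINT x:{0..1} \<inter> A. d (i, j) x) = (LBINT x:{0..1} \<inter> A. u (s i) k x) - (LBINT x:{0..1} \<inter> A. u (s j) k x)"
        if "A \<in> sets borel" for A i j
        unfolding d_def prod.case by (rule set_integral_diff(2)) (use that finA in \<open>auto intro!: int\<close>)
      have "((\<lambda>ij. LBINT x:{0..1} \<inter> A. d ij x) \<longlongrightarrow> 0) (sequentially \<times>\<^sub>F sequentially)"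
      proof (rule weak_null_borel[OF _ _ _ _ A])
        show "sequentially \<times>\<^sub>F sequentially \<noteq> (bot :: (nat \<times> nat) filter)" by (simp add: prod_filter_eq_bot)
        show "d ij \<in> borel_measurable borel" for ij unfolding d_def using u(1) by (cases ij) auto
        show "\<bar>d ij x\<bar> \<le> 1" for ij x
          using u(2,3)[of "s (fst ij)" k x] u(2,3)[of "s (snd ij)" k x] by (cases ij) (auto simp: d_def abs_le_iff)
        fix y :: real
        show "((\<lambda>ij. LBINT x:{0..1} \<inter> {..y}. d ij x) \<longlongrightarrow> 0) (sequentially \<times>\<^sub>F sequentially)"
        proof (cases "0 \<le> y")
          case False
          then have "{0..1} \<inter> {..y} = {}" by auto
          then show ?thesis by (simp add: set_lebesgue_integral_def)
        next
          case True
          show ?thesis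
          proof (rule tendstoI)
            fix e :: real assume "0 < e"
            then obtain N where N: "\<And>n x. n \<ge> N \<Longrightarrow> x \<in> {0..1} \<Longrightarrow> norm (F (s n) x - g x) < e/2"
              using g[of "e/2"] by auto
            have "dist (LBINT x:{0..1} \<inter> {..y}. d (i, j) x) 0 < e" if "i \<ge> N" "j \<ge> N" for i j
            proof -
              have "\<bar>F (s n) (min 1 y) $ k - g (min 1 y) $ k\<bar> < e/2" if "n \<ge> N" for n
                using component_le_norm_cart[of "F (s n) (min 1 y) - g (min 1 y)" k] N[OF that, of "min 1 y"] True
                by simp
              from this[OF \<open>i \<ge> N\<close>] this[OF \<open>j \<ge> N\<close>]
              have "\<bar>F (s i) (min 1 y) $ k - F (s j) (min 1 y) $ k\<bar> < e" by linarith
              moreover have "(LBINT x:{0..1} \<inter> {..y}. d (i, j) x) = F (s i) (min 1 y) $ k - F (s j) (min 1 y) $ k"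
                by (subst deq) (simp_all only: boxeq[OF True] atMost_borel)
              ultimately show ?thesis by (simp only: dist_real_def diff_zero)
            qed
            then have "eventually (\<lambda>(i, j). dist (LBINT x:{0..1} \<inter> {..y}. d (i, j) x) 0 < e) (sequentially \<times>\<^sub>F sequentially)"
              unfolding eventually_prod_sequentially by blast
            then show "eventually (\<lambda>ij. dist (LBINT x:{0..1} \<inter> {..y}. d ij x) 0 < e) (sequentially \<times>\<^sub>F sequentially)"
              by (simp add: case_prod_unfold)
          qed
        qed
      qed
      then have lim0: "((\<lambda>ij. LBINT x:{0..1} \<inter> A. d ij x) \<longlongrightarrow> 0) (sequentially \<times>\<^sub>F sequentially)" .
      have "Cauchy (\<lambda>i. LBINT x:{0..1} \<inter> A. u (s i) k x)"
      proof (rule CauchyI)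
        fix e :: real assume "0 < e"
        have "eventually (\<lambda>ij. dist (LBINT x:{0..1} \<inter> A. d ij x) 0 < e) (sequentially \<times>\<^sub>F sequentially)"
          by (rule tendstoD[OF lim0 \<open>0 < e\<close>])
        then have "eventually (\<lambda>(i, j). dist (LBINT x:{0..1} \<inter> A. d (i, j) x) 0 < e) (sequentially \<times>\<^sub>F sequentially)"
          by (simp add: case_prod_unfold)
        then obtain N where N: "\<And>i j. i \<ge> N \<Longrightarrow> j \<ge> N \<Longrightarrow> dist (LBINT x:{0..1} \<inter> A. d (i, j) x) 0 < e"
          unfolding eventually_prod_sequentially by blast
        then show "\<exists>M. \<forall>m\<ge>M. \<forall>n\<ge>M. norm ((LBINT x:{0..1} \<inter> A. u (s m) k x) - (LBINT x:{0..1} \<inter> A. u (s n) k x)) < e"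
          by (intro exI[of _ N]) (simp add: deq[OF A] dist_real_def)
      qed
      then show ?thesis by (simp add: real_Cauchy_convergent)
    qed
    show ?thesis
      by (rule density_of_setwise_limit[of "\<lambda>i. u (s i) k" 0 1, OF u conv])
  qed
  from choice[OF allI[OF ex]] obtain h where h: "\<forall>k. h k \<in> borel_measurable borel \<and> (\<forall>x. 0 \<le> h k x) \<and> integrable lborel (h k) \<and>
      (\<forall>A\<in>sets borel. (\<lambda>i. LBINT x:{0..1} \<inter> A. u (s i) k x) \<longlonglongrightarrow> (LBINT x:A. h k x))"
    by (rule exE)
  show ?thesis by (rule that[OF s, of h]) (use h in blast)+
qed


text \<open>Substituting belief for time turns the integral into one against the density 1 / speed
  on the stretch of beliefs travelled up to time b. These densities converge in L1, so the moving
  density may be replaced by its limit, after which the weak convergence of r is tested on a fixed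
  integrable function.\<close>

lemma weak_limit_flow_box:
  fixes r :: "nat \<Rightarrow> real \<Rightarrow> real" and h :: "real \<Rightarrow> real"
  assumes Es: "econ_tendsto Es E sequentially" and vEs: "\<And>n. valid_economy (Es n)" and E: "valid_economy E"
    and ps: "ps \<longlonglongrightarrow> p" and ms: "ms \<longlonglongrightarrow> m" "\<And>n. 0 < ms n \<and> ms n < 1" "0 < m" "m < 1"
    and r: "\<And>n. r n \<in> borel_measurable borel" "\<And>n x. 0 \<le> r n x \<and> r n x \<le> 1"
    and h: "h \<in> borel_measurable borel" "\<And>x. 0 \<le> h x \<and> h x \<le> 1"
    and weak: "\<And>y. (\<lambda>n. LBINT x:{0..1} \<inter> {..y}. r n x - h x) \<longlonglongrightarrow> 0"
    and b: "0 \<le> b"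
  shows "(\<lambda>n. LBINT t:{0..b}. r n (flow (Es n) (ps n) t (ms n)) - h (flow E p t m)) \<longlonglongrightarrow> 0"
proof -
  \<comment> \<open>The density of the time that the path spends at each belief up to time
    b.\<close>
  define dens where "dens E' p' m' y = indicator {flow E' p' b m'..m'} y * (1 / speed E' p' y)" for E' p' m' and y :: real
  have subst: "(LBINT t:{0..b}. f (flow E' p' t m')) = (LBINT y. dens E' p' m' y * f y)"
      and dens_int: "integrable lborel (dens E' p' m')" and dens_nn: "\<And>y. 0 \<le> dens E' p' m' y"
      and flow_le: "flow E' p' b m' \<le> m'"
    if v: "valid_economy E'" and m': "0 < m'" "m' < 1" and f: "f \<in> borel_measurable borel" "\<And>x. 0 \<le> f x \<and> f x \<le> 1"
    for E' p' m' and f :: "real \<Rightarrow> real"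
  proof -
    define s where "s = clock E' p' m'"
    define lo where "lo = flow E' p' b m'"
    have lo: "0 < lo" "lo < 1" "clock E' p' lo = s - b"
      using flow_interior[OF v m', of p' b] unclock(3)[OF v] m' by (auto simp: lo_def s_def flow_def)
    have lom: "lo \<le> m'" using clock_less_iff[OF v m' lo(1,2), of p'] b lo(3) by (simp add: s_def)
    then show "flow E' p' b m' \<le> m'" by (simp add: lo_def)
    have [measurable]: "unclock E' p' \<in> borel_measurable borel"
      by (intro borel_measurable_continuous_onI continuous_at_imp_continuous_on) (simp add: isCont_unclock[OF v])
    note [measurable] = f(1)
    have sub: "{lo..m'} \<subseteq> {0<..<1}" using lo m' by auto
    have cont: "continuous_on {lo..m'} (\<lambda>y. 1 / speed E' p' y)" by (rule continuous_on_inverse_speed[OF v sub])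
    have sp: "0 \<le> 1 / speed E' p' y" if "y \<in> {lo..m'}" for y
      using speed_pos[OF v, of y p'] that sub by auto
    show "integrable lborel (dens E' p' m')"
      using borel_integrable_atLeastAtMost'[OF cont] unfolding set_integrable_def dens_def[abs_def] lo_def by simp
    show "0 \<le> dens E' p' m' y" for y
      using sp[of y] by (auto simp: dens_def lo_def indicator_def)
    have "(LBINT t:{0..b}. f (flow E' p' t m')) = (LBINT t. indicator {0..b} t * f (unclock E' p' (s - t)))"
      unfolding set_lebesgue_integral_def using m' by (simp add: flow_def s_def)
    \<comment> \<open>Reversing time prepares the substitution by the clock, which is
      increasing.\<close>
    also have "\<dots> = (LBINT t. indicator {0..b} (s + - 1 * t) * f (unclock E' p' (s - (s + - 1 * t))))"
      by (subst lborel_integral_real_affine[of "-1" _ s]) auto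
    also have "\<dots> = (LBINT t. f (unclock E' p' t) * indicator {clock E' p' lo..clock E' p' m'} t)"
      by (intro Bochner_Integration.integral_cong refl) (auto simp: lo(3) s_def[symmetric] indicator_def)
    also have "\<dots> = (LBINT y. f (unclock E' p' (clock E' p' y)) * (1 / speed E' p' y) * indicator {lo..m'} y)"
    proof (rule integral_substitution(2)[OF _ _ cont sp lom])
      show "set_integrable lborel {clock E' p' lo..clock E' p' m'} (\<lambda>t. f (unclock E' p' t))"
        by (rule bounded_set_integrable[of _ 1]) (use f(2) in \<open>auto simp: emeasure_lborel_Icc_eq\<close>)
      show "(clock E' p' has_real_derivative 1 / speed E' p' x) (at x)" if "x \<in> {lo..m'}" for x
        by (rule DERIV_clock[OF v]) (use that sub in auto)
    qed
    also have "\<dots> = (LBINT y. dens E' p' m' y * f y)"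
      using sub unclock_clock[OF v] by (intro Bochner_Integration.integral_cong refl) (auto simp: dens_def lo_def indicator_def)
    finally show "(LBINT t:{0..b}. f (flow E' p' t m')) = (LBINT y. dens E' p' m' y * f y)" .
  qed
  have one: "(\<lambda>_. 1) \<in> borel_measurable borel" "\<And>x. 0 \<le> (1::real) \<and> (1::real) \<le> 1" by auto
  \<comment> \<open>Every path spends total time b, so all densities have the same mass; this is
    what lets Scheffe's lemma turn pointwise into L1 convergence below.\<close>
  have dens_total: "(LBINT y. dens E' p' m' y) = b" if "valid_economy E'" "0 < m'" "m' < 1" for E' p' m'
    using subst[OF that one] b by (simp add: set_lebesgue_integral_def)
  define D where "D n y = dens (Es n) (ps n) (ms n) y - dens E p m y" for n y
  have D_int: "integrable lborel (D n)" for n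
    unfolding D_def using dens_int[OF vEs _ _ one] dens_int[OF E ms(3,4) one] ms(2) by (intro Bochner_Integration.integrable_diff) auto
  have "(\<lambda>n. \<integral>\<^sup>+y. norm (dens (Es n) (ps n) (ms n) y - dens E p m y) \<partial>lborel) \<longlonglongrightarrow> 0"
  proof (rule Scheffe_lemma2)
    show "dens (Es n) (ps n) (ms n) \<in> borel_measurable lborel" for n
      using dens_int[OF vEs _ _ one] ms(2) by blast
    show "integrable lborel (dens E p m)" by (rule dens_int[OF E ms(3,4) one])
    have nn: "(\<integral>\<^sup>+y. norm (dens E' p' m' y) \<partial>lborel) = ennreal b" if "valid_economy E'" "0 < m'" "m' < 1" for E' p' m'
      using nn_integral_eq_integral[OF dens_int[OF that one]] dens_nn[OF that one] dens_total[OF that] by simp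
    show "(\<integral>\<^sup>+y. norm (dens (Es n) (ps n) (ms n) y) \<partial>lborel) \<le> (\<integral>\<^sup>+y. norm (dens E p m y) \<partial>lborel)" for n
      using nn[OF vEs, of "ms n" n "ps n"] nn[OF E ms(3,4), of p] ms(2)[of n] by simp
    have fl: "(\<lambda>n. flow (Es n) (ps n) b (ms n)) \<longlonglongrightarrow> flow E p b m"
      by (rule tendsto_flow[OF Es vEs E ps ms(3,4,1) tendsto_const])
    \<comment> \<open>The two ends of the limiting stretch are set aside: there the indicators may
      jump.\<close>
    have "AE y in lborel. y \<noteq> m" "AE y in lborel. y \<noteq> flow E p b m" by (rule AE_lborel_singleton)+
    then show "AE y in lborel. (\<lambda>n. dens (Es n) (ps n) (ms n) y) \<longlonglongrightarrow> dens E p m y"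
    proof eventually_elim
      fix y assume y: "y \<noteq> m" "y \<noteq> flow E p b m"
      consider "y < flow E p b m" | "m < y" | "flow E p b m < y" "y < m" using y by linarith
      then show "(\<lambda>n. dens (Es n) (ps n) (ms n) y) \<longlonglongrightarrow> dens E p m y"
      proof cases
        case 1
        have "eventually (\<lambda>n. dens (Es n) (ps n) (ms n) y = 0) sequentially"
          using order_tendstoD(1)[OF fl 1] by eventually_elim (simp add: dens_def)
        then show ?thesis using 1 by (simp add: dens_def tendsto_eventually)
      next
        case 2
        have "eventually (\<lambda>n. dens (Es n) (ps n) (ms n) y = 0) sequentially"
          using order_tendstoD(2)[OF ms(1) 2] by eventually_elim (simp add: dens_def)
        then show ?thesis using 2 by (simp add: dens_def tendsto_eventually)
      next
        case 3
        have y01: "0 < y" "y < 1" using 3 ms(4) flow_interior(1)[OF E ms(3,4), of p b] by auto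
        have "eventually (\<lambda>n. 1 / speed (Es n) (ps n) y = dens (Es n) (ps n) (ms n) y) sequentially"
          using order_tendstoD(2)[OF fl 3(1)] order_tendstoD(1)[OF ms(1) 3(2)] by eventually_elim (simp add: dens_def)
        moreover have "(\<lambda>n. 1 / speed (Es n) (ps n) y) \<longlonglongrightarrow> 1 / speed E p y"
          by (rule tendsto_divide[OF tendsto_const tendsto_speed[OF Es E tendsto_const _ ps]])
             (use y01 speed_pos[OF E y01, of p] in simp_all)
        ultimately have "(\<lambda>n. dens (Es n) (ps n) (ms n) y) \<longlonglongrightarrow> 1 / speed E p y" by (rule Lim_transform_eventually[rotated])
        then show ?thesis using 3 by (simp add: dens_def)
      qed
    qed
  qed
  moreover have "(\<integral>\<^sup>+y. norm (D n y) \<partial>lborel) = ennreal (LBINT y. \<bar>D n y\<bar>)" for n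
    using nn_integral_eq_integral[OF integrable_abs[OF D_int[of n]]] by simp
  ultimately have "(\<lambda>n. ennreal (LBINT y. \<bar>D n y\<bar>)) \<longlonglongrightarrow> ennreal 0" by (simp add: D_def)
  then have lim1: "(\<lambda>n. LBINT y. \<bar>D n y\<bar>) \<longlonglongrightarrow> 0"
    by (subst (asm) tendsto_ennreal_iff) (auto intro!: always_eventually)
  define u where "u n y = indicator {0..1} y * (r n y - h y)" for n and y :: real
  have "(\<lambda>n. LBINT y. dens E p m y * u n y) \<longlonglongrightarrow> 0"
  proof (rule weak_null_integrable[where a = 0 and b = 1])
    show "u n \<in> borel_measurable borel" for n using r(1) h(1) unfolding u_def by measurable
    show "\<bar>u n x\<bar> \<le> 1" for n x using r(2)[of n x] h(2)[of x] by (auto simp: u_def indicator_def abs_le_iff)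
    show "integrable lborel (dens E p m)" by (rule dens_int[OF E ms(3,4) one])
    show "(\<lambda>n. LBINT x:{0..1} \<inter> {..y}. u n x) \<longlonglongrightarrow> 0" for y
    proof -
      have "(LBINT x:{0..1} \<inter> {..y}. u n x) = (LBINT x:{0..1} \<inter> {..y}. r n x - h x)" for n
        unfolding set_lebesgue_integral_def u_def by (intro Bochner_Integration.integral_cong refl) (auto simp: indicator_def)
      then show ?thesis using weak by simp
    qed
  qed (auto simp: u_def)
  moreover have "dens E p m y * u n y = dens E p m y * (r n y - h y)" for n y
    using ms(4) flow_interior(1)[OF E ms(3,4), of p b] by (auto simp: u_def dens_def indicator_def)
  ultimately have lim2: "(\<lambda>n. LBINT y. dens E p m y * (r n y - h y)) \<longlonglongrightarrow> 0" by simp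
  have abs_r: "\<bar>r n x\<bar> \<le> 1" "\<bar>h x\<bar> \<le> 1" for n x using r(2)[of n x] h(2)[of x] by auto
  \<comment> \<open>The error splits into the change of density, tested on a function bounded by 1,
    and the change of r against the fixed limiting density.\<close>
  have eq: "(LBINT t:{0..b}. r n (flow (Es n) (ps n) t (ms n)) - h (flow E p t m))
      = (LBINT y. D n y * r n y) + (LBINT y. dens E p m y * (r n y - h y))" for n
  proof -
    have msn: "0 < ms n" "ms n < 1" using ms(2) by auto
    have cm: "(\<lambda>t. flow E' p' t x) \<in> borel_measurable borel" if "valid_economy E'" for E' p' x
      by (rule measurable_flow[OF that]) auto
    have "(LBINT t:{0..b}. r n (flow (Es n) (ps n) t (ms n)) - h (flow E p t m))
        = (LBINT t:{0..b}. r n (flow (Es n) (ps n) t (ms n))) - (LBINT t:{0..b}. h (flow E p t m))"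
      by (intro set_integral_diff(2) bounded_set_integrable[of _ 1] measurable_compose[OF cm[OF vEs] r(1)]
          measurable_compose[OF cm[OF E] h(1)]) (use abs_r in \<open>auto simp: emeasure_lborel_Icc_eq\<close>)
    also have "\<dots> = (LBINT y. dens (Es n) (ps n) (ms n) y * r n y) - (LBINT y. dens E p m y * h y)"
      by (simp only: subst[OF vEs msn r] subst[OF E ms(3,4) h])
    also have "(LBINT y. dens (Es n) (ps n) (ms n) y * r n y) = (LBINT y. D n y * r n y + dens E p m y * r n y)"
      by (simp add: D_def algebra_simps)
    also have "\<dots> = (LBINT y. D n y * r n y) + (LBINT y. dens E p m y * r n y)"
      using integrable_mult_bounded[OF r(1) abs_r(1)] D_int dens_int[OF E ms(3,4) one] by simp
    finally have 1: "(LBINT t:{0..b}. r n (flow (Es n) (ps n) t (ms n)) - h (flow E p t m))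
        = (LBINT y. D n y * r n y) + (LBINT y. dens E p m y * r n y) - (LBINT y. dens E p m y * h y)" .
    have 2: "(LBINT y. dens E p m y * (r n y - h y)) = (LBINT y. dens E p m y * r n y) - (LBINT y. dens E p m y * h y)"
      using integrable_mult_bounded[OF r(1) abs_r(1)] integrable_mult_bounded[OF h(1) abs_r(2)] dens_int[OF E ms(3,4) one]
      by (simp add: right_diff_distrib)
    show ?thesis using 1 2 by linarith
  qed
  have "(\<lambda>n. LBINT y. D n y * r n y) \<longlonglongrightarrow> 0"
    by (rule Lim_null_comparison[OF _ lim1]) (use abs_integral_mult_bounded[OF r(1) abs_r(1) D_int] in auto)
  from tendsto_add[OF this lim2] show ?thesis by (simp add: eq)
qed

text \<open>By \<open>weak_limit_flow_box\<close> the differences are weakly null as functions of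
  time; \<open>weak_null_integrable\<close> passes from boxes to integrable weights on a bounded
  horizon, and beyond a large horizon the weight has little mass.\<close>

lemma weak_limit_flow:
  fixes r :: "nat \<Rightarrow> real \<Rightarrow> real" and h w :: "real \<Rightarrow> real"
  assumes Es: "econ_tendsto Es E sequentially" and vEs: "\<And>n. valid_economy (Es n)" and E: "valid_economy E"
    and ps: "ps \<longlonglongrightarrow> p" and ms: "ms \<longlonglongrightarrow> m" "\<And>n. 0 < ms n \<and> ms n < 1" "0 < m" "m < 1"
    and r: "\<And>n. r n \<in> borel_measurable borel" "\<And>n x. 0 \<le> r n x \<and> r n x \<le> 1"
    and h: "h \<in> borel_measurable borel" "\<And>x. 0 \<le> h x \<and> h x \<le> 1"
    and weak: "\<And>y. (\<lambda>n. LBINT x:{0..1} \<inter> {..y}. r n x - h x) \<longlonglongrightarrow> 0"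
    and w: "integrable lborel w" "\<And>t. t < 0 \<Longrightarrow> w t = 0"
  shows "(\<lambda>n. LBINT t. w t * (r n (flow (Es n) (ps n) t (ms n)) - h (flow E p t m))) \<longlonglongrightarrow> 0"
proof -
  define d where "d n t = r n (flow (Es n) (ps n) t (ms n)) - h (flow E p t m)" for n t
  have cm: "(\<lambda>t. flow E' p' t x) \<in> borel_measurable borel" if "valid_economy E'" for E' p' x
    by (rule measurable_flow[OF that]) auto
  have d: "d n \<in> borel_measurable borel" "\<bar>d n t\<bar> \<le> 1" for n t
    using borel_measurable_diff[OF measurable_compose[OF cm[OF vEs] r(1)] measurable_compose[OF cm[OF E] h(1)], of n n "ps n" "ms n" p m]
      r(2)[of n "flow (Es n) (ps n) t (ms n)"] h(2)[of "flow E p t m"]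
    by (auto simp: d_def[abs_def] abs_le_iff)
  have trunc: "(\<lambda>n. LBINT t. w t * (indicator {0..T} t * d n t)) \<longlonglongrightarrow> 0" for T
  proof (rule weak_null_integrable[where a = 0 and b = T, OF _ _ _ _ _ w(1)])
    show "(\<lambda>t. indicator {0..T} t * d n t) \<in> borel_measurable borel" for n using d(1) by measurable
    show "\<bar>indicator {0..T} t * d n t\<bar> \<le> 1" for n t using d(2) by (auto simp: indicator_def)
    fix y
    show "(\<lambda>n. LBINT t:{0..T} \<inter> {..y}. indicator {0..T} t * d n t) \<longlonglongrightarrow> 0"
    proof (cases "0 \<le> min T y")
      case True
      have "(LBINT t:{0..T} \<inter> {..y}. indicator {0..T} t * d n t) = (LBINT t:{0..min T y}. d n t)" for n
        unfolding set_lebesgue_integral_def by (intro Bochner_Integration.integral_cong refl) (auto simp: indicator_def)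
      then show ?thesis
        using weak_limit_flow_box[OF Es vEs E ps ms r h weak True] by (simp add: d_def)
    next
      case False
      then have "{0..T} \<inter> {..y} = {}" by auto
      then show ?thesis by (simp add: set_lebesgue_integral_def)
    qed
  qed auto
  have tail: "(\<lambda>T. LBINT t. \<bar>w t * (1 - indicator {0..real T} t)\<bar>) \<longlonglongrightarrow> (LBINT t::real. 0)"
  proof (rule integral_dominated_convergence[where w = "\<lambda>t. \<bar>w t\<bar>"])
    show "(\<lambda>t. \<bar>w t * (1 - indicator {0..real T} t)\<bar>) \<in> borel_measurable lborel" for T
      using w(1) by measurable
    show "AE t in lborel. (\<lambda>T. \<bar>w t * (1 - indicator {0..real T} t)\<bar>) \<longlonglongrightarrow> 0"
    proof (intro AE_I2 tendsto_eventually)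
      fix t :: real
      obtain N :: nat where "t \<le> N" using real_arch_simple by blast
      then have "\<bar>w t * (1 - indicator {0..real T} t)\<bar> = 0" if "T \<ge> N" for T
        using w(2)[of t] that by (cases "t < 0") (auto simp: indicator_def)
      then show "eventually (\<lambda>T. \<bar>w t * (1 - indicator {0..real T} t)\<bar> = 0) sequentially"
        unfolding eventually_sequentially by blast
    qed
    show "AE t in lborel. norm \<bar>w t * (1 - indicator {0..real T} t)\<bar> \<le> \<bar>w t\<bar>" for T
      by (intro AE_I2) (auto simp: indicator_def)
  qed (use w(1) in auto)
  have "(\<lambda>n. LBINT t. w t * d n t) \<longlonglongrightarrow> 0"
  proof (rule tendstoI)
    fix e :: real assume e: "0 < e"
    have "eventually (\<lambda>T. (LBINT t. \<bar>w t * (1 - indicator {0..real T} t)\<bar>) < e/2) sequentially"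
      using order_tendstoD(2)[OF tail, of "e/2"] e by simp
    then obtain T where T: "(LBINT t. \<bar>w t * (1 - indicator {0..real T} t)\<bar>) < e/2" by (auto dest: eventually_happens)
    have "eventually (\<lambda>n. dist (LBINT t. w t * (indicator {0..real T} t * d n t)) 0 < e/2) sequentially"
      using tendstoD[OF trunc, of "e/2"] e by simp
    then show "eventually (\<lambda>n. dist (LBINT t. w t * d n t) 0 < e) sequentially"
    proof (rule eventually_mono)
      fix n assume n: "dist (LBINT t. w t * (indicator {0..real T} t * d n t)) 0 < e/2"
      have wi: "integrable lborel (\<lambda>t. w t * indicator {0..real T} t)" "integrable lborel (\<lambda>t. w t * (1 - indicator {0..real T} t))"
        by (rule integrable_mult_bounded[OF _ _ w(1)]; auto simp: indicator_def)+
      have "(LBINT t. w t * d n t) = (LBINT t. (w t * indicator {0..real T} t) * d n t + (w t * (1 - indicator {0..real T} t)) * d n t)"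
        by (simp add: algebra_simps)
      also have "\<dots> = (LBINT t. (w t * indicator {0..real T} t) * d n t) + (LBINT t. (w t * (1 - indicator {0..real T} t)) * d n t)"
        using integrable_mult_bounded[OF d wi(1)] integrable_mult_bounded[OF d wi(2)] by (rule Bochner_Integration.integral_add)
      finally have "(LBINT t. w t * d n t) = (LBINT t. w t * (indicator {0..real T} t * d n t)) + (LBINT t. (w t * (1 - indicator {0..real T} t)) * d n t)"
        by (simp only: mult.assoc)
      moreover have "\<bar>LBINT t. (w t * (1 - indicator {0..real T} t)) * d n t\<bar> \<le> (LBINT t. \<bar>w t * (1 - indicator {0..real T} t)\<bar>)"
        by (rule abs_integral_mult_bounded[OF d wi(2)])
      ultimately show "dist (LBINT t. w t * d n t) 0 < e" using n T unfolding dist_real_def by linarith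
    qed
  qed
  then show ?thesis by (simp add: d_def)
qed


section \<open>Stability of the values under perturbation of the economy\<close>

text \<open>The discounting weight as a function on the line, so that integrands of different
  economies can be subtracted.\<close>

definition wt :: "economy \<Rightarrow> real \<Rightarrow> (real \<Rightarrow> real) \<Rightarrow> real \<Rightarrow> real \<Rightarrow> real" where
  "wt E p h \<mu> t = indicator {0..} t * exp (- disc E * t - (LBINT s:{0..t}. h (flow E p s \<mu>)))"

lemma path_value_wt: "path_value E p h \<Psi> \<mu> = (LBINT t. wt E p h \<mu> t * \<Psi> (flow E p t \<mu>))"
  by (simp add: path_value_def wt_def set_lebesgue_integral_def mult.assoc)

lemma flow_comp_measurable:
  fixes \<Psi> :: "real \<Rightarrow> real"
  assumes E: "valid_economy E" and \<Psi>: "set_borel_measurable borel {0..1} \<Psi>" and \<mu>: "\<mu> \<in> {0..1}"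
  shows "(\<lambda>t. \<Psi> (flow E p t \<mu>)) \<in> borel_measurable borel"
proof -
  have "(\<lambda>t. flow E p t \<mu>) \<in> borel_measurable borel" by (rule measurable_flow[OF E]) auto
  from measurable_compose[OF this \<Psi>[unfolded set_borel_measurable_def]]
  show ?thesis using flow_range[OF E \<mu>] by simp
qed

context silence_path
begin

lemma wt_measurable: "\<mu> \<in> {0..1} \<Longrightarrow> wt E p h \<mu> \<in> borel_measurable borel"
  using integrand_measurable_fixed[of "\<lambda>_. 1" \<mu>, OF set_borel_measurable_continuous]
  by (simp add: wt_def[abs_def])

text \<open>Here \<rho> is any lower bound of the discount rate, so one exponential can dominate the
  weights of a whole sequence of economies.\<close>

lemma wt_bounds:
  assumes "\<mu> \<in> {0..1}" "\<rho> \<le> disc E"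
  shows "0 \<le> wt E p h \<mu> t" "wt E p h \<mu> t \<le> indicator {0..} t * exp (- \<rho> * t)"
proof -
  show "0 \<le> wt E p h \<mu> t" by (simp add: wt_def)
  show "wt E p h \<mu> t \<le> indicator {0..} t * exp (- \<rho> * t)"
  proof (cases "0 \<le> t")
    case True
    have "\<rho> * t \<le> disc E * t" using assms(2) True by (rule mult_right_mono)
    then show ?thesis using hazard_bounds(1)[OF assms(1) True] True by (simp add: wt_def)
  qed (simp add: wt_def)
qed

lemma wt_integrable:
  assumes "\<mu> \<in> {0..1}" "g \<in> borel_measurable borel" "\<And>t. \<bar>g t\<bar> \<le> K"
  shows "integrable lborel (\<lambda>t. wt E p h \<mu> t * g t)"
proof (rule Bochner_Integration.integrable_bound[OF integrable_exp_decay[OF disc_pos, of K]])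
  show "(\<lambda>t. wt E p h \<mu> t * g t) \<in> borel_measurable lborel"
    using wt_measurable[OF assms(1)] assms(2) by simp
  show "AE t in lborel. norm (wt E p h \<mu> t * g t) \<le> norm (indicator {0..} t * (K * exp (- disc E * t)))"
  proof (intro AE_I2)
    fix t :: real
    have "wt E p h \<mu> t * \<bar>g t\<bar> \<le> (indicator {0..} t * exp (- disc E * t)) * K"
      using wt_bounds[OF assms(1) order_refl, of t] assms(3)[of t] by (intro mult_mono) auto
    also have "\<dots> \<le> \<bar>indicator {0..} t * (K * exp (- disc E * t))\<bar>" by (simp add: mult_ac)
    finally show "norm (wt E p h \<mu> t * g t) \<le> norm (indicator {0..} t * (K * exp (- disc E * t)))"
      using wt_bounds(1)[OF assms(1) order_refl, of t] by (simp add: abs_mult)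
  qed
qed

end

text \<open>Used with X the open unit interval or {1}. Both are invariant under the flow and under
  purchases, so sequences of beliefs remain of this kind at all later times.\<close>

definition adm :: "real set \<Rightarrow> (nat \<Rightarrow> real) \<Rightarrow> real \<Rightarrow> bool" where
  "adm X ms m \<longleftrightarrow> (\<forall>n. ms n \<in> X) \<and> m \<in> X \<and> ms \<longlonglongrightarrow> m"

lemma adm_flow:
  assumes X: "X = {0<..<1} \<or> X = {1}" and Es: "econ_tendsto Es E sequentially"
    and vEs: "\<And>n. valid_economy (Es n)" and E: "valid_economy E" and ps: "ps \<longlonglongrightarrow> p" and ms: "adm X ms m"
  shows "adm X (\<lambda>n. flow (Es n) (ps n) t (ms n)) (flow E p t m)"
  using X
proof
  assume X: "X = {0<..<1}"
  then have "(\<lambda>n. flow (Es n) (ps n) t (ms n)) \<longlonglongrightarrow> flow E p t m"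
    using ms by (intro tendsto_flow[OF Es vEs E ps]) (auto simp: adm_def)
  then show ?thesis
    using ms X flow_interior[OF vEs] flow_interior[OF E] by (simp add: adm_def)
qed (use ms in \<open>simp add: adm_def\<close>)

lemma adm_J0:
  assumes X: "X = {0<..<1} \<or> X = {1}" and Es: "econ_tendsto Es E sequentially"
    and vEs: "\<And>n. valid_economy (Es n)" and E: "valid_economy E" and ps: "ps \<longlonglongrightarrow> p" and ms: "adm X ms m"
  shows "adm X (\<lambda>n. J0 (Es n) (ms n) (ps n)) (J0 E m p)"
  using X
proof
  assume X: "X = {0<..<1}"
  then have "(\<lambda>n. J0 (Es n) (ms n) (ps n)) \<longlonglongrightarrow> J0 E m p"
    using ms by (intro tendsto_J0[OF Es E _ _ ps]) (auto simp: adm_def)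
  then show ?thesis
    using ms X J0_interior[OF vEs] J0_interior[OF E] by (simp add: adm_def)
qed (use ms J0_endpoints(2)[OF vEs] J0_endpoints(2)[OF E] in \<open>simp add: adm_def\<close>)

lemma tendsto_wt:
  assumes A: "demand A" and X: "X = {0<..<1} \<or> X = {1}" and Es: "econ_tendsto Es E sequentially"
    and vEs: "\<And>n. valid_economy (Es n)" and E: "valid_economy E" and ps: "ps \<longlonglongrightarrow> p" and ms: "adm X ms m"
  shows "(\<lambda>n. wt (Es n) (ps n) (hazard A (Es n) (ps n)) (ms n) t) \<longlonglongrightarrow> wt E p (hazard A E p) m t"
proof -
  have X01: "y \<in> {0..1}" if "y \<in> X" for y using X that by auto
  have ms01: "ms n \<in> {0..1}" "m \<in> {0..1}" for n using ms X01 by (auto simp: adm_def)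
  have "(\<lambda>n. reset (Es n) + arrival (Es n)) \<longlonglongrightarrow> reset E + arrival E"
    by (intro tendsto_intros econ_tendstoD[OF Es])
  then have "Bseq (\<lambda>n. reset (Es n) + arrival (Es n))" using convergentI convergent_imp_Bseq by blast
  then obtain K where K: "\<And>n. norm (reset (Es n) + arrival (Es n)) \<le> K" by (auto simp: Bseq_def)
  have "(\<lambda>n. LBINT s:{0..t}. hazard A (Es n) (ps n) (flow (Es n) (ps n) s (ms n))) \<longlonglongrightarrow>
      (LBINT s:{0..t}. hazard A E p (flow E p s m))"
    unfolding set_lebesgue_integral_def
  proof (rule integral_dominated_convergence[where w = "\<lambda>s. indicator {0..t} s * K"])
    show "integrable lborel (\<lambda>s. indicator {0..t} s * K)"
      by (intro integrable_mult_left integrable_real_indicator) (auto simp: emeasure_lborel_Icc_eq)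
    show "(\<lambda>s. indicator {0..t} s *\<^sub>R hazard A E p (flow E p s m)) \<in> borel_measurable lborel"
      using flow_comp_measurable[OF E set_borel_measurable_continuous[OF silence_path.h_cont[OF path_hazard[OF A E]]] ms01(2)]
      by simp
    show "(\<lambda>s. indicator {0..t} s *\<^sub>R hazard A (Es n) (ps n) (flow (Es n) (ps n) s (ms n))) \<in> borel_measurable lborel" for n
      using flow_comp_measurable[OF vEs set_borel_measurable_continuous[OF silence_path.h_cont[OF path_hazard[OF A vEs]]] ms01(1)]
      by simp
    show "AE s in lborel. (\<lambda>n. indicator {0..t} s *\<^sub>R hazard A (Es n) (ps n) (flow (Es n) (ps n) s (ms n)))
        \<longlonglongrightarrow> indicator {0..t} s *\<^sub>R hazard A E p (flow E p s m)"
    proof (intro AE_I2 tendsto_scaleR tendsto_const)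
      fix s
      have "adm X (\<lambda>n. flow (Es n) (ps n) s (ms n)) (flow E p s m)" by (rule adm_flow[OF X Es vEs E ps ms])
      then show "(\<lambda>n. hazard A (Es n) (ps n) (flow (Es n) (ps n) s (ms n))) \<longlonglongrightarrow> hazard A E p (flow E p s m)"
        unfolding hazard_def using X01
        by (intro tendsto_intros econ_tendstoD[OF Es] tendsto_demand[OF A Es E _ _ ps]) (auto simp: adm_def)
    qed
    show "AE s in lborel. norm (indicator {0..t} s *\<^sub>R hazard A (Es n) (ps n) (flow (Es n) (ps n) s (ms n))) \<le> indicator {0..t} s * K" for n
    proof (intro AE_I2)
      fix s
      have "\<bar>hazard A (Es n) (ps n) (flow (Es n) (ps n) s (ms n))\<bar> \<le> K"
        using silence_path.h_range[OF path_hazard[OF A vEs] flow_range[OF vEs ms01(1)], of n "ps n" n "ps n" s n]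
          K[of n] by simp
      then show "norm (indicator {0..t} s *\<^sub>R hazard A (Es n) (ps n) (flow (Es n) (ps n) s (ms n))) \<le> indicator {0..t} s * K"
        by (simp add: indicator_def)
    qed
  qed
  then show ?thesis unfolding wt_def by (intro tendsto_intros econ_tendstoD[OF Es])
qed

lemma positive_convergent_lower:
  fixes a :: "nat \<Rightarrow> real"
  assumes "a \<longlonglongrightarrow> l" "0 < l" "\<And>n. 0 < a n"
  shows "\<exists>c>0. c \<le> l \<and> (\<forall>n. c \<le> a n)"
proof -
  have "(\<lambda>n. inverse (a n)) \<longlonglongrightarrow> inverse l" using assms(1,2) by (intro tendsto_inverse) auto
  then have "Bseq (\<lambda>n. inverse (a n))" using convergentI convergent_imp_Bseq by blast
  then obtain K where K: "0 < K" "\<And>n. norm (inverse (a n)) \<le> K" by (auto simp: Bseq_def)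
  have "inverse K \<le> a n" for n
    using le_imp_inverse_le[of "inverse (a n)" K] K(2)[of n] assms(3)[of n] by simp
  then show ?thesis using K(1) assms(2) by (intro exI[of _ "min l (inverse K)"]) (auto simp: min_le_iff_disj)
qed

lemma convergent_upper:
  fixes a :: "nat \<Rightarrow> real"
  assumes "a \<longlonglongrightarrow> l"
  shows "\<exists>K>0. \<bar>l\<bar> \<le> K \<and> (\<forall>n. \<bar>a n\<bar> \<le> K)"
proof -
  have "Bseq a" using assms convergentI convergent_imp_Bseq by blast
  then obtain K where K: "0 < K" "\<And>n. norm (a n) \<le> K" by (auto simp: Bseq_def)
  then show ?thesis by (intro exI[of _ "max K \<bar>l\<bar>"]) (auto simp: le_max_iff_disj)
qed

text \<open>An asymptotic bound by c becomes a null sequence, the form that dominated convergence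
  can use.\<close>

lemma tendsto_excess:
  fixes d :: "nat \<Rightarrow> real"
  assumes "\<And>e. 0 < e \<Longrightarrow> eventually (\<lambda>n. \<bar>d n\<bar> \<le> c + e) sequentially"
  shows "(\<lambda>n. max 0 (\<bar>d n\<bar> - c)) \<longlonglongrightarrow> 0"
proof (rule tendstoI)
  fix e :: real assume e: "0 < e"
  have "eventually (\<lambda>n. \<bar>d n\<bar> \<le> c + e/2) sequentially" using assms e by simp
  then show "eventually (\<lambda>n. dist (max 0 (\<bar>d n\<bar> - c)) 0 < e) sequentially"
    by eventually_elim (use e in \<open>auto simp: dist_real_def\<close>)
qed

text \<open>The values of the perturbed economies are compared by index \<open>k\<close> of the price. No continuity of
  the limit value in the belief is needed: along any sequence of beliefs the asymptotic gap is at most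
  the discounted average of the asymptotic gaps at later times, hence at most \<open>modulus\<close> times its
  supremum. In the premise on the aggregators the vector of continuation values is the limiting one.\<close>

locale stability =
  fixes A :: "economy \<Rightarrow> real \<Rightarrow> real \<Rightarrow> real" and X :: "real set"
    and Es :: "nat \<Rightarrow> economy" and E :: economy
    and Gs :: "nat \<Rightarrow> real \<Rightarrow> real \<Rightarrow> (real \<Rightarrow> real) \<Rightarrow> real" and G :: "real \<Rightarrow> real \<Rightarrow> (real \<Rightarrow> real) \<Rightarrow> real"
    and fs :: "nat \<Rightarrow> real \<Rightarrow> real \<Rightarrow> real" and f :: "real \<Rightarrow> real \<Rightarrow> real"
    and xs :: "nat \<Rightarrow> 'k::finite \<Rightarrow> real" and x :: "'k \<Rightarrow> real" and B :: real
  assumes A: "demand A" and X: "X = {0<..<1} \<or> X = {1}"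
    and Es: "econ_tendsto Es E sequentially" and vEs: "\<And>n. valid_economy (Es n)" and E: "valid_economy E"
    and menus: "\<And>n. menu (Es n) = range (xs n)" "menu E = range x"
    and inj: "\<And>n. inj (xs n)" and xs: "\<And>k. (\<lambda>n. xs n k) \<longlonglongrightarrow> x k"
    and Gs: "\<And>n. aggregator (Es n) (Gs n)" and G: "aggregator E G"
    and fs: "\<And>n. is_value A (Gs n) (Es n) (fs n)" and f: "is_value A G E f"
    and fs_le: "\<And>n \<mu> p. \<mu> \<in> {0..1} \<Longrightarrow> p \<in> menu (Es n) \<Longrightarrow> \<bar>fs n \<mu> p\<bar> \<le> B"
    and f_le: "\<And>\<mu> p. \<mu> \<in> {0..1} \<Longrightarrow> p \<in> menu E \<Longrightarrow> \<bar>f \<mu> p\<bar> \<le> B"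
    and carry_meas: "\<And>n k \<mu> m. \<mu> \<in> X \<Longrightarrow> m \<in> X \<Longrightarrow>
      (\<lambda>t. Gs n (xs n k) (flow (Es n) (xs n k) t \<mu>) (\<lambda>p. f (flow E (x k) t m) (x (inv (xs n) p)))) \<in> borel_measurable borel"
    and weak: "\<And>ms m k. adm X ms m \<Longrightarrow>
      (\<lambda>n. LBINT t. wt E (x k) (hazard A E (x k)) m t *
         (Gs n (xs n k) (flow (Es n) (xs n k) t (ms n)) (\<lambda>p. f (flow E (x k) t m) (x (inv (xs n) p)))
          - G (x k) (flow E (x k) t m) (f (flow E (x k) t m)))) \<longlonglongrightarrow> 0"
begin

sublocale lim: valuation A G E by unfold_locales (rule A E G)+

sublocale seq: valuation A "Gs n" "Es n" for n by unfold_locales (rule A vEs Gs)+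

lemma X01: "y \<in> X \<Longrightarrow> y \<in> {0..1}" using X by auto

lemma B_nonneg: "0 \<le> B" using f_le[of 0 "x undefined"] menus by auto

text \<open>A bound along each sequence of beliefs, without a rate uniform over sequences. Moving
  beliefs are included because paths and jumps of the perturbed economies differ from those of the
  limit.\<close>

definition close :: "real \<Rightarrow> bool" where
  "close c \<longleftrightarrow> (\<forall>ms m k. adm X ms m \<longrightarrow>
     (\<forall>e>0. eventually (\<lambda>n. \<bar>fs n (ms n) (xs n k) - f m (x k)\<bar> \<le> c + e) sequentially))"

text \<open>At every time t the two paths again form an admissible sequence, so
  \<open>close c\<close> applies there. The difference of the integrands splits into changes of
  coefficients, a change of aggregator at limiting continuation values, and continuation gaps
  weighted by the limiting hazard. The last part integrates to at most \<open>modulus\<close> times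
  c plus a vanishing excess; the other parts vanish.\<close>

lemma close_step:
  assumes close: "close c" and c: "0 \<le> c"
  shows "close (lim.modulus * c)"
  unfolding close_def
proof (intro allI impI)
  fix ms m k and e :: real assume ms: "adm X ms m" and e: "0 < e"
  have ms01: "ms n \<in> {0..1}" "m \<in> {0..1}" for n using ms X01 by (auto simp: adm_def)
  define p where "p n = xs n k" for n
  define q where "q = x k"
  have pq: "p \<longlonglongrightarrow> q" using xs by (simp add: p_def[abs_def] q_def)
  have pm: "p n \<in> menu (Es n)" "q \<in> menu E" for n using menus by (auto simp: p_def q_def)
  define \<phi>n where "\<phi>n n t = flow (Es n) (p n) t (ms n)" for n t
  define \<phi> where "\<phi> t = flow E q t m" for t
  have adm\<phi>: "adm X (\<lambda>n. \<phi>n n t) (\<phi> t)" for t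
    unfolding \<phi>n_def \<phi>_def by (rule adm_flow[OF X Es vEs E pq ms])
  have \<phi>01: "\<phi>n n t \<in> {0..1}" "\<phi> t \<in> {0..1}" for n t using adm\<phi>[of t] X01 by (auto simp: adm_def)
  define wn where "wn n = wt (Es n) (p n) (hazard A (Es n) (p n)) (ms n)" for n
  define w where "w = wt E q (hazard A E q) m"
  define an where "an n t = arrival (Es n) * A (Es n) (\<phi>n n t) (p n)" for n t
  define a where "a t = arrival E * A E (\<phi> t) q" for t
  define gn where "gn n t = Gs n (p n) (\<phi>n n t) (fs n (\<phi>n n t))" for n t
  \<comment> \<open>The perturbed aggregator at limiting values: each perturbed price is matched
    with the limit price of the same index. This separates the change of aggregator from that of the
    values.\<close>
  define gm where "gm n t = Gs n (p n) (\<phi>n n t) (\<lambda>p'. f (\<phi> t) (x (inv (xs n) p')))" for n t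
  define g where "g t = G q (\<phi> t) (f (\<phi> t))" for t
  define jn where "jn n t = fs n (J0 (Es n) (\<phi>n n t) (p n)) (p n)" for n t
  define j where "j t = f (J0 E (\<phi> t) q) q" for t
  define \<kappa>n where "\<kappa>n n = reset (Es n)" for n
  define \<kappa> where "\<kappa> = reset E"
  note v = valid_economyD[OF E] and vn = valid_economyD[OF vEs]
  have bvn: "bounded_value (Es n) (fs n)" for n using fs by (simp add: is_value_def)
  have bv: "bounded_value E f" using f by (simp add: is_value_def)

  have fs_eq: "fs n (ms n) (p n) = (LBINT t. wn n t * (an n t * p n + \<kappa>n n * gn n t + an n t * jn n t))" for n
    using fs[of n] ms01(1)[of n] pm(1)[of n]
    by (simp add: is_value_def val_op_def path_value_wt reward_def wn_def an_def \<kappa>n_def gn_def jn_def \<phi>n_def mult_ac)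
  have f_eq: "f m q = (LBINT t. w t * (a t * q + \<kappa> * g t + a t * j t))"
    using f ms01(2) pm(2)
    by (simp add: is_value_def val_op_def path_value_wt reward_def w_def a_def \<kappa>_def g_def j_def \<phi>_def mult_ac)

  have J01: "J0 (Es n) (\<phi>n n t) (p n) \<in> {0..1}" "J0 E (\<phi> t) q \<in> {0..1}" for n t
    using J0_range[OF vEs] J0_range[OF E] \<phi>01 by auto
  have gn_le: "\<bar>gn n t\<bar> \<le> B" and gm_le: "\<bar>gm n t\<bar> \<le> B" and g_le: "\<bar>g t\<bar> \<le> B" and jn_le: "\<bar>jn n t\<bar> \<le> B" and j_le: "\<bar>j t\<bar> \<le> B" for n t
    unfolding gn_def gm_def g_def jn_def j_def
    using pm \<phi>01 J01 fs_le f_le menus by (auto intro!: seq.G_le lim.G_le)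
  have an_bd: "0 \<le> an n t" "an n t \<le> arrival (Es n)" and a_bd: "0 \<le> a t" "a t \<le> arrival E" for n t
    using demand_bounds[OF A vEs \<phi>01(1), of n n t "p n"] demand_bounds[OF A E \<phi>01(2), of t q] v(2) vn(2)[of n]
    by (auto simp: an_def a_def mult_left_le less_imp_le)

  have contA: "set_borel_measurable borel {0..1} (\<lambda>\<phi>. A E' \<phi> p')" if "valid_economy E'" for E' p'
    by (rule set_borel_measurable_continuous[OF continuous_on_demand[OF A that]])
  have meas_an: "an n \<in> borel_measurable borel" and meas_a: "a \<in> borel_measurable borel" for n
    unfolding an_def[abs_def] a_def[abs_def] \<phi>n_def \<phi>_def
    using flow_comp_measurable[OF vEs contA[OF vEs] ms01(1)] flow_comp_measurable[OF E contA[OF E] ms01(2)] by simp_all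
  have meas_gn: "gn n \<in> borel_measurable borel" for n
    unfolding gn_def[abs_def] \<phi>n_def
    by (rule flow_comp_measurable[OF vEs _ ms01(1)])
       (use Gs[of n] bvn[of n] pm(1)[of n] in \<open>auto simp: aggregator_def bounded_value_def\<close>)
  have meas_g: "g \<in> borel_measurable borel"
    unfolding g_def[abs_def] \<phi>_def
    by (rule flow_comp_measurable[OF E _ ms01(2)])
       (use G bv pm(2) in \<open>auto simp: aggregator_def bounded_value_def\<close>)
  have meas_gm: "gm n \<in> borel_measurable borel" for n
    unfolding gm_def[abs_def] \<phi>n_def \<phi>_def p_def q_def by (rule carry_meas) (use ms in \<open>auto simp: adm_def\<close>)
  have meas_jn: "jn n \<in> borel_measurable borel" for n
    unfolding jn_def[abs_def] \<phi>n_def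
    by (rule flow_comp_measurable[OF vEs set_borel_measurable_compose[OF _ continuous_on_J0[OF vEs] J0_range[OF vEs]] ms01(1)])
       (use bvn[of n] pm(1)[of n] in \<open>auto simp: bounded_value_def\<close>)
  have meas_j: "j \<in> borel_measurable borel"
    unfolding j_def[abs_def] \<phi>_def
    by (rule flow_comp_measurable[OF E set_borel_measurable_compose[OF _ continuous_on_J0[OF E] J0_range[OF E]] ms01(2)])
       (use bv pm(2) in \<open>auto simp: bounded_value_def\<close>)
  have meas_fs: "(\<lambda>t. fs n (\<phi>n n t) (xs n k')) \<in> borel_measurable borel" for n k'
    unfolding \<phi>n_def by (rule flow_comp_measurable[OF vEs _ ms01(1)]) (use bvn[of n] menus in \<open>auto simp: bounded_value_def\<close>)
  have meas_f: "(\<lambda>t. f (\<phi> t) (x k')) \<in> borel_measurable borel" for k'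
    unfolding \<phi>_def by (rule flow_comp_measurable[OF E _ ms01(2)]) (use bv menus in \<open>auto simp: bounded_value_def\<close>)
  have meas_wn: "wn n \<in> borel_measurable borel" and meas_w: "w \<in> borel_measurable borel" for n
    unfolding wn_def w_def
    using silence_path.wt_measurable[OF path_hazard[OF A vEs] ms01(1)] silence_path.wt_measurable[OF path_hazard[OF A E] ms01(2)]
    by auto

  \<comment> \<open>By how much the gaps at time t, after a reset or a purchase, still exceed c. The
    sum over k' stands in for a maximum over prices.\<close>
  define ex where "ex n t = (\<Sum>k'\<in>UNIV. max 0 (\<bar>fs n (\<phi>n n t) (xs n k') - f (\<phi> t) (x k')\<bar> - c)) + max 0 (\<bar>jn n t - j t\<bar> - c)" for n t
  have meas_ex: "ex n \<in> borel_measurable borel" for n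
    unfolding ex_def[abs_def]
    by (intro borel_measurable_add borel_measurable_sum borel_measurable_max borel_measurable_const borel_measurable_diff
        borel_measurable_abs meas_fs meas_f meas_jn meas_j)
  have term_le: "max 0 (\<bar>fs n (\<phi>n n t) (xs n k') - f (\<phi> t) (x k')\<bar> - c) \<le> 2 * B" for n t k'
    using fs_le[OF \<phi>01(1), of "xs n k'" n n t] f_le[OF \<phi>01(2), of "x k'" t] menus c B_nonneg by auto
  have ex_le: "0 \<le> ex n t" "ex n t \<le> (real CARD('k) + 1) * (2 * B)" for n t
  proof -
    show "0 \<le> ex n t" unfolding ex_def by (intro add_nonneg_nonneg sum_nonneg) auto
    have "(\<Sum>k'\<in>(UNIV :: 'k set). max 0 (\<bar>fs n (\<phi>n n t) (xs n k') - f (\<phi> t) (x k')\<bar> - c)) \<le> (\<Sum>k'\<in>(UNIV :: 'k set). 2 * B)"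
      by (intro sum_mono term_le)
    moreover have "max 0 (\<bar>jn n t - j t\<bar> - c) \<le> 2 * B" using jn_le[of n t] j_le[of t] c B_nonneg by auto
    ultimately show "ex n t \<le> (real CARD('k) + 1) * (2 * B)"
      unfolding ex_def distrib_right by (intro add_mono) simp_all
  qed
  have jdiff: "\<bar>jn n t - j t\<bar> \<le> c + ex n t" for n t
  proof -
    have "0 \<le> (\<Sum>k'\<in>(UNIV :: 'k set). max 0 (\<bar>fs n (\<phi>n n t) (xs n k') - f (\<phi> t) (x k')\<bar> - c))" by (intro sum_nonneg) auto
    then show ?thesis unfolding ex_def by linarith
  qed
  have fdiff: "\<bar>fs n (\<phi>n n t) (xs n k') - f (\<phi> t) (x k')\<bar> \<le> c + ex n t" for n t k'
  proof -
    have "max 0 (\<bar>fs n (\<phi>n n t) (xs n k') - f (\<phi> t) (x k')\<bar> - c) \<le>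
        (\<Sum>k'\<in>(UNIV :: 'k set). max 0 (\<bar>fs n (\<phi>n n t) (xs n k') - f (\<phi> t) (x k')\<bar> - c))"
      by (rule member_le_sum) auto
    then show ?thesis unfolding ex_def by linarith
  qed
  have gdiff: "\<bar>gn n t - gm n t\<bar> \<le> c + ex n t" for n t
    unfolding gn_def gm_def
  proof (rule seq.G_nonexp[OF pm(1) \<phi>01(1)])
    fix p' assume "p' \<in> menu (Es n)"
    then obtain k' where "p' = xs n k'" using menus by auto
    then show "\<bar>fs n (\<phi>n n t) p' - f (\<phi> t) (x (inv (xs n) p'))\<bar> \<le> c + ex n t"
      using fdiff inv_f_f[OF inj] by simp
  qed
  have ex_lim: "(\<lambda>n. ex n t) \<longlonglongrightarrow> 0" for t
  proof -
    have "(\<lambda>n. ex n t) \<longlonglongrightarrow> (\<Sum>k'\<in>(UNIV :: 'k set). 0) + 0"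
      unfolding ex_def
    proof (intro tendsto_add tendsto_sum tendsto_excess)
      fix k' and e :: real assume "0 < e"
      then show "eventually (\<lambda>n. \<bar>fs n (\<phi>n n t) (xs n k') - f (\<phi> t) (x k')\<bar> \<le> c + e) sequentially"
        using close adm\<phi>[of t] unfolding close_def by blast
    next
      fix e :: real assume "0 < e"
      then show "eventually (\<lambda>n. \<bar>jn n t - j t\<bar> \<le> c + e) sequentially"
        using close adm_J0[OF X Es vEs E pq adm\<phi>[of t]] unfolding close_def jn_def j_def p_def q_def by blast
    qed
    then show ?thesis by simp
  qed

  \<comment> \<open>Bounds on the primitives that hold for all n and for the limit prepare the
    dominating function C exp (- \<rho> t).\<close>
  obtain \<rho> where \<rho>: "0 < \<rho>" "\<rho> \<le> disc E" "\<And>n. \<rho> \<le> disc (Es n)"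
    using positive_convergent_lower[OF econ_tendstoD(1)[OF Es] v(1) vn(1)] by blast
  obtain N1 where N1: "0 < N1" "\<bar>arrival E\<bar> \<le> N1" "\<And>n. \<bar>arrival (Es n)\<bar> \<le> N1"
    using convergent_upper[OF econ_tendstoD(2)[OF Es]] by blast
  obtain N2 where N2: "0 < N2" "\<bar>\<kappa>\<bar> \<le> N2" "\<And>n. \<bar>\<kappa>n n\<bar> \<le> N2"
    using convergent_upper[OF econ_tendstoD(3)[OF Es]] unfolding \<kappa>_def \<kappa>n_def by blast
  obtain N3 where N3: "0 < N3" "\<bar>q\<bar> \<le> N3" "\<And>n. \<bar>p n\<bar> \<le> N3"
    using convergent_upper[OF pq] by blast
  define d where "d t = indicator {0..} t * exp (- \<rho> * t)" for t :: real
  have d0: "0 \<le> d t" for t by (simp add: d_def)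
  have wn_bd: "0 \<le> wn n t" "wn n t \<le> d t" and w_bd: "0 \<le> w t" "w t \<le> d t" for n t
    unfolding wn_def w_def d_def
    using silence_path.wt_bounds[OF path_hazard[OF A vEs] ms01(1) \<rho>(3)] silence_path.wt_bounds[OF path_hazard[OF A E] ms01(2) \<rho>(2)]
    by auto
  have an_le: "\<bar>an n t\<bar> \<le> N1" "\<bar>a t\<bar> \<le> N1" for n t using an_bd[of n t] a_bd[of t] N1(2) N1(3)[of n] by auto

  \<comment> \<open>Collects what vanishes pointwise as n grows: three changes of coefficients and
    the excess over c.\<close>
  define Q where "Q n t = \<bar>wn n t * an n t * p n - w t * a t * q\<bar> + \<bar>wn n t * \<kappa>n n - w t * \<kappa>\<bar> * B
      + \<bar>wn n t * an n t - w t * a t\<bar> * B + w t * (\<kappa> + a t) * ex n t" for n t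
  have Q0: "0 \<le> Q n t" for n t
    unfolding Q_def using w_bd(1) a_bd(1) ex_le(1) B_nonneg v(3) by (auto simp: \<kappa>_def)
  define C where "C = 2 * N1 * N3 + 2 * N2 * B + 2 * N1 * B + (N2 + N1) * ((real CARD('k) + 1) * (2 * B))"
  have Q_le: "Q n t \<le> indicator {0..} t * (C * exp (- \<rho> * t))" for n t
  proof -
    have b2: "\<bar>y * z\<bar> \<le> d t * N" if "0 \<le> y" "y \<le> d t" "\<bar>z\<bar> \<le> N" for y z N
      using that d0[of t] by (auto simp: abs_mult intro!: mult_mono)
    have "\<bar>an n t * p n\<bar> \<le> N1 * N3" "\<bar>a t * q\<bar> \<le> N1 * N3"
      using an_le(1)[of n t] an_le(2)[of t] N3 N1(1) by (auto simp: abs_mult intro!: mult_mono)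
    then have "\<bar>wn n t * (an n t * p n)\<bar> \<le> d t * (N1 * N3)" "\<bar>w t * (a t * q)\<bar> \<le> d t * (N1 * N3)"
      using b2 wn_bd w_bd by auto
    then have 1: "\<bar>wn n t * an n t * p n - w t * a t * q\<bar> \<le> d t * (2 * N1 * N3)" by (simp add: mult_ac)
    have "\<bar>wn n t * \<kappa>n n - w t * \<kappa>\<bar> \<le> d t * (2 * N2)"
      using b2[OF wn_bd N2(3), of n n] b2[OF w_bd N2(2)] by simp
    then have 2: "\<bar>wn n t * \<kappa>n n - w t * \<kappa>\<bar> * B \<le> d t * (2 * N2 * B)"
      using B_nonneg mult_right_mono by (fastforce simp: mult_ac)
    have "\<bar>wn n t * an n t - w t * a t\<bar> \<le> d t * (2 * N1)"
      using b2[OF wn_bd an_le(1)[of n t], of n] b2[OF w_bd an_le(2)[of t]] by simp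
    then have 3: "\<bar>wn n t * an n t - w t * a t\<bar> * B \<le> d t * (2 * N1 * B)"
      using B_nonneg mult_right_mono by (fastforce simp: mult_ac)
    have "(\<kappa> + a t) * ex n t \<le> (N2 + N1) * ((real CARD('k) + 1) * (2 * B))"
      using an_le(2)[of t] N2(2) ex_le[of n t] N1(1) N2(1) by (intro mult_mono) auto
    from mult_mono[OF w_bd(2)[of t] this d0[of t]]
    have 4: "w t * (\<kappa> + a t) * ex n t \<le> d t * ((N2 + N1) * ((real CARD('k) + 1) * (2 * B)))"
      using a_bd(1)[of t] ex_le(1)[of n t] v(3) by (simp only: mult.assoc) (simp add: \<kappa>_def)
    have "Q n t \<le> d t * C" using 1 2 3 4 unfolding Q_def C_def distrib_left by linarith
    then show ?thesis by (simp add: d_def mult_ac)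
  qed
  have meas_Q: "Q n \<in> borel_measurable borel" for n
    unfolding Q_def[abs_def]
    by (intro borel_measurable_add borel_measurable_times borel_measurable_abs borel_measurable_diff borel_measurable_const
        meas_wn meas_w meas_an meas_a meas_ex)
  have Q_int: "integrable lborel (Q n)" for n
  proof (rule Bochner_Integration.integrable_bound[OF integrable_exp_decay[OF \<rho>(1), of C]])
    show "Q n \<in> borel_measurable lborel" using meas_Q by simp
    show "AE t in lborel. norm (Q n t) \<le> norm (indicator {0..} t * (C * exp (- \<rho> * t)))"
      by (intro AE_I2) (use Q0 Q_le order_trans[OF Q_le abs_ge_self] in simp)
  qed
  have Q_lim: "(\<lambda>n. LBINT t. Q n t) \<longlonglongrightarrow> (LBINT t::real. 0)"
  proof (rule integral_dominated_convergence[where w = "\<lambda>t. indicator {0..} t * (C * exp (- \<rho> * t))"])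
    show "AE t in lborel. (\<lambda>n. Q n t) \<longlonglongrightarrow> 0"
    proof (intro AE_I2)
      fix t
      have wl: "(\<lambda>n. wn n t) \<longlonglongrightarrow> w t" unfolding wn_def w_def by (rule tendsto_wt[OF A X Es vEs E pq ms])
      have al: "(\<lambda>n. an n t) \<longlonglongrightarrow> a t"
        unfolding an_def a_def using adm\<phi>[of t] X01
        by (intro tendsto_intros econ_tendstoD[OF Es] tendsto_demand[OF A Es E _ _ pq]) (auto simp: adm_def)
      have "(\<lambda>n. Q n t) \<longlonglongrightarrow> \<bar>w t * a t * q - w t * a t * q\<bar> + \<bar>w t * \<kappa> - w t * \<kappa>\<bar> * B + \<bar>w t * a t - w t * a t\<bar> * B
          + w t * (\<kappa> + a t) * 0"
        unfolding Q_def \<kappa>n_def \<kappa>_def by (intro tendsto_intros wl al pq ex_lim econ_tendstoD[OF Es])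
      then show "(\<lambda>n. Q n t) \<longlonglongrightarrow> 0" by simp
    qed
    show "AE t in lborel. norm (Q n t) \<le> indicator {0..} t * (C * exp (- \<rho> * t))" for n
      using Q0 Q_le by simp
  qed (use meas_Q integrable_exp_decay[OF \<rho>(1)] in auto)

  have int_w: "integrable lborel (\<lambda>t. w t * z t)" if "z \<in> borel_measurable borel" "\<And>t. \<bar>z t\<bar> \<le> K" for z K
    unfolding w_def by (rule silence_path.wt_integrable[OF path_hazard[OF A E] ms01(2) that])
  have int_wn: "integrable lborel (\<lambda>t. wn n t * z t)" if "z \<in> borel_measurable borel" "\<And>t. \<bar>z t\<bar> \<le> K" for z K n
    unfolding wn_def by (rule silence_path.wt_integrable[OF path_hazard[OF A vEs] ms01(1) that])
  \<comment> \<open>The contraction factor enters here, as a bound on the path value of the hazard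
    alone.\<close>
  have haz_total: "(LBINT t. w t * (\<kappa> + a t)) \<le> lim.modulus"
  proof -
    have "\<bar>path_value E q (hazard A E q) (hazard A E q) m\<bar> \<le> lim.modulus"
    proof (rule silence_path.path_value_abs_le[OF path_hazard[OF A E] _ ms01(2)])
      show "set_borel_measurable borel {0..1} (hazard A E q)"
        by (rule set_borel_measurable_continuous[OF silence_path.h_cont[OF path_hazard[OF A E]]])
      fix y :: real assume y: "y \<in> {0..1}"
      note h = silence_path.h_range[OF path_hazard[OF A E] y, of q]
      have "hazard A E q y * disc E \<le> (reset E + arrival E) * disc E" using h v(1) by (intro mult_right_mono) auto
      then show "\<bar>hazard A E q y\<bar> \<le> lim.modulus * (disc E + hazard A E q y)"
        using h v(1,2,3) by (simp add: lim.modulus_def field_simps add_pos_pos)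
    qed
    then show ?thesis by (simp add: path_value_wt w_def hazard_def \<kappa>_def a_def \<phi>_def)
  qed
  define Z where "Z n = (LBINT t. w t * (gm n t - g t))" for n
  have Z_lim: "Z \<longlonglongrightarrow> 0"
    unfolding Z_def[abs_def] w_def gm_def g_def \<phi>n_def \<phi>_def p_def q_def by (rule weak[OF ms])

  have main: "\<bar>fs n (ms n) (p n) - f m q\<bar> \<le> (LBINT t. Q n t) + lim.modulus * c + \<kappa> * \<bar>Z n\<bar>" for n
  proof -
    have i1: "integrable lborel (\<lambda>t. wn n t * (an n t * p n + \<kappa>n n * gn n t + an n t * jn n t))"
    proof (rule int_wn[of _ "N1 * N3 + N2 * B + N1 * B"])
      show "(\<lambda>t. an n t * p n + \<kappa>n n * gn n t + an n t * jn n t) \<in> borel_measurable borel"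
        by (intro borel_measurable_add borel_measurable_times borel_measurable_const meas_an meas_gn meas_jn)
      fix t
      have "\<bar>an n t * p n\<bar> \<le> N1 * N3" "\<bar>\<kappa>n n * gn n t\<bar> \<le> N2 * B" "\<bar>an n t * jn n t\<bar> \<le> N1 * B"
        using an_le(1)[of n t] N1(1) N2(1,3) N3(3) gn_le jn_le by (auto simp: abs_mult intro!: mult_mono)
      then show "\<bar>an n t * p n + \<kappa>n n * gn n t + an n t * jn n t\<bar> \<le> N1 * N3 + N2 * B + N1 * B" by linarith
    qed
    have i2: "integrable lborel (\<lambda>t. w t * (a t * q + \<kappa> * g t + a t * j t))"
    proof (rule int_w[of _ "N1 * N3 + N2 * B + N1 * B"])
      show "(\<lambda>t. a t * q + \<kappa> * g t + a t * j t) \<in> borel_measurable borel"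
        by (intro borel_measurable_add borel_measurable_times borel_measurable_const meas_a meas_g meas_j)
      fix t
      have "\<bar>a t * q\<bar> \<le> N1 * N3" "\<bar>\<kappa> * g t\<bar> \<le> N2 * B" "\<bar>a t * j t\<bar> \<le> N1 * B"
        using an_le(2)[of t] N1(1) N2(1,2) N3(2) g_le j_le by (auto simp: abs_mult intro!: mult_mono)
      then show "\<bar>a t * q + \<kappa> * g t + a t * j t\<bar> \<le> N1 * N3 + N2 * B + N1 * B" by linarith
    qed
    have i3: "integrable lborel (\<lambda>t. w t * (gm n t - g t))"
    proof (rule int_w[of _ "2 * B"])
      show "(\<lambda>t. gm n t - g t) \<in> borel_measurable borel" by (intro borel_measurable_diff meas_gm meas_g)
      show "\<bar>gm n t - g t\<bar> \<le> 2 * B" for t using gm_le[of n t] g_le[of t] by linarith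
    qed
    have i4: "integrable lborel (\<lambda>t. w t * (\<kappa> + a t))"
    proof (rule int_w[of _ "N2 + N1"])
      show "(\<lambda>t. \<kappa> + a t) \<in> borel_measurable borel" by (intro borel_measurable_add borel_measurable_const meas_a)
      show "\<bar>\<kappa> + a t\<bar> \<le> N2 + N1" for t using an_le(2)[of t] N2(2) by linarith
    qed
    \<comment> \<open>The aggregator term is subtracted beforehand: it tends to 0 only after
      integration and cannot be bounded inside the absolute value.\<close>
    define R where "R t = wn n t * (an n t * p n + \<kappa>n n * gn n t + an n t * jn n t) - w t * (a t * q + \<kappa> * g t + a t * j t)
        - \<kappa> * (w t * (gm n t - g t))" for t
    have R_int: "integrable lborel R" unfolding R_def[abs_def] using i1 i2 i3 by simp
    have R_eq: "(LBINT t. R t) = fs n (ms n) (p n) - f m q - \<kappa> * Z n"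
      unfolding R_def fs_eq f_eq Z_def using i1 i2 i3 by simp
    have R_le: "\<bar>R t\<bar> \<le> Q n t + c * (w t * (\<kappa> + a t))" for t
    proof -
      have "R t = (wn n t * an n t * p n - w t * a t * q) + (wn n t * \<kappa>n n - w t * \<kappa>) * gn n t
          + w t * \<kappa> * (gn n t - gm n t) + (wn n t * an n t - w t * a t) * jn n t + w t * a t * (jn n t - j t)"
        unfolding R_def by (simp add: algebra_simps)
      moreover have "\<bar>(wn n t * \<kappa>n n - w t * \<kappa>) * gn n t\<bar> \<le> \<bar>wn n t * \<kappa>n n - w t * \<kappa>\<bar> * B"
        unfolding abs_mult using gn_le by (intro mult_left_mono) auto
      moreover have "\<bar>(wn n t * an n t - w t * a t) * jn n t\<bar> \<le> \<bar>wn n t * an n t - w t * a t\<bar> * B"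
        unfolding abs_mult using jn_le by (intro mult_left_mono) auto
      moreover have "\<bar>w t * \<kappa> * (gn n t - gm n t)\<bar> \<le> w t * \<kappa> * (c + ex n t)"
        using gdiff[of n t] w_bd(1)[of t] v(3) by (simp add: abs_mult \<kappa>_def mult_left_mono)
      moreover have "\<bar>w t * a t * (jn n t - j t)\<bar> \<le> w t * a t * (c + ex n t)"
        using jdiff[of n t] w_bd(1)[of t] a_bd(1)[of t] by (simp add: abs_mult mult_left_mono)
      moreover have "w t * \<kappa> * (c + ex n t) + w t * a t * (c + ex n t) = w t * (\<kappa> + a t) * ex n t + c * (w t * (\<kappa> + a t))"
        by (simp add: algebra_simps)
      ultimately show ?thesis unfolding Q_def by linarith
    qed
    have "\<bar>LBINT t. R t\<bar> \<le> (LBINT t. \<bar>R t\<bar>)" by (rule integral_abs_bound)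
    also have "\<dots> \<le> (LBINT t. Q n t + c * (w t * (\<kappa> + a t)))"
      by (rule integral_mono[OF integrable_abs[OF R_int] Bochner_Integration.integrable_add[OF Q_int integrable_mult_right[OF i4]] R_le])
    also have "\<dots> = (LBINT t. Q n t) + c * (LBINT t. w t * (\<kappa> + a t))"
      by (simp only: Bochner_Integration.integral_add[OF Q_int integrable_mult_right[OF i4]] integral_mult_right_zero)
    also have "\<dots> \<le> (LBINT t. Q n t) + lim.modulus * c"
      using mult_left_mono[OF haz_total c] by (simp add: mult.commute)
    finally have "\<bar>fs n (ms n) (p n) - f m q - \<kappa> * Z n\<bar> \<le> (LBINT t. Q n t) + lim.modulus * c" by (simp add: R_eq)
    moreover have "\<bar>\<kappa> * Z n\<bar> = \<kappa> * \<bar>Z n\<bar>" using v(3) by (simp add: abs_mult \<kappa>_def)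
    ultimately show ?thesis by linarith
  qed
  have "(\<lambda>n. (LBINT t. Q n t) + \<kappa> * \<bar>Z n\<bar>) \<longlonglongrightarrow> 0 + \<kappa> * \<bar>0\<bar>"
    using Q_lim by (intro tendsto_intros Z_lim) simp
  then have "eventually (\<lambda>n. (LBINT t. Q n t) + \<kappa> * \<bar>Z n\<bar> < e) sequentially"
    using order_tendstoD(2)[of "\<lambda>n. (LBINT t. Q n t) + \<kappa> * \<bar>Z n\<bar>" 0 sequentially e] e by simp
  then show "eventually (\<lambda>n. \<bar>fs n (ms n) (xs n k) - f m (x k)\<bar> \<le> lim.modulus * c + e) sequentially"
  proof (rule eventually_mono)
    fix n assume "(LBINT t. Q n t) + \<kappa> * \<bar>Z n\<bar> < e"
    with main[of n] show "\<bar>fs n (ms n) (xs n k) - f m (x k)\<bar> \<le> lim.modulus * c + e"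
      unfolding p_def q_def by linarith
  qed
qed

text \<open>The trivial bound 2 B improves by the factor \<open>modulus\<close> at every application
  of \<open>close_step\<close>.\<close>

lemma values_tendsto:
  assumes ms: "adm X ms m"
  shows "(\<lambda>n. fs n (ms n) (xs n k)) \<longlonglongrightarrow> f m (x k)"
proof -
  have "close (lim.modulus ^ i * (2 * B))" for i
  proof (induction i)
    case 0
    have "\<bar>fs n (ms n) (xs n k) - f m (x k)\<bar> \<le> 2 * B" if "adm X ms m" for ms m k n
    proof -
      have "ms n \<in> {0..1}" "m \<in> {0..1}" using that X01 by (auto simp: adm_def)
      then show ?thesis using fs_le[of "ms n" "xs n k" n] f_le[of m "x k"] menus by auto
    qed
    then show ?case unfolding close_def by (auto intro!: always_eventually add_increasing2)
  next
    case (Suc i)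
    have "0 \<le> lim.modulus ^ i * (2 * B)" using lim.modulus B_nonneg by simp
    from close_step[OF Suc this] show ?case by (simp add: mult.assoc)
  qed
  note close = this
  have lim0: "(\<lambda>i. lim.modulus ^ i * (2 * B)) \<longlonglongrightarrow> 0 * (2 * B)"
    using lim.modulus by (intro tendsto_mult LIMSEQ_power_zero tendsto_const) auto
  show ?thesis
  proof (rule tendstoI)
    fix e :: real assume e: "0 < e"
    have "eventually (\<lambda>i. lim.modulus ^ i * (2 * B) < e/2) sequentially"
      using order_tendstoD(2)[OF lim0, of "e/2"] e by simp
    then obtain i where i: "lim.modulus ^ i * (2 * B) < e/2" by (auto dest: eventually_happens)
    have "eventually (\<lambda>n. \<bar>fs n (ms n) (xs n k) - f m (x k)\<bar> \<le> lim.modulus ^ i * (2 * B) + e/2) sequentially"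
      using close[of i] ms e unfolding close_def by simp
    then show "eventually (\<lambda>n. dist (fs n (ms n) (xs n k)) (f m (x k)) < e) sequentially"
      by (rule eventually_mono) (use i in \<open>auto simp: dist_real_def\<close>)
  qed
qed

end


section \<open>Continuity of the gross value and compactness of the desk selectors\<close>

locale econ_seq =
  fixes Es :: "nat \<Rightarrow> economy" and E :: economy and xs :: "nat \<Rightarrow> 'k::finite \<Rightarrow> real" and x :: "'k \<Rightarrow> real"
  assumes Es: "econ_tendsto Es E sequentially" and vEs: "\<And>n. valid_economy (Es n)" and E: "valid_economy E"
    and menus: "\<And>n. menu (Es n) = range (xs n)" "menu E = range x"
    and inj: "\<And>n. inj (xs n)" "inj x" and xs: "\<And>k. (\<lambda>n. xs n k) \<longlonglongrightarrow> x k"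
begin

lemma value_bound_bounded: "\<exists>B. value_bound E \<le> B \<and> (\<forall>n. value_bound (Es n) \<le> B)"
proof -
  obtain \<rho> where \<rho>: "0 < \<rho>" "\<rho> \<le> disc E" "\<And>n. \<rho> \<le> disc (Es n)"
    using positive_convergent_lower[OF econ_tendstoD(1)[OF Es] valid_economyD(1)[OF E] valid_economyD(1)[OF vEs]] by blast
  obtain N where N: "0 < N" "\<bar>arrival E\<bar> \<le> N" "\<And>n. \<bar>arrival (Es n)\<bar> \<le> N"
    using convergent_upper[OF econ_tendstoD(2)[OF Es]] by blast
  have "\<forall>k. \<exists>K>0. \<bar>x k\<bar> \<le> K \<and> (\<forall>n. \<bar>xs n k\<bar> \<le> K)"
    using convergent_upper[OF xs] by blast
  from choice[OF this] obtain K where K: "\<And>k. 0 < K k \<and> \<bar>x k\<bar> \<le> K k \<and> (\<forall>n. \<bar>xs n k\<bar> \<le> K k)" by blast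
  define M where "M = (\<Sum>k\<in>UNIV. K k)"
  have KM: "K k \<le> M" for k unfolding M_def using K by (intro member_le_sum) (auto simp: less_imp_le)
  have "value_bound E' \<le> N * M / \<rho>"
    if v: "valid_economy E'" and "\<rho> \<le> disc E'" "\<bar>arrival E'\<bar> \<le> N" and m: "menu E' = range y" and y: "\<And>k. \<bar>y k\<bar> \<le> K k" for E' and y :: "'k \<Rightarrow> real"
  proof -
    define mx where "mx = Max (menu E')"
    have "mx \<in> menu E'" unfolding mx_def by (rule Max_in[OF valid_economyD(9,10)[OF v]])
    then obtain k where k: "mx = y k" using m by auto
    have "0 < y k" using valid_economyD(11)[OF v, of "y k"] m by auto
    moreover have "y k \<le> M" using y[of k] KM[of k] by linarith
    ultimately show ?thesis
      unfolding value_bound_def mx_def[symmetric] k using that(2,3) valid_economyD(1,2)[OF v] \<rho>(1) N(1)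
      by (intro frac_le mult_mono) auto
  qed
  from this[OF E \<rho>(2) N(2) menus(2)] this[OF vEs \<rho>(3) N(3) menus(1)] K show ?thesis by blast
qed

text \<open>Indexed by k, the maximum over the menu is the same function of the continuation values
  in every economy, so the change of aggregator is identically 0.\<close>

lemma gross_value_tendsto:
  assumes X: "X = {0<..<1} \<or> X = {1}" and ms: "adm X ms m"
  shows "(\<lambda>n. gross_value (Es n) (ms n) (xs n k)) \<longlonglongrightarrow> gross_value E m (x k)"
proof -
  obtain B where B: "value_bound E \<le> B" "\<And>n. value_bound (Es n) \<le> B" using value_bound_bounded by blast
  have b: "\<bar>gross_value (Es n) \<mu> p\<bar> \<le> B" if "\<mu> \<in> {0..1}" "p \<in> menu (Es n)" for n \<mu> p
    by (rule order_trans[OF gross_value(2)[OF vEs that] B(2)])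
  have b': "\<bar>gross_value E \<mu> p\<bar> \<le> B" if "\<mu> \<in> {0..1}" "p \<in> menu E" for \<mu> p
    by (rule order_trans[OF gross_value(2)[OF E that] B(1)])
  have carry: "max_agg (Es n) p \<phi> (\<lambda>p. v (x (inv (xs n) p))) = Max (range (\<lambda>k. v (x k)))" for n p \<phi> and v :: "real \<Rightarrow> real"
    by (simp add: max_agg_def menus image_image inv_f_f[OF inj(1)])
  have lim: "max_agg E p \<phi> v = Max (range (\<lambda>k. v (x k)))" for p \<phi> and v :: "real \<Rightarrow> real"
    by (simp add: max_agg_def menus image_image)
  interpret stability A_bar X Es E "\<lambda>n. max_agg (Es n)" "max_agg E" "\<lambda>n. gross_value (Es n)" "gross_value E" xs x B
  proof (unfold_locales, goal_cases)
    \<comment> \<open>Case 16 is the premise \<open>carry_meas\<close> of the locale, case 17 the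
      premise \<open>weak\<close>.\<close>
    case (16 n k \<mu> m)
    then have m: "m \<in> {0..1}" using X by auto
    have "(\<lambda>t. Max (range (\<lambda>k'. gross_value E (flow E (x k) t m) (x k')))) \<in> borel_measurable borel"
      using gross_value(1)[OF E] menus
      by (intro borel_measurable_Max flow_comp_measurable[OF E _ m]) (auto simp: is_value_def bounded_value_def)
    then show ?case by (simp only: carry)
  next
    case (17 ms m k)
    then show ?case by (simp only: carry lim) simp
  qed (use X Es vEs E menus inj xs aggregator_max gross_value(1) b b' in \<open>auto simp: demand_def\<close>)
  show ?thesis by (rule values_tendsto[OF ms])
qed

end

section \<open>Measurability of optimal prices and the uniform selector\<close>

lemma finite_weights_pmf:
  fixes x :: "'k::finite \<Rightarrow> real"
  assumes x: "inj x" and w: "\<And>k. 0 \<le> w k" "(\<Sum>k\<in>UNIV. w k) = 1"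
  shows "\<exists>M. (\<forall>k. pmf M (x k) = w k) \<and> set_pmf M \<subseteq> x ` {k. w k \<noteq> 0}"
proof -
  have s: "(\<integral>\<^sup>+k. ennreal (w k) \<partial>count_space UNIV) = 1"
    using w by (simp add: nn_integral_count_space_finite sum_ennreal)
  define M where "M = embed_pmf w"
  have M: "pmf M k = w k" for k unfolding M_def by (rule pmf_embed_pmf[OF w(1) s])
  show ?thesis
  proof (intro exI[of _ "map_pmf x M"] conjI allI)
    show "pmf (map_pmf x M) (x k) = w k" for k by (simp add: pmf_map_inj'[OF x] M)
    show "set_pmf (map_pmf x M) \<subseteq> x ` {k. w k \<noteq> 0}" by (auto simp: set_pmf_iff M)
  qed
qed

lemma argmax_nonempty:
  fixes f :: "real \<Rightarrow> real"
  assumes "finite S" "S \<noteq> {}"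
  shows "argmax_on f S \<noteq> {}" "finite (argmax_on f S)"
proof -
  obtain y where y: "y \<in> S" "f y = Max (f ` S)"
    using Max_in[of "f ` S"] assms by (metis (no_types, lifting) finite_imageI image_iff image_is_empty)
  then have "y \<in> argmax_on f S" using assms by (auto simp: is_arg_max_on_iff)
  then show "argmax_on f S \<noteq> {}" by blast
  show "finite (argmax_on f S)"
    by (rule finite_subset[OF _ assms(1)]) (auto simp: is_arg_max_on_iff)
qed

lemma argmax_measurable:
  assumes E: "valid_economy E" and p: "p \<in> menu E"
  shows "{\<mu> \<in> {0..1}. p \<in> argmax_on (gross_value E \<mu>) (menu E)} \<in> sets borel"
proof -
  define V where "V p \<mu> = indicator {0..1} \<mu> *\<^sub>R gross_value E \<mu> p" for p \<mu>
  have [measurable]: "V p \<in> borel_measurable borel" if "p \<in> menu E" for p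
    using gross_value(1)[OF E] that by (auto simp: is_value_def bounded_value_def set_borel_measurable_def V_def[abs_def])
  have "{\<mu> \<in> {0..1}. p \<in> argmax_on (gross_value E \<mu>) (menu E)} = {0..1} \<inter> (\<Inter>y\<in>menu E. {\<mu> \<in> space borel. V y \<mu> \<le> V p \<mu>})"
    using p by (auto simp: is_arg_max_on_iff V_def)
  also have "\<dots> \<in> sets borel"
    using valid_economyD(9,10)[OF E] p by (intro sets.Int sets.finite_INT) auto
  finally show ?thesis .
qed

lemma uniform_argmax_measurable:
  assumes E: "valid_economy E" and p: "p \<in> menu E"
  shows "set_borel_measurable borel {0..1} (\<lambda>\<mu>. pmf (pmf_of_set (argmax_on (gross_value E \<mu>) (menu E))) p)"
proof -
  define S where "S \<mu> = argmax_on (gross_value E \<mu>) (menu E)" for \<mu>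
  have S: "S \<mu> \<subseteq> menu E" "finite (S \<mu>)" "S \<mu> \<noteq> {}" for \<mu>
    unfolding S_def using argmax_nonempty[OF valid_economyD(9,10)[OF E]] by (auto simp: is_arg_max_on_iff)
  \<comment> \<open>As a sum of indicators, the number of optimal prices is measurable in the
    belief.\<close>
  have card: "real (card (S \<mu>)) = (\<Sum>y\<in>menu E. indicator {\<mu> \<in> {0..1}. y \<in> S \<mu>} \<mu>)" if "\<mu> \<in> {0..1}" for \<mu>
  proof -
    have "(\<Sum>y\<in>menu E. indicator {\<mu> \<in> {0..1}. y \<in> S \<mu>} \<mu> :: real) = (\<Sum>y\<in>menu E. if y \<in> S \<mu> then 1 else 0)"
      using that by (intro sum.cong) (auto simp: indicator_def)
    also have "\<dots> = real (card (menu E \<inter> S \<mu>))"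
      using valid_economyD(9)[OF E] by (simp add: sum.If_cases Collect_mem_eq)
    finally show ?thesis using S(1) by (simp add: Int_absorb1)
  qed
  have "(\<lambda>\<mu>. indicator {\<mu> \<in> {0..1}. p \<in> S \<mu>} \<mu> / (\<Sum>y\<in>menu E. indicator {\<mu> \<in> {0..1}. y \<in> S \<mu>} \<mu> :: real)) \<in> borel_measurable borel"
    unfolding S_def by (intro borel_measurable_divide borel_measurable_sum borel_measurable_indicator argmax_measurable[OF E] p)
  also have "(\<lambda>\<mu>. indicator {\<mu> \<in> {0..1}. p \<in> S \<mu>} \<mu> / (\<Sum>y\<in>menu E. indicator {\<mu> \<in> {0..1}. y \<in> S \<mu>} \<mu> :: real))
      = (\<lambda>\<mu>. indicator {0..1} \<mu> *\<^sub>R pmf (pmf_of_set (S \<mu>)) p)"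
    using S card by (intro ext) (auto simp: indicator_def simp del: of_nat_sum)
  finally show ?thesis by (simp add: set_borel_measurable_def S_def)
qed

text \<open>Exact selectors exist, so statements about all of them are not vacuous. The same
  distribution is later the default on null sets.\<close>

lemma uniform_selector:
  assumes E: "valid_economy E"
  shows "desk_selector E (\<lambda>\<mu> p. pmf_of_set (argmax_on (gross_value E \<mu>) (menu E)))"
  unfolding desk_selector_def
  using uniform_argmax_measurable[OF E] argmax_nonempty[OF valid_economyD(9,10)[OF E]] by (simp add: set_pmf_of_set)

lemma sum_set_integral:
  fixes f :: "'i \<Rightarrow> 'a \<Rightarrow> real"
  assumes "\<And>i. set_integrable M A (f i)"
  shows "(\<Sum>i\<in>I. LINT x:A|M. f i x) = (LINT x:A|M. \<Sum>i\<in>I. f i x)"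
  using assms unfolding set_integrable_def set_lebesgue_integral_def scaleR_sum_right
  by (intro Bochner_Integration.integral_sum[symmetric]) auto

context econ_seq
begin

text \<open>Selectors of the perturbed economies have a weak-* convergent subsequence. At each interior
  belief a price that is not optimal in the limit is eventually not optimal, so the limit density
  charges optimal prices almost everywhere; on the exceptional null set it is replaced by the uniform
  distribution on the optimal prices.\<close>

lemma limit_selector:
  assumes r: "\<And>n. desk_selector (Es n) (rs n)"
  obtains s r where "strict_mono (s :: nat \<Rightarrow> nat)" "desk_selector E r"
    "\<And>ms m k. adm {0<..<1} ms m \<Longrightarrow>
       (\<lambda>n. strategic_value (Es (s n)) (rs (s n)) (ms n) (xs (s n) k)) \<longlonglongrightarrow> strategic_value E r m (x k)"
proof -
  \<comment> \<open>Indexed by the pair of current and new price; set to 0 at the belief endpoints,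
    where the interior argument does not reach.\<close>
  define u where "u n kk \<mu> = (if 0 < \<mu> \<and> \<mu> < 1 then pmf (rs n \<mu> (xs n (fst kk))) (xs n (snd kk)) else 0)"
    for n and kk :: "'k \<times> 'k" and \<mu>
  have meas_u: "u n kk \<in> borel_measurable borel" for n kk
  proof -
    have "set_borel_measurable borel {0..1} (\<lambda>\<mu>. pmf (rs n \<mu> (xs n (fst kk))) (xs n (snd kk)))"
      using r[of n] menus by (auto simp: desk_selector_def)
    then have "(\<lambda>\<mu>. indicator {0<..<1} \<mu> * (indicator {0..1} \<mu> *\<^sub>R pmf (rs n \<mu> (xs n (fst kk))) (xs n (snd kk)))) \<in> borel_measurable borel"
      unfolding set_borel_measurable_def by (intro borel_measurable_times borel_measurable_indicator) auto
    also have "(\<lambda>\<mu>. indicator {0<..<1} \<mu> * (indicator {0..1} \<mu> *\<^sub>R pmf (rs n \<mu> (xs n (fst kk))) (xs n (snd kk)))) = u n kk"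
      by (auto simp: u_def fun_eq_iff indicator_def)
    finally show ?thesis .
  qed
  have u01: "0 \<le> u n kk \<mu>" "u n kk \<mu> \<le> 1" for n kk \<mu> by (auto simp: u_def pmf_le_1)
  obtain s h where s: "strict_mono (s :: nat \<Rightarrow> nat)"
    and h: "\<And>kk. h kk \<in> borel_measurable borel" "\<And>kk y. 0 \<le> h kk y" "\<And>kk. integrable lborel (h kk)"
    and conv: "\<And>kk A. A \<in> sets borel \<Longrightarrow> (\<lambda>i. LBINT y:{0..1} \<inter> A. u (s i) kk y) \<longlonglongrightarrow> (LBINT y:A. h kk y)"
    by (rule weak_star_compact[of u, OF meas_u u01]) blast
  have finA: "emeasure lborel ({0..1} \<inter> A) < \<infinity>" for A :: "real set"
    by (rule le_less_trans[OF emeasure_mono[of _ "{0..1}"]]) (auto simp: emeasure_lborel_Icc_eq)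
  have int_u: "set_integrable lborel ({0..1} \<inter> A) (u n kk)" if "A \<in> sets borel" for n kk A
    by (rule bounded_set_integrable[OF meas_u, of _ _ 1]) (use that finA u01 in auto)
  have int_h: "set_integrable lborel A (h kk)" if "A \<in> sets borel" for A kk
    unfolding set_integrable_def using that by (intro integrable_mult_indicator h(3)) auto

  have usum: "(\<Sum>k'\<in>UNIV. u n (k, k') \<mu>) = indicator {0<..<1} \<mu>" for n k \<mu>
  proof (cases "0 < \<mu> \<and> \<mu> < 1")
    case True
    have "(\<Sum>p'\<in>menu (Es n). pmf (rs n \<mu> (xs n k)) p') = 1"
      by (rule sum_pmf_selector[OF r valid_economyD(9)[OF vEs]]) (use True menus in auto)
    then show ?thesis using True inj(1)[of n] by (simp add: menus u_def sum.reindex o_def)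
  next
    case False
    then have "u n kk \<mu> = 0" for kk by (simp only: u_def if_False)
    then show ?thesis using False by (auto simp: indicator_def)
  qed
  \<comment> \<open>The weights sum to 1 on (0, 1) for every n; this survives integration over each
    Borel set and so holds almost everywhere in the limit.\<close>
  have hsum: "AE \<mu> in lborel. (\<Sum>k'\<in>UNIV. h (k, k') \<mu>) = indicator {0<..<1} \<mu>" for k
  proof (rule density_unique_real)
    show "integrable lborel (\<lambda>\<mu>. \<Sum>k'\<in>UNIV. h (k, k') \<mu>)" using h(3) by simp
    show "integrable lborel (indicator {0<..<1} :: real \<Rightarrow> real)" by simp
    fix A :: "real set" assume "A \<in> sets lborel"
    then have A: "A \<in> sets borel" by simp
    have "(\<lambda>i. \<Sum>k'\<in>UNIV. LBINT y:{0..1} \<inter> A. u (s i) (k, k') y) \<longlonglongrightarrow> (\<Sum>k'\<in>UNIV. LBINT y:A. h (k, k') y)"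
      by (intro tendsto_sum conv A)
    moreover have "(\<Sum>k'\<in>UNIV. LBINT y:{0..1} \<inter> A. u n (k, k') y) = (LBINT y:A. indicator {0<..<1} y)" for n
    proof -
      have "(\<Sum>k'\<in>UNIV. LBINT y:{0..1} \<inter> A. u n (k, k') y) = (LBINT y:{0..1} \<inter> A. \<Sum>k'\<in>UNIV. u n (k, k') y)"
        by (rule sum_set_integral[OF int_u[OF A]])
      also have "\<dots> = (LBINT y:A. indicator {0<..<1} y)"
        unfolding usum set_lebesgue_integral_def by (intro Bochner_Integration.integral_cong refl) (auto simp: indicator_def)
      finally show ?thesis .
    qed
    ultimately have "(\<Sum>k'\<in>UNIV. LBINT y:A. h (k, k') y) = (LBINT y:A. indicator {0<..<1} y)"
      by (simp add: LIMSEQ_const_iff)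
    moreover have "(\<Sum>k'\<in>UNIV. LBINT y:A. h (k, k') y) = (LBINT y:A. \<Sum>k'\<in>UNIV. h (k, k') y)"
      by (rule sum_set_integral[OF int_h[OF A]])
    ultimately show "(LBINT y:A. \<Sum>k'\<in>UNIV. h (k, k') y) = (LBINT y:A. indicator {0<..<1} y)" by simp
  qed

  define bad where "bad k' = {0<..<1} \<inter> (UNIV - {\<mu> \<in> {0..1}. x k' \<in> argmax_on (gross_value E \<mu>) (menu E)})" for k'
  have bad: "bad k' \<in> sets borel" for k'
    unfolding bad_def using argmax_measurable[OF E, of "x k'"] menus by (intro sets.Int sets.Diff) auto
  have hbad: "AE \<mu> in lborel. \<mu> \<in> bad k' \<longrightarrow> h (k, k') \<mu> = 0" for k k'
  proof -
    have "(\<lambda>i. LBINT y:{0..1} \<inter> bad k'. u (s i) (k, k') y) \<longlonglongrightarrow> (LBINT y::real. 0)"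
      unfolding set_lebesgue_integral_def
    proof (rule integral_dominated_convergence[where w = "indicator {0..1}"])
      show "(\<lambda>y. indicator ({0..1} \<inter> bad k') y *\<^sub>R u (s i) (k, k') y) \<in> borel_measurable lborel" for i
        using int_u[OF bad] by (auto simp: set_integrable_def)
      show "AE y in lborel. norm (indicator ({0..1} \<inter> bad k') y *\<^sub>R u (s i) (k, k') y) \<le> indicator {0..1} y" for i
        using u01 by (intro AE_I2) (auto simp: indicator_def)
      show "AE y in lborel. (\<lambda>i. indicator ({0..1} \<inter> bad k') y *\<^sub>R u (s i) (k, k') y) \<longlonglongrightarrow> 0"
      proof (intro AE_I2)
        fix \<mu> :: real
        show "(\<lambda>i. indicator ({0..1} \<inter> bad k') \<mu> *\<^sub>R u (s i) (k, k') \<mu>) \<longlonglongrightarrow> 0"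
        proof (cases "\<mu> \<in> bad k'")
          case True
          then have \<mu>: "0 < \<mu>" "\<mu> < 1" and "\<not> (\<forall>y. gross_value E \<mu> (x y) \<le> gross_value E \<mu> (x k'))"
            using menus by (auto simp: bad_def is_arg_max_on_iff)
          then obtain y where y: "gross_value E \<mu> (x k') < gross_value E \<mu> (x y)" by (auto simp: not_le)
          have adm: "adm {0<..<1} (\<lambda>_. \<mu>) \<mu>" using \<mu> by (simp add: adm_def)
          have "eventually (\<lambda>n. gross_value (Es n) \<mu> (xs n k') < gross_value (Es n) \<mu> (xs n y)) sequentially"
            by (rule eventually_less_of_tendsto[OF gross_value_tendsto[OF _ adm] gross_value_tendsto[OF _ adm] y]) auto
          then have "eventually (\<lambda>n. u n (k, k') \<mu> = 0) sequentially"
          proof (rule eventually_mono)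
            fix n assume *: "gross_value (Es n) \<mu> (xs n k') < gross_value (Es n) \<mu> (xs n y)"
            have "set_pmf (rs n \<mu> (xs n k)) \<subseteq> argmax_on (gross_value (Es n) \<mu>) (menu (Es n))"
              using r[of n] \<mu> menus by (auto simp: desk_selector_def)
            moreover have "xs n k' \<notin> argmax_on (gross_value (Es n) \<mu>) (menu (Es n))"
              using * menus by (auto simp: is_arg_max_on_iff not_le)
            ultimately show "u n (k, k') \<mu> = 0" by (auto simp: u_def set_pmf_iff)
          qed
          from eventually_subseq[OF s this] show ?thesis by (intro tendsto_eventually) (auto elim: eventually_mono)
        qed simp
      qed
    qed auto
    from LIMSEQ_unique[OF conv[OF bad] this] have "(LBINT y:bad k'. h (k, k') y) = 0" by simp
    moreover have "AE y in lborel. 0 \<le> indicator (bad k') y *\<^sub>R h (k, k') y" using h(2) by simp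
    ultimately have "AE y in lborel. indicator (bad k') y *\<^sub>R h (k, k') y = 0"
      using integral_nonneg_eq_0_iff_AE int_h[OF bad] unfolding set_lebesgue_integral_def set_integrable_def by blast
    then show ?thesis by eventually_elim (auto simp: indicator_def)
  qed

  \<comment> \<open>The beliefs at which the limit densities form a probability vector on optimal
    prices; almost every interior belief is one.\<close>
  define good where "good = {\<mu>. 0 < \<mu> \<and> \<mu> < 1 \<and> (\<forall>k. (\<Sum>k'\<in>UNIV. h (k, k') \<mu>) = 1) \<and> (\<forall>k k'. \<mu> \<in> bad k' \<longrightarrow> h (k, k') \<mu> = 0)}"
  have good_borel: "good \<in> sets borel"
  proof -
    note [measurable] = h(1) bad
    have "good = {\<mu> \<in> space borel. 0 < \<mu> \<and> \<mu> < 1 \<and> (\<forall>k\<in>UNIV. (\<Sum>k'\<in>UNIV. h (k, k') \<mu>) = 1) \<and> (\<forall>k\<in>UNIV. \<forall>k'\<in>UNIV. \<mu> \<in> bad k' \<longrightarrow> h (k, k') \<mu> = 0)}"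
      by (simp add: good_def)
    also have "\<dots> \<in> sets borel" by measurable
    finally show ?thesis .
  qed
  have good_AE: "AE \<mu> in lborel. 0 < \<mu> \<and> \<mu> < 1 \<longrightarrow> \<mu> \<in> good"
  proof -
    have "AE \<mu> in lborel. \<forall>k\<in>UNIV. (\<Sum>k'\<in>UNIV. h (k, k') \<mu>) = indicator {0<..<1} \<mu>"
      by (rule AE_finite_allI) (use hsum in auto)
    moreover have "AE \<mu> in lborel. \<forall>k\<in>UNIV. \<forall>k'\<in>UNIV. \<mu> \<in> bad k' \<longrightarrow> h (k, k') \<mu> = 0"
      by (intro AE_finite_allI) (use hbad in auto)
    ultimately show ?thesis by eventually_elim (auto simp: good_def)
  qed
  have "\<exists>M. (\<forall>k'. pmf M (x k') = h (k, k') \<mu>) \<and> set_pmf M \<subseteq> argmax_on (gross_value E \<mu>) (menu E)" if \<mu>: "\<mu> \<in> good" for k \<mu>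
  proof -
    obtain M where M: "\<And>k'. pmf M (x k') = h (k, k') \<mu>" "set_pmf M \<subseteq> x ` {k'. h (k, k') \<mu> \<noteq> 0}"
      using finite_weights_pmf[OF inj(2), of "\<lambda>k'. h (k, k') \<mu>"] h(2) \<mu> by (auto simp: good_def)
    have "x k' \<in> argmax_on (gross_value E \<mu>) (menu E)" if "h (k, k') \<mu> \<noteq> 0" for k'
      using that \<mu> by (auto simp: good_def bad_def)
    then show ?thesis using M by blast
  qed
  then have "\<forall>k \<mu>. \<exists>M. \<mu> \<in> good \<longrightarrow> (\<forall>k'. pmf M (x k') = h (k, k') \<mu>) \<and> set_pmf M \<subseteq> argmax_on (gross_value E \<mu>) (menu E)"
    by blast
  then obtain M where M: "\<And>k \<mu> k'. \<mu> \<in> good \<Longrightarrow> pmf (M k \<mu>) (x k') = h (k, k') \<mu>"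
      "\<And>k \<mu>. \<mu> \<in> good \<Longrightarrow> set_pmf (M k \<mu>) \<subseteq> argmax_on (gross_value E \<mu>) (menu E)"
    by metis
  define r' where "r' \<mu> p = (if \<mu> \<in> good then M (inv x p) \<mu> else pmf_of_set (argmax_on (gross_value E \<mu>) (menu E)))" for \<mu> p
  have sel: "desk_selector E r'"
    unfolding desk_selector_def
  proof (intro ballI conjI)
    fix p assume "p \<in> menu E"
    then obtain k where k: "p = x k" using menus by auto
    show "set_pmf (r' \<mu> p) \<subseteq> argmax_on (gross_value E \<mu>) (menu E)" for \<mu>
      using M(2) argmax_nonempty[OF valid_economyD(9,10)[OF E]] by (auto simp: r'_def set_pmf_of_set)
    fix p' assume p': "p' \<in> menu E"
    then obtain k' where k': "p' = x k'" using menus by auto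
    have "(\<lambda>\<mu>. if \<mu> \<in> good then h (k, k') \<mu> else indicator {0..1} \<mu> *\<^sub>R pmf (pmf_of_set (argmax_on (gross_value E \<mu>) (menu E))) p') \<in> borel_measurable borel"
      using uniform_argmax_measurable[OF E p'] good_borel h(1) unfolding set_borel_measurable_def
      by (intro measurable_If_set) auto
    also have "(\<lambda>\<mu>. if \<mu> \<in> good then h (k, k') \<mu> else indicator {0..1} \<mu> *\<^sub>R pmf (pmf_of_set (argmax_on (gross_value E \<mu>) (menu E))) p')
        = (\<lambda>\<mu>. indicator {0..1} \<mu> *\<^sub>R pmf (r' \<mu> p) p')"
      using M(1) by (auto simp: fun_eq_iff r'_def k k' inv_f_f[OF inj(2)] good_def)
    finally show "set_borel_measurable borel {0..1} (\<lambda>\<mu>. pmf (r' \<mu> p) p')" by (simp add: set_borel_measurable_def)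
  qed

  \<comment> \<open>A version of h read off the selector, hence in [0, 1] everywhere and not just
    almost everywhere, as \<open>weak_limit_flow\<close> requires.\<close>
  define hh where "hh kk \<mu> = (if 0 < \<mu> \<and> \<mu> < 1 then pmf (r' \<mu> (x (fst kk))) (x (snd kk)) else 0)" for kk :: "'k \<times> 'k" and \<mu>
  have hh01: "0 \<le> hh kk \<mu>" "hh kk \<mu> \<le> 1" for kk \<mu> by (auto simp: hh_def pmf_le_1)
  have meas_hh: "hh kk \<in> borel_measurable borel" for kk
  proof -
    have "set_borel_measurable borel {0..1} (\<lambda>\<mu>. pmf (r' \<mu> (x (fst kk))) (x (snd kk)))"
      using sel menus by (auto simp: desk_selector_def)
    then have "(\<lambda>\<mu>. indicator {0<..<1} \<mu> * (indicator {0..1} \<mu> *\<^sub>R pmf (r' \<mu> (x (fst kk))) (x (snd kk)))) \<in> borel_measurable borel"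
      unfolding set_borel_measurable_def by (intro borel_measurable_times borel_measurable_indicator) auto
    also have "(\<lambda>\<mu>. indicator {0<..<1} \<mu> * (indicator {0..1} \<mu> *\<^sub>R pmf (r' \<mu> (x (fst kk))) (x (snd kk)))) = hh kk"
      by (auto simp: hh_def fun_eq_iff indicator_def)
    finally show ?thesis .
  qed
  have h_hh: "AE \<mu> in lborel. h (k, k') \<mu> = hh (k, k') \<mu>" for k k'
    using good_AE hsum[of k]
  proof eventually_elim
    fix \<mu> assume *: "0 < \<mu> \<and> \<mu> < 1 \<longrightarrow> \<mu> \<in> good" "(\<Sum>k'\<in>UNIV. h (k, k') \<mu>) = indicator {0<..<1} \<mu>"
    show "h (k, k') \<mu> = hh (k, k') \<mu>"
    proof (cases "0 < \<mu> \<and> \<mu> < 1")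
      case True
      then show ?thesis using * M(1) by (simp add: hh_def r'_def inv_f_f[OF inj(2)])
    next
      case False
      then have "(\<Sum>k'\<in>UNIV. h (k, k') \<mu>) = 0" using *(2) by simp
      then have "h (k, k') \<mu> = 0" using h(2) by (simp add: sum_nonneg_eq_0_iff)
      then show ?thesis using False by (auto simp: hh_def)
    qed
  qed
  have box: "(\<lambda>n. LBINT y:{0..1} \<inter> {..b}. u (s n) kk y - hh kk y) \<longlonglongrightarrow> 0" for kk b
  proof -
    obtain k k' where kk: "kk = (k, k')" by (cases kk)
    have int_hh: "set_integrable lborel ({0..1} \<inter> {..b}) (hh kk)"
      by (rule bounded_set_integrable[where K = 1, OF meas_hh _ _ finA]) (use hh01 in auto)
    have "(LBINT y:{..b}. h kk y) = (LBINT y:{0..1} \<inter> {..b}. hh kk y)"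
      unfolding set_lebesgue_integral_def
    proof (rule integral_cong_AE)
      show "AE y in lborel. indicator {..b} y *\<^sub>R h kk y = indicator ({0..1} \<inter> {..b}) y *\<^sub>R hh kk y"
        using h_hh[of k k'] unfolding kk by eventually_elim (auto simp: indicator_def hh_def)
    qed (use h(1) meas_hh in measurable)
    then have "(\<lambda>n. (LBINT y:{0..1} \<inter> {..b}. u (s n) kk y) - (LBINT y:{0..1} \<inter> {..b}. hh kk y)) \<longlonglongrightarrow> 0"
      using tendsto_diff[OF conv[of "{..b}" kk] tendsto_const[of "LBINT y:{..b}. h kk y"]] by simp
    then show ?thesis using set_integral_diff(2)[OF int_u int_hh] by simp
  qed

  obtain B where B: "value_bound E \<le> B" "\<And>n. value_bound (Es n) \<le> B" using value_bound_bounded by blast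
  have Es': "econ_tendsto (\<lambda>n. Es (s n)) E sequentially"
    using Es filterlim_compose[OF _ filterlim_subseq[OF s]] unfolding econ_tendsto_def by blast
  have xs': "(\<lambda>n. xs (s n) k) \<longlonglongrightarrow> x k" for k using filterlim_compose[OF xs filterlim_subseq[OF s]] .
  define V where "V n = strategic_value (Es (s n)) (rs (s n))" for n
  define Vl where "Vl = strategic_value E r'"
  have Vl: "is_value A_L (sel_agg E r') E Vl" "\<And>\<mu> p. \<mu> \<in> {0..1} \<Longrightarrow> p \<in> menu E \<Longrightarrow> \<bar>Vl \<mu> p\<bar> \<le> B"
    using strategic_value[OF E sel] B(1) by (auto simp: Vl_def intro: order_trans)
  have Vb: "\<bar>strategic_value (Es (s n)) (rs (s n)) \<mu> p\<bar> \<le> B" if "\<mu> \<in> {0..1}" "p \<in> menu (Es (s n))" for n \<mu> p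
    by (rule order_trans[OF strategic_value(2)[OF vEs r that] B(2)])
  have carry: "sel_agg (Es (s n)) (rs (s n)) (xs (s n) k) \<phi> (\<lambda>p. v (x (inv (xs (s n)) p))) = (\<Sum>k'\<in>UNIV. u (s n) (k, k') \<phi> * v (x k'))"
    if "0 < \<phi>" "\<phi> < 1" for n k \<phi> and v :: "real \<Rightarrow> real"
    using that inj(1)[of "s n"] by (simp add: sel_agg_def menus u_def sum.reindex o_def inv_f_f)
  have lim: "sel_agg E r' (x k) \<phi> v = (\<Sum>k'\<in>UNIV. hh (k, k') \<phi> * v (x k'))" if "0 < \<phi>" "\<phi> < 1" for k \<phi> and v :: "real \<Rightarrow> real"
    using that inj(2) by (simp add: sel_agg_def menus hh_def sum.reindex o_def)
  have meas_Vl: "(\<lambda>t. Vl (flow E p t m) (x k')) \<in> borel_measurable borel" if "m \<in> {0..1}" for p m k'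
    by (rule flow_comp_measurable[OF E _ that]) (use Vl(1) menus in \<open>auto simp: is_value_def bounded_value_def\<close>)
  interpret st: stability A_L "{0<..<1}" "\<lambda>n. Es (s n)" E "\<lambda>n. sel_agg (Es (s n)) (rs (s n))" "sel_agg E r'" V Vl "\<lambda>n. xs (s n)" x B
  proof (unfold_locales, goal_cases)
    case (16 n k \<mu> m)
    have "(\<lambda>t. \<Sum>k'\<in>UNIV. u (s n) (k, k') (flow (Es (s n)) (xs (s n) k) t \<mu>) * Vl (flow E (x k) t m) (x k')) \<in> borel_measurable borel"
      using 16 by (intro borel_measurable_sum borel_measurable_times meas_Vl
          measurable_compose[OF measurable_flow[OF vEs] meas_u]) auto
    then show ?case using 16 flow_interior[OF vEs] by (simp add: carry)
  next
    case (17 ms m k)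
    then have ms: "\<And>n. 0 < ms n \<and> ms n < 1" "0 < m" "m < 1" "ms \<longlonglongrightarrow> m" by (auto simp: adm_def)
    then have m01: "m \<in> {0..1}" by simp
    \<comment> \<open>For each new price the limiting continuation value is made part of the weight,
      so that only the probability remains to converge weakly.\<close>
    define w where "w k' t = wt E (x k) (hazard A_L E (x k)) m t * Vl (flow E (x k) t m) (x k')" for k' t
    define \<phi>n where "\<phi>n n t = flow (Es (s n)) (xs (s n) k) t (ms n)" for n t
    define \<phi> where "\<phi> t = flow E (x k) t m" for t
    have w_int: "integrable lborel (w k')" for k'
      unfolding w_def[abs_def]
      by (rule silence_path.wt_integrable[where K = B, OF path_hazard[OF _ E] m01 meas_Vl[OF m01]])
         (use Vl(2) flow_range[OF E m01] menus in \<open>auto simp: demand_def\<close>)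
    have "(\<lambda>n. LBINT t. w k' t * (u (s n) (k, k') (\<phi>n n t) - hh (k, k') (\<phi> t))) \<longlonglongrightarrow> 0" for k'
      unfolding \<phi>n_def \<phi>_def
      by (rule weak_limit_flow[OF Es' vEs E xs' ms(4,1,2,3) meas_u _ meas_hh _ box w_int])
         (use u01 hh01 in \<open>auto simp: w_def wt_def\<close>)
    then have "(\<lambda>n. \<Sum>k'\<in>UNIV. LBINT t. w k' t * (u (s n) (k, k') (\<phi>n n t) - hh (k, k') (\<phi> t))) \<longlonglongrightarrow> (\<Sum>k'\<in>(UNIV :: 'k set). 0)"
      by (rule tendsto_sum)
    moreover have "(\<Sum>k'\<in>UNIV. LBINT t. w k' t * (u (s n) (k, k') (\<phi>n n t) - hh (k, k') (\<phi> t)))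
        = (LBINT t. wt E (x k) (hazard A_L E (x k)) m t *
         (sel_agg (Es (s n)) (rs (s n)) (xs (s n) k) (\<phi>n n t) (\<lambda>p. Vl (\<phi> t) (x (inv (xs (s n)) p)))
          - sel_agg E r' (x k) (\<phi> t) (Vl (\<phi> t))))" for n
    proof -
      have int: "integrable lborel (\<lambda>t. w k' t * (u (s n) (k, k') (\<phi>n n t) - hh (k, k') (\<phi> t)))" for k'
      proof (rule integrable_mult_bounded[OF _ _ w_int])
        show "(\<lambda>t. u (s n) (k, k') (\<phi>n n t) - hh (k, k') (\<phi> t)) \<in> borel_measurable borel"
          unfolding \<phi>n_def \<phi>_def
          by (intro borel_measurable_diff measurable_compose[OF measurable_flow[OF vEs] meas_u]
              measurable_compose[OF measurable_flow[OF E] meas_hh]) auto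
        show "\<bar>u (s n) (k, k') (\<phi>n n t) - hh (k, k') (\<phi> t)\<bar> \<le> 1" for t
          using u01[of "s n" "(k, k')" "\<phi>n n t"] hh01[of "(k, k')" "\<phi> t"] by (auto simp: abs_le_iff)
      qed
      have "(\<Sum>k'\<in>UNIV. LBINT t. w k' t * (u (s n) (k, k') (\<phi>n n t) - hh (k, k') (\<phi> t)))
          = (LBINT t. \<Sum>k'\<in>UNIV. w k' t * (u (s n) (k, k') (\<phi>n n t) - hh (k, k') (\<phi> t)))"
        using int by (subst Bochner_Integration.integral_sum) auto
      also have "\<dots> = (LBINT t. wt E (x k) (hazard A_L E (x k)) m t *
         (sel_agg (Es (s n)) (rs (s n)) (xs (s n) k) (\<phi>n n t) (\<lambda>p. Vl (\<phi> t) (x (inv (xs (s n)) p)))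
          - sel_agg E r' (x k) (\<phi> t) (Vl (\<phi> t))))"
      proof (rule Bochner_Integration.integral_cong[OF refl])
        fix t
        have i: "0 < \<phi>n n t" "\<phi>n n t < 1" "0 < \<phi> t" "\<phi> t < 1"
          using flow_interior[OF vEs] flow_interior[OF E] ms by (auto simp: \<phi>n_def \<phi>_def)
        show "(\<Sum>k'\<in>UNIV. w k' t * (u (s n) (k, k') (\<phi>n n t) - hh (k, k') (\<phi> t))) =
          wt E (x k) (hazard A_L E (x k)) m t *
         (sel_agg (Es (s n)) (rs (s n)) (xs (s n) k) (\<phi>n n t) (\<lambda>p. Vl (\<phi> t) (x (inv (xs (s n)) p)))
          - sel_agg E r' (x k) (\<phi> t) (Vl (\<phi> t)))"
          unfolding carry[OF i(1,2)] lim[OF i(3,4)] sum_subtractf[symmetric] sum_distrib_left w_def \<phi>_def[symmetric]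
          by (intro sum.cong refl) (simp add: algebra_simps)
      qed
      finally show ?thesis .
    qed
    ultimately show ?case by (simp add: \<phi>n_def \<phi>_def)
  qed (use Es' vEs E menus inj xs' aggregator_sel[OF vEs r] aggregator_sel[OF E sel] strategic_value(1)[OF vEs r] Vl Vb in
      \<open>auto simp: demand_def V_def\<close>)
  show ?thesis by (rule that[OF s sel]) (use st.values_tendsto in \<open>auto simp: V_def Vl_def\<close>)
qed

end


section \<open>Openness of the conditions\<close>

lemma economy_of_simps [simp]:
  "disc (economy_of e) = fst e" "arrival (economy_of e) = fst (snd e)"
  "reset (economy_of e) = fst (snd (snd e))" "hval (economy_of e) = fst (snd (snd (snd e)))"
  "scale (economy_of e) = fst (snd (snd (snd (snd e))))" "cost (economy_of e) = fst (snd (snd (snd (snd (snd e)))))"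
  "precision (economy_of e) = fst (snd (snd (snd (snd (snd (snd e))))))"
  "menu (economy_of e) = range (\<lambda>k. econ_prices e $ k)"
  by (simp_all add: economy_of_def econ_prices_def case_prod_unfold)

lemma econ_prices_alt: "econ_prices e = snd (snd (snd (snd (snd (snd (snd e))))))"
  by (simp add: econ_prices_def case_prod_unfold)

lemma econ_tendsto_param:
  assumes "es \<longlonglongrightarrow> e"
  shows "econ_tendsto (\<lambda>n. economy_of (es n)) (economy_of e) sequentially"
    "(\<lambda>n. econ_prices (es n) $ k) \<longlonglongrightarrow> econ_prices e $ k"
proof -
  show "econ_tendsto (\<lambda>n. economy_of (es n)) (economy_of e) sequentially"
    unfolding econ_tendsto_def economy_of_simps by (intro conjI tendsto_fst tendsto_snd assms)
  show "(\<lambda>n. econ_prices (es n) $ k) \<longlonglongrightarrow> econ_prices e $ k"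
    unfolding econ_prices_alt by (intro tendsto_vec_nth tendsto_snd assms)
qed

lemma valid_param_iff:
  "valid_param e \<longleftrightarrow> 0 < disc (economy_of e) \<and> 0 < arrival (economy_of e) \<and> 0 < reset (economy_of e) \<and>
     0 < hval (economy_of e) \<and> 0 < scale (economy_of e) \<and> 0 < cost (economy_of e) \<and>
     1/2 < precision (economy_of e) \<and> precision (economy_of e) < 1 \<and>
     (\<forall>k. 0 < econ_prices e $ k) \<and> (\<forall>k k'. k \<noteq> k' \<longrightarrow> econ_prices e $ k \<noteq> econ_prices e $ k')"
  unfolding valid_param_def valid_economy_def by (auto simp: inj_def)

lemma eventually_valid_param:
  fixes e :: "'k::finite econ_param"
  assumes e: "valid_param e" and es: "es \<longlonglongrightarrow> e"
  shows "eventually (\<lambda>n. valid_param (es n)) sequentially"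
proof -
  note lim = econ_tendstoD[OF econ_tendsto_param(1)[OF es]]
  have cost: "(\<lambda>n. cost (economy_of (es n))) \<longlonglongrightarrow> cost (economy_of e)"
    unfolding economy_of_simps by (intro tendsto_fst tendsto_snd es)
  have ne: "eventually (\<lambda>n. k \<noteq> k' \<longrightarrow> econ_prices (es n) $ k \<noteq> econ_prices (es n) $ k') sequentially" for k k'
  proof (cases "k = k'")
    case False
    then have "econ_prices e $ k - econ_prices e $ k' \<noteq> 0" using e by (auto simp: valid_param_iff)
    from tendsto_imp_eventually_ne[OF tendsto_diff[OF econ_tendsto_param(2)[OF es] econ_tendsto_param(2)[OF es]] this]
    show ?thesis by eventually_elim simp
  qed simp
  have pos: "eventually (\<lambda>n. 0 < econ_prices (es n) $ k) sequentially" for k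
    using order_tendstoD(1)[OF econ_tendsto_param(2)[OF es]] e by (auto simp: valid_param_iff)
  note v = e[unfolded valid_param_iff]
  show ?thesis unfolding valid_param_iff
    by (intro eventually_conj eventually_all_finite ne pos order_tendstoD(1)[OF lim(1)] order_tendstoD(1)[OF lim(2)]
        order_tendstoD(1)[OF lim(3)] order_tendstoD(1)[OF lim(4)] order_tendstoD(1)[OF lim(5)] order_tendstoD(1)[OF cost]
        order_tendstoD(1)[OF lim(6)] order_tendstoD(2)[OF lim(6)]) (use v in blast)+
qed

lemma econ_seq_param:
  fixes e :: "'k::finite econ_param"
  assumes "es \<longlonglongrightarrow> e" "\<And>n. valid_param (es n)" "valid_param e"
  shows "econ_seq (\<lambda>n. economy_of (es n)) (economy_of e) (\<lambda>n k. econ_prices (es n) $ k) (\<lambda>k. econ_prices e $ k)"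
  by unfold_locales (use assms econ_tendsto_param[OF assms(1)] in \<open>auto simp: valid_param_def\<close>)

lemma uniquely_reset_optimal_iff:
  assumes "menu E = range x" "inj x"
  shows "uniquely_reset_optimal E \<mu> (x j) \<longleftrightarrow> (\<forall>k. k \<noteq> j \<longrightarrow> gross_value E \<mu> (x k) < gross_value E \<mu> (x j))"
proof
  assume u: "uniquely_reset_optimal E \<mu> (x j)"
  show "\<forall>k. k \<noteq> j \<longrightarrow> gross_value E \<mu> (x k) < gross_value E \<mu> (x j)"
  proof (intro allI impI)
    fix k assume "k \<noteq> j"
    then have "x k \<noteq> x j" using assms(2) by (auto dest: injD)
    then have "x k \<notin> argmax_on (gross_value E \<mu>) (menu E)" "x j \<in> argmax_on (gross_value E \<mu>) (menu E)"
      using u by (auto simp: uniquely_reset_optimal_def)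
    then obtain y where "gross_value E \<mu> (x k) < gross_value E \<mu> y" "y \<in> menu E"
      "gross_value E \<mu> y \<le> gross_value E \<mu> (x j)"
      using assms(1) by (auto simp: is_arg_max_on_iff not_le)
    then show "gross_value E \<mu> (x k) < gross_value E \<mu> (x j)" by linarith
  qed
next
  assume *: "\<forall>k. k \<noteq> j \<longrightarrow> gross_value E \<mu> (x k) < gross_value E \<mu> (x j)"
  then have "gross_value E \<mu> (x k) \<le> gross_value E \<mu> (x j)" for k by (cases "k = j") (auto simp: less_imp_le)
  then show "uniquely_reset_optimal E \<mu> (x j)"
    using * assms(1) unfolding uniquely_reset_optimal_def
    by (auto simp: is_arg_max_on_iff) (metis leD)
qed

lemma eventually_uniquely_reset_optimal:
  fixes e :: "'k::finite econ_param"
  assumes es: "es \<longlonglongrightarrow> e" "\<And>n. valid_param (es n)" "valid_param e" and \<mu>: "0 < \<mu>" "\<mu> \<le> 1"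
    and u: "uniquely_reset_optimal (economy_of e) \<mu> (econ_prices e $ j)"
  shows "eventually (\<lambda>n. uniquely_reset_optimal (economy_of (es n)) \<mu> (econ_prices (es n) $ j)) sequentially"
proof -
  interpret econ_seq "\<lambda>n. economy_of (es n)" "economy_of e" "\<lambda>n k. econ_prices (es n) $ k" "\<lambda>k. econ_prices e $ k"
    by (rule econ_seq_param[OF es])
  \<comment> \<open>A constant belief lies in exactly one of the two sets on which gross values
    converge.\<close>
  define X where "X = (if \<mu> = 1 then {1} else {0<..<1::real})"
  have X: "X = {0<..<1} \<or> X = {1}" and adm: "adm X (\<lambda>_. \<mu>) \<mu>" using \<mu> by (auto simp: X_def adm_def)
  have "eventually (\<lambda>n. k \<noteq> j \<longrightarrow> gross_value (economy_of (es n)) \<mu> (econ_prices (es n) $ k)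
      < gross_value (economy_of (es n)) \<mu> (econ_prices (es n) $ j)) sequentially" for k
  proof (cases "k = j")
    case False
    have "gross_value (economy_of e) \<mu> (econ_prices e $ k) < gross_value (economy_of e) \<mu> (econ_prices e $ j)"
      using u False unfolding uniquely_reset_optimal_iff[OF menus(2) inj(2)] by blast
    from eventually_less_of_tendsto[OF gross_value_tendsto[OF X adm] gross_value_tendsto[OF X adm] this]
    show ?thesis by eventually_elim simp
  qed simp
  then show ?thesis
    unfolding uniquely_reset_optimal_iff[OF menus(1) inj(1)] by (intro eventually_all_finite)
qed

text \<open>The sequence lies entirely outside S, so that a violation can be picked for every
  index.\<close>

lemma open_of_sequences:
  fixes S :: "'a::first_countable_topology set"
  assumes "\<And>l s. l \<in> S \<Longrightarrow> s \<longlonglongrightarrow> l \<Longrightarrow> (\<And>n. s n \<notin> S) \<Longrightarrow> False"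
  shows "open S"
proof -
  have "closed (- S)" unfolding closed_sequential_limits using assms by blast
  then show ?thesis by (simp add: closed_def)
qed

lemma robust_conditionsD:
  assumes "robust_conditions e \<mu>\<^sub>0 i j"
  shows "valid_param e" "valid_economy (economy_of e)" "uniquely_reset_optimal (economy_of e) \<mu>\<^sub>0 (econ_prices e $ j)"
    "\<And>r. desk_selector (economy_of e) r \<Longrightarrow> strict_inherited_price_cond (economy_of e) r \<mu>\<^sub>0 (econ_prices e $ i) (econ_prices e $ j)"
    "econ_prices e $ j < econ_prices e $ i" "econ_prices e $ i < price_D (economy_of e) \<mu>\<^sub>0" "0 < econ_prices e $ i"
proof -
  show v: "valid_param e" and v': "valid_economy (economy_of e)"
    and "uniquely_reset_optimal (economy_of e) \<mu>\<^sub>0 (econ_prices e $ j)"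
    and s: "\<And>r. desk_selector (economy_of e) r \<Longrightarrow> strict_inherited_price_cond (economy_of e) r \<mu>\<^sub>0 (econ_prices e $ i) (econ_prices e $ j)"
    using assms by (auto simp: robust_conditions_def Let_def valid_param_def)
  \<comment> \<open>A single existing selector suffices to extract the inequalities that do not
    involve values.\<close>
  from s[OF uniform_selector[OF v']]
  show "econ_prices e $ j < econ_prices e $ i" "econ_prices e $ i < price_D (economy_of e) \<mu>\<^sub>0"
    by (auto simp: strict_inherited_price_cond_def)
  show "0 < econ_prices e $ i" using v by (simp add: valid_param_iff)
qed

lemma robust_conditions_pos:
  assumes "robust_conditions e \<mu>\<^sub>0 i j" "0 \<le> \<mu>\<^sub>0"
  shows "0 < \<mu>\<^sub>0"
  using robust_conditionsD(6,7)[OF assms(1)] assms(2) price_D_0[of "economy_of e"] by (cases "\<mu>\<^sub>0 = 0") auto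

lemma open_robust_conditions:
  fixes i j :: "'k::finite"
  assumes \<mu>: "0 \<le> \<mu>\<^sub>0" "\<mu>\<^sub>0 \<le> 1"
  shows "open {e :: 'k econ_param. robust_conditions e \<mu>\<^sub>0 i j}"
proof (rule open_of_sequences)
  fix e :: "'k econ_param" and es0
  assume "e \<in> {e. robust_conditions e \<mu>\<^sub>0 i j}" and es0: "es0 \<longlonglongrightarrow> e" and "\<And>n. es0 n \<notin> {e. robust_conditions e \<mu>\<^sub>0 i j}"
  then have e: "robust_conditions e \<mu>\<^sub>0 i j" and not0: "\<And>n. \<not> robust_conditions (es0 n) \<mu>\<^sub>0 i j" by auto
  have \<mu>0: "0 < \<mu>\<^sub>0" by (rule robust_conditions_pos[OF e \<mu>(1)])
  note eD = robust_conditionsD[OF e]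
  obtain N where N: "\<And>n. n \<ge> N \<Longrightarrow> valid_param (es0 n)"
    using eventually_valid_param[OF eD(1) es0] unfolding eventually_sequentially by blast
  define es where "es n = es0 (n + N)" for n
  have es: "es \<longlonglongrightarrow> e" unfolding es_def by (rule LIMSEQ_ignore_initial_segment[OF es0])
  have ves: "valid_param (es n)" for n unfolding es_def by (rule N) simp
  have not: "\<not> robust_conditions (es n) \<mu>\<^sub>0 i j" for n unfolding es_def by (rule not0)
  interpret econ_seq "\<lambda>n. economy_of (es n)" "economy_of e" "\<lambda>n k. econ_prices (es n) $ k" "\<lambda>k. econ_prices e $ k"
    by (rule econ_seq_param[OF es ves eD(1)])
  \<comment> \<open>The conditions that mention no selector hold eventually, so from then on only
    the inequalities for \<open>B0\<close> can fail.\<close>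
  define Q where "Q n \<longleftrightarrow> uniquely_reset_optimal (economy_of (es n)) \<mu>\<^sub>0 (econ_prices (es n) $ j) \<and>
      econ_prices (es n) $ j < econ_prices (es n) $ i \<and> econ_prices (es n) $ i < price_D (economy_of (es n)) \<mu>\<^sub>0" for n
  have Q: "eventually Q sequentially"
    unfolding Q_def[abs_def]
    using eventually_uniquely_reset_optimal[OF es ves eD(1) \<mu>0 \<mu>(2) eD(3)] eventually_less_of_tendsto[OF xs xs eD(5)]
      eventually_less_of_tendsto[OF xs tendsto_price_D[OF Es E tendsto_const] eD(6)] \<mu>
    by (intro eventually_conj) auto
  \<comment> \<open>Where \<open>Q n\<close> fails any selector will do; supplying one makes the
    sequence of selectors total.\<close>
  have "\<exists>r. desk_selector (economy_of (es n)) r \<and>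
      (Q n \<longrightarrow> \<not> (B0 (economy_of (es n)) r (econ_prices (es n) $ i) \<mu>\<^sub>0 > B0 (economy_of (es n)) r (econ_prices (es n) $ j) \<mu>\<^sub>0 \<and>
           B0 (economy_of (es n)) r (econ_prices (es n) $ j) \<mu>\<^sub>0 > 0))" for n
  proof (cases "Q n")
    case True
    then show ?thesis
      using not[of n] ves[of n] by (auto simp: robust_conditions_def Let_def strict_inherited_price_cond_def Q_def)
  qed (use uniform_selector[OF vEs] in blast)
  then obtain rs where rs: "\<And>n. desk_selector (economy_of (es n)) (rs n)"
    and viol: "\<And>n. Q n \<Longrightarrow> \<not> (B0 (economy_of (es n)) (rs n) (econ_prices (es n) $ i) \<mu>\<^sub>0 > B0 (economy_of (es n)) (rs n) (econ_prices (es n) $ j) \<mu>\<^sub>0 \<and>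
           B0 (economy_of (es n)) (rs n) (econ_prices (es n) $ j) \<mu>\<^sub>0 > 0)"
    by metis
  show False
  proof (cases "\<mu>\<^sub>0 = 1")
    case True
    \<comment> \<open>A purchase leaves belief 1 unchanged, so the strategic values cancel and the
      inequalities in question become inequalities between prices, which hold by
      \<open>Q n\<close>.\<close>
    have B: "B0 (economy_of (es n)) (rs n) p \<mu>\<^sub>0 = p" for n p
      by (simp add: B0_def True J0_endpoints(2)[OF vEs])
    obtain n where n: "Q n" using Q by (auto dest: eventually_happens)
    then show False using viol[OF n] ves[of n] by (simp add: B Q_def valid_param_iff)
  next
    case False
    then have \<mu>1: "\<mu>\<^sub>0 < 1" using \<mu>(2) by simp
    obtain s r where s: "strict_mono (s :: nat \<Rightarrow> nat)" and r: "desk_selector (economy_of e) r"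
      and lim: "\<And>ms m k. adm {0<..<1} ms m \<Longrightarrow>
         (\<lambda>n. strategic_value (economy_of (es (s n))) (rs (s n)) (ms n) (econ_prices (es (s n)) $ k))
            \<longlonglongrightarrow> strategic_value (economy_of e) r m (econ_prices e $ k)"
      by (rule limit_selector[OF rs]) blast
    have adm: "adm {0<..<1} (\<lambda>_. \<mu>\<^sub>0) \<mu>\<^sub>0" using \<mu>0 \<mu>1 by (simp add: adm_def)
    note sub = filterlim_compose[OF _ filterlim_subseq[OF s]]
    have Es': "econ_tendsto (\<lambda>n. economy_of (es (s n))) (economy_of e) sequentially"
      using Es sub unfolding econ_tendsto_def by blast
    have Blim: "(\<lambda>n. B0 (economy_of (es (s n))) (rs (s n)) (econ_prices (es (s n)) $ k) \<mu>\<^sub>0)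
        \<longlonglongrightarrow> B0 (economy_of e) r (econ_prices e $ k) \<mu>\<^sub>0" for k
      unfolding B0_def
      by (intro tendsto_diff tendsto_add sub[OF xs] lim adm adm_J0[OF _ Es' vEs E sub[OF xs] adm]) simp
    have "B0 (economy_of e) r (econ_prices e $ j) \<mu>\<^sub>0 < B0 (economy_of e) r (econ_prices e $ i) \<mu>\<^sub>0"
      "0 < B0 (economy_of e) r (econ_prices e $ j) \<mu>\<^sub>0"
      using eD(4)[OF r] by (auto simp: strict_inherited_price_cond_def)
    from eventually_less_of_tendsto[OF Blim Blim this(1)] order_tendstoD(1)[OF Blim this(2)] eventually_subseq[OF s Q]
    have "eventually (\<lambda>n. False) sequentially"
      by eventually_elim (use viol in blast)
    then show False by simp
  qed
qed

lemma open_robust_upstream_conditions: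
  fixes i j :: "'k::finite"
  assumes \<mu>: "0 \<le> \<mu>\<^sub>0" "\<mu>\<^sub>0 \<le> 1"
  shows "open {e :: 'k econ_param. robust_upstream_conditions e \<mu>' \<mu>\<^sub>0 i j}"
proof (rule open_of_sequences)
  fix e :: "'k econ_param" and es0
  assume "e \<in> {e. robust_upstream_conditions e \<mu>' \<mu>\<^sub>0 i j}" and es0: "es0 \<longlonglongrightarrow> e"
    and "\<And>n. es0 n \<notin> {e. robust_upstream_conditions e \<mu>' \<mu>\<^sub>0 i j}"
  then have e: "robust_conditions e \<mu>\<^sub>0 i j" "upstream (economy_of e) (econ_prices e $ i) \<mu>' \<mu>\<^sub>0"
      "uniquely_reset_optimal (economy_of e) \<mu>' (econ_prices e $ i)"
    and not0: "\<And>n. \<not> robust_upstream_conditions (es0 n) \<mu>' \<mu>\<^sub>0 i j" by (auto simp: robust_upstream_conditions_def Let_def)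
  note eD = robust_conditionsD[OF e(1)]
  have \<mu>0: "0 < \<mu>\<^sub>0" by (rule robust_conditions_pos[OF e(1) \<mu>(1)])
  \<comment> \<open>Otherwise both unique optima would be taken at belief 1, at different
    prices.\<close>
  have \<mu>1: "\<mu>\<^sub>0 < 1"
  proof (rule ccontr)
    assume "\<not> \<mu>\<^sub>0 < 1"
    then have "\<mu>\<^sub>0 = 1" "\<mu>' = 1" using \<mu>(2) upstream_1[OF eD(2)] e(2) by auto
    then have "{econ_prices e $ i} = {econ_prices e $ j}" using e(3) eD(3) by (simp add: uniquely_reset_optimal_def)
    then show False using eD(5) by simp
  qed
  have up: "\<mu>\<^sub>0 \<le> \<mu>'" "\<mu>' < 1" using e(2) upstream_iff[OF eD(2) \<mu>0 \<mu>1] by auto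
  obtain N where N: "\<And>n. n \<ge> N \<Longrightarrow> robust_conditions (es0 n) \<mu>\<^sub>0 i j"
    using topological_tendstoD[OF es0 open_robust_conditions[OF \<mu>], of i j] e(1)
    unfolding eventually_sequentially by auto
  define es where "es n = es0 (n + N)" for n
  have es: "es \<longlonglongrightarrow> e" unfolding es_def by (rule LIMSEQ_ignore_initial_segment[OF es0])
  have res: "robust_conditions (es n) \<mu>\<^sub>0 i j" for n unfolding es_def by (rule N) simp
  have "eventually (\<lambda>n. uniquely_reset_optimal (economy_of (es n)) \<mu>' (econ_prices (es n) $ i)) sequentially"
    by (rule eventually_uniquely_reset_optimal[OF es robust_conditionsD(1)[OF res] eD(1) _ _ e(3)]) (use up \<mu>0 in auto)
  then obtain n where "uniquely_reset_optimal (economy_of (es n)) \<mu>' (econ_prices (es n) $ i)" by (auto dest: eventually_happens)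
  then have "robust_upstream_conditions (es n) \<mu>' \<mu>\<^sub>0 i j"
    using res[of n] up upstream_iff[OF robust_conditionsD(2)[OF res] \<mu>0 \<mu>1]
    by (simp add: robust_upstream_conditions_def Let_def)
  then show False using not0 by (simp add: es_def)
qed

section \<open>The inherited price and reachability\<close>

text \<open>Strictness comes from \<open>D0\<close>, multiplied by the positive benefit at
  \<open>p_r\<close>; passing to the benefit at \<open>p_i\<close> costs only a weak
  inequality.\<close>

lemma Gain0_inherited:
  assumes E: "valid_economy E" and \<mu>: "0 \<le> \<mu>\<^sub>0" "\<mu>\<^sub>0 < 1" and p: "p_i \<in> menu E"
    and c: "inherited_price_cond E r \<mu>\<^sub>0 p_i p_r"
  shows "Gain0 E r \<mu>\<^sub>0 p_r < Gain0 E r \<mu>\<^sub>0 p_i"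
proof -
  have c': "p_r < p_i" "p_i \<le> price_D E \<mu>\<^sub>0" "B0 E r p_r \<mu>\<^sub>0 \<le> B0 E r p_i \<mu>\<^sub>0" "0 < B0 E r p_r \<mu>\<^sub>0"
    using c by (auto simp: inherited_price_cond_def)
  have \<mu>0: "0 < \<mu>\<^sub>0"
    using c'(2) valid_economyD(11)[OF E p] price_D_0[of E] \<mu>(1) by (cases "\<mu>\<^sub>0 = 0") auto
  have "D0 E \<mu>\<^sub>0 p_r * B0 E r p_r \<mu>\<^sub>0 < D0 E \<mu>\<^sub>0 p_i * B0 E r p_r \<mu>\<^sub>0"
    using D0_strict_mono_price[OF E \<mu>0 \<mu>(2) c'(1,2)] c'(4) by simp
  also have "\<dots> \<le> D0 E \<mu>\<^sub>0 p_i * B0 E r p_i \<mu>\<^sub>0"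
    using c'(3) D0_pos[OF E \<mu>0 \<mu>(2)] by (simp add: less_imp_le)
  finally show ?thesis by (simp add: Gain0_def)
qed

section \<open>Changing the cost, and the law of the first event\<close>

lemma static_cost_update [simp]:
  "sig_gap (E\<lparr>cost := c\<rparr>) = sig_gap E" "post_H (E\<lparr>cost := c\<rparr>) = post_H E" "post_L (E\<lparr>cost := c\<rparr>) = post_L E"
  "buy_H (E\<lparr>cost := c\<rparr>) = buy_H E" "buy_L (E\<lparr>cost := c\<rparr>) = buy_L E" "A_H (E\<lparr>cost := c\<rparr>) = A_H E"
  "A_L (E\<lparr>cost := c\<rparr>) = A_L E" "D0 (E\<lparr>cost := c\<rparr>) = D0 E" "A_bar (E\<lparr>cost := c\<rparr>) = A_bar E"
  "drift (E\<lparr>cost := c\<rparr>) = drift E" "J0 (E\<lparr>cost := c\<rparr>) = J0 E" "silence (E\<lparr>cost := c\<rparr>) = silence E"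
  by (simp_all add: fun_eq_iff sig_gap_def post_H_def post_L_def buy_H_def buy_L_def A_H_def A_L_def D0_def A_bar_def
      drift_def J0_def silence_def silence_solution_def)

text \<open>Gains are computed at zero quality, so a cost can be inserted between them without
  moving them.\<close>

lemma Gain0_cost_update: "Gain0 (E\<lparr>cost := c\<rparr>) r = Gain0 E r"
  by (simp add: fun_eq_iff Gain0_def B0_def strategic_value_def bounded_value_def strategic_op_def)

text \<open>Purchase probabilities are at most 1 and at least that of a customer with posterior 0.
  The upper bound delays purchases; the lower one makes the cumulated intensity unbounded, so that
  \<open>purchase_time\<close> is the infimum of a nonempty set.\<close>

lemma cumulated_intensity:
  assumes E: "valid_economy E" and \<mu>: "\<mu> \<in> {0..1}" and t: "0 \<le> t"
  shows "(LBINT s:{0..t}. arrival E * A_bar E (silence E p s \<mu>) p) \<le> arrival E * t"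
    "arrival E * logistic (- p / scale E) * t \<le> (LBINT s:{0..t}. arrival E * A_bar E (silence E p s \<mu>) p)"
proof -
  note v = valid_economyD[OF E]
  have eq: "(LBINT s:{0..t}. arrival E * A_bar E (silence E p s \<mu>) p) = (LBINT s:{0..t}. arrival E * A_bar E (flow E p s \<mu>) p)"
    by (rule set_lebesgue_integral_cong) (auto simp: silence_eq_flow[OF E \<mu>])
  interpret silence_path E p "\<lambda>\<phi>. arrival E * A_bar E \<phi> p" "arrival E"
  proof
    show "continuous_on {0..1} (\<lambda>\<phi>. arrival E * A_bar E \<phi> p)"
      by (intro continuous_intros continuous_on_demand[OF _ E]) (simp add: demand_def)
    show "0 \<le> arrival E * A_bar E x p \<and> arrival E * A_bar E x p \<le> arrival E" if "x \<in> {0..1}" for x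
      using A_bar_bounds[OF E that, of p] v(2) by (auto simp: mult_left_le less_imp_le)
  qed (rule E)
  show "(LBINT s:{0..t}. arrival E * A_bar E (silence E p s \<mu>) p) \<le> arrival E * t"
    unfolding eq by (rule hazard_bounds(2)[OF \<mu> t])
  have low: "logistic (- p / scale E) \<le> A_bar E \<phi> p" if \<phi>: "\<phi> \<in> {0..1}" for \<phi>
  proof -
    have "logistic (- p / scale E) \<le> logistic ((hval E * y - p) / scale E)" if "0 \<le> y" for y
    proof (cases "- p / scale E = (hval E * y - p) / scale E")
      case False
      moreover have "- p / scale E \<le> (hval E * y - p) / scale E" using that v by (intro divide_right_mono) auto
      ultimately show ?thesis by (intro less_imp_le logistic_strict_mono) simp
    qed simp
    then have b: "logistic (- p / scale E) \<le> buy_H E \<phi> p" "logistic (- p / scale E) \<le> buy_L E \<phi> p"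
      using post_H_range[OF E \<phi>] post_L_range[OF E \<phi>] by (auto simp: buy_H_def buy_L_def)
    have "(1 - precision E) * logistic (- p / scale E) + precision E * logistic (- p / scale E) \<le> A_L E \<phi> p"
      unfolding A_L_def using b v by (intro add_mono mult_left_mono) auto
    then show ?thesis using A_bar_ge[OF E \<phi>, of p] by (simp add: left_diff_distrib)
  qed
  have "(LBINT s:{0..t}. arrival E * logistic (- p / scale E)) \<le> (LBINT s:{0..t}. arrival E * A_bar E (flow E p s \<mu>) p)"
    by (rule set_integral_mono[OF borel_integrable_atLeastAtMost'[OF continuous_on_const] h_flow_integrable[OF \<mu>]])
       (use low flow_range[OF E \<mu>] v(2) in auto)
  then show "arrival E * logistic (- p / scale E) * t \<le> (LBINT s:{0..t}. arrival E * A_bar E (silence E p s \<mu>) p)"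
    unfolding eq using t by (simp add: set_lebesgue_integral_def mult_ac)
qed

text \<open>The margin in t + 1 keeps the infimum away from t, which makes the inequality
  strict.\<close>

lemma purchase_time_gt:
  assumes E: "valid_economy E" and \<mu>: "\<mu> \<in> {0..1}" and t: "0 \<le> t" and e: "arrival E * (t + 1) < e"
  shows "t < purchase_time E (\<mu>, p) e"
proof -
  note v = valid_economyD[OF E]
  define S where "S = {t. 0 \<le> t \<and> e \<le> (LBINT s:{0..t}. arrival E * A_bar E (silence E p s \<mu>) p)}"
  have l: "0 < arrival E * logistic (- p / scale E)" using v logistic_pos by simp
  have e0: "0 \<le> e" using e t v(2) by (smt (verit) mult_nonneg_nonneg)
  define T where "T = e / (arrival E * logistic (- p / scale E))"
  have T: "0 \<le> T" "arrival E * logistic (- p / scale E) * T = e"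
  proof -
    have "y * (e / y) = e" if "0 < y" for y :: real using that by simp
    then show "arrival E * logistic (- p / scale E) * T = e" unfolding T_def using l by blast
    show "0 \<le> T" unfolding T_def using e0 l by (rule divide_nonneg_pos)
  qed
  have "T \<in> S"
    unfolding S_def using T(1) cumulated_intensity(2)[OF E \<mu> T(1), of p, unfolded T(2)] by (intro CollectI conjI)
  moreover have "t + 1 \<le> t'" if "t' \<in> S" for t'
  proof -
    have "arrival E * (t + 1) < arrival E * t'"
      using that e cumulated_intensity(1)[OF E \<mu>, of t' p] by (auto simp: S_def)
    then show ?thesis using v(2) by simp
  qed
  ultimately have "t + 1 \<le> Inf S" by (intro cInf_greatest) auto
  then show ?thesis by (simp add: purchase_time_def S_def)
qed

lemma exponential_tail_pos:
  assumes l: "0 < l" and a: "0 \<le> a"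
  shows "0 < emeasure (density lborel (exponential_density l)) {a<..}"
proof -
  interpret prob_space "density lborel (exponential_density l)" by (rule prob_space_exponential_density[OF l])
  have "distributed (density lborel (exponential_density l)) lborel (\<lambda>x. x) (exponential_density l)"
    unfolding distributed_def
    using distr_id2[of lborel "density lborel (exponential_density l)"] by simp
  from exponential_distributedD_gt[OF this a l]
  have "prob {a<..} = exp (- a * l)" by (simp add: greaterThan_def)
  then show ?thesis by (simp add: emeasure_eq_measure)
qed

text \<open>With positive probability the first reset and the first purchase both come after the time at
  which the silence path passes through the target belief.\<close>

lemma inherited_state_reached:
  assumes E: "valid_economy E" and up: "upstream E p \<mu>' \<mu>\<^sub>0" and N: "(\<mu>\<^sub>0, p) \<in> N"
  shows "reached_with_positive_prob E r (\<mu>', p) N"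
proof -
  note v = valid_economyD[OF E]
  obtain t where \<mu>': "\<mu>' \<in> {0..1}" and t: "0 \<le> t" "silence E p t \<mu>' = \<mu>\<^sub>0"
    using up by (auto simp: upstream_def)
  define M1 where "M1 = density lborel (exponential_density (reset E))"
  define M2 where "M2 = density lborel (exponential_density 1)"
  define M3 :: "real measure" where "M3 = uniform_measure lborel {0<..<1}"
  define M where "M = M1 \<Otimes>\<^sub>M (M2 \<Otimes>\<^sub>M M3)"
  have ns: "noise_space E = PiM UNIV (\<lambda>_. M)" by (simp add: noise_space_def M_def M1_def M2_def M3_def)
  interpret M1: prob_space M1 unfolding M1_def by (rule prob_space_exponential_density[OF v(3)])
  interpret M2: prob_space M2 unfolding M2_def by (rule prob_space_exponential_density) simp
  interpret M3: prob_space M3 unfolding M3_def by (rule prob_space_uniform_measure) auto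
  interpret M23: pair_prob_space M2 M3 ..
  interpret M123: pair_prob_space M1 "M2 \<Otimes>\<^sub>M M3" ..
  \<comment> \<open>The reset comes after t, the purchase threshold exceeds what t + 1 units of time
    can accumulate, and the uniform draw is free.\<close>
  define T where "T = {t<..} \<times> ({arrival E * (t + 1)<..} \<times> (UNIV :: real set))"
  have s1: "{t<..} \<in> sets M1" and s2: "{arrival E * (t + 1)<..} \<in> sets M2" and s3: "UNIV \<in> sets M3" and sp3: "space M3 = UNIV"
    by (simp_all add: M1_def M2_def M3_def)
  have T: "T \<in> sets M" unfolding T_def M_def using s1 s2 s3 by (intro pair_measureI)
  have "emeasure M T = emeasure M1 {t<..} * (emeasure M2 {arrival E * (t + 1)<..} * emeasure M3 UNIV)"
    unfolding M_def T_def using s1 s2 s3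
    by (simp add: M23.P.emeasure_pair_measure_Times M3.emeasure_pair_measure_Times pair_measureI)
  moreover have "emeasure M3 UNIV = 1" using M3.emeasure_space_1 sp3 by simp
  moreover have "0 < emeasure M1 {t<..}" "0 < emeasure M2 {arrival E * (t + 1)<..}"
    unfolding M1_def M2_def using t v by (auto intro!: exponential_tail_pos)
  ultimately have posT: "0 < emeasure M T" by (simp add: ennreal_zero_less_mult_iff)
  define S where "S = (\<lambda>\<omega>. \<omega> 0) -` T \<inter> space (noise_space E)"
  have meas: "(\<lambda>\<omega>. \<omega> 0) \<in> noise_space E \<rightarrow>\<^sub>M M" unfolding ns by (rule measurable_component_singleton) simp
  have "distr (noise_space E) M (\<lambda>\<omega>. \<omega> 0) = M"
    unfolding ns by (rule distr_PiM_component) (auto simp: M_def M123.prob_space_axioms)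
  then have "emeasure (noise_space E) S = emeasure M T"
    unfolding S_def using emeasure_distr[OF meas T] by simp
  with posT have "0 < emeasure (noise_space E) S" by simp
  moreover have "prob_space (noise_space E)"
    unfolding ns by (rule prob_space_PiM) (auto simp: M_def M123.prob_space_axioms)
  ultimately have posS: "0 < measure (noise_space E) S"
    by (simp add: finite_measure.emeasure_eq_measure[OF prob_space.finite_measure])
  have "zq_process E r (\<mu>', p) t \<omega> \<in> N" if "\<omega> \<in> S" for \<omega>
  proof -
    obtain \<tau> e u where \<omega>: "\<omega> 0 = (\<tau>, e, u)" by (cases "\<omega> 0") auto
    have "t < \<tau>" "arrival E * (t + 1) < e" using that by (auto simp: S_def T_def \<omega>)
    then have hold: "t < holding_time E (\<mu>', p) (\<omega> 0)"
      using purchase_time_gt[OF E \<mu>' t(1), of e p] by (simp add: holding_time_def \<omega>)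
    \<comment> \<open>No event has occurred by time t, so the process is still on its initial
      silence path.\<close>
    have "(LEAST n. t < fst (event E r (\<mu>', p) \<omega> (Suc n))) = 0"
      by (rule Least_eq_0) (use hold in simp)
    then show ?thesis using N t(2) by (simp add: zq_process_def)
  qed
  then show ?thesis
    unfolding reached_with_positive_prob_def
    using posS t(1) measurable_sets[OF meas T] by (intro bexI[of _ S]) (auto simp: S_def)
qed

section \<open>Large discount rates\<close>

lemma integral_exp_neg: "(LBINT t. indicator {0..} t * exp (- t :: real)) = 1"
proof -
  have "(\<integral>\<^sup>+t. ennreal (exp (- t)) * indicator {0..} t \<partial>lborel) = ennreal (0 - (- exp (- 0)))"
  proof (rule nn_integral_FTC_atLeast)
    show "((\<lambda>t. - exp (- t)) \<longlongrightarrow> (0::real)) at_top"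
      using tendsto_minus[OF filterlim_compose[OF exp_at_bot filterlim_uminus_at_bot_at_top]] by simp
  qed (auto intro!: derivative_eq_intros)
  then have "(\<integral>\<^sup>+t. ennreal (indicator {0..} t * exp (- t)) \<partial>lborel) = (1 :: ennreal)"
    by (subst (asm) nn_integral_cong[where v = "\<lambda>t. ennreal (indicator {0..} t * exp (- t))"]) (auto simp: indicator_def)
  then show ?thesis by (subst integral_eq_nn_integral) auto
qed

text \<open>Substituting t = s / \<rho> concentrates the weight at time 0: the integrand becomes exp
  (- s) g (s / \<rho>), dominated by K exp (- s). Continuity at 0 is asked along nonnegative
  sequences only.\<close>

lemma abelian_limit:
  fixes g :: "real \<Rightarrow> real"
  assumes g: "(\<lambda>t. indicator {0..} t * g t) \<in> borel_measurable borel" and K: "\<And>t. 0 \<le> t \<Longrightarrow> \<bar>g t\<bar> \<le> K"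
    and lim: "\<And>ts. (\<And>n. 0 \<le> ts n) \<Longrightarrow> ts \<longlonglongrightarrow> 0 \<Longrightarrow> (\<lambda>n. g (ts n)) \<longlonglongrightarrow> g0"
  shows "((\<lambda>\<rho>. \<rho> * (LBINT t. indicator {0..} t * (exp (- \<rho> * t) * g t))) \<longlongrightarrow> g0) at_top"
proof (rule tendsto_at_topI_sequentially)
  fix X :: "nat \<Rightarrow> real" assume X: "filterlim X at_top sequentially"
  \<comment> \<open>Rates below 1 are raised to 1 so that rescaling is legitimate for all n;
    eventually nothing changes.\<close>
  define Y where "Y n = max 1 (X n)" for n
  have Y: "0 < Y n" for n by (simp add: Y_def)
  have ev: "eventually (\<lambda>n. Y n = X n) sequentially"
    using X unfolding filterlim_at_top by (auto simp: Y_def max_def elim: eventually_mono dest: spec[of _ 1])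
  have YX: "filterlim Y at_top sequentially"
    by (rule filterlim_at_top_mono[OF X]) (simp add: Y_def)
  have inv: "(\<lambda>n. inverse (Y n)) \<longlonglongrightarrow> 0" by (rule tendsto_inverse_0_at_top[OF YX])
  have eq: "Y n * (LBINT t. indicator {0..} t * (exp (- Y n * t) * g t)) = (LBINT s. indicator {0..} s * (exp (- s) * g (inverse (Y n) * s)))" for n
  proof -
    have "(LBINT t. indicator {0..} t * (exp (- Y n * t) * g t))
        = \<bar>inverse (Y n)\<bar> *\<^sub>R (LBINT s. indicator {0..} (0 + inverse (Y n) * s) * (exp (- Y n * (0 + inverse (Y n) * s)) * g (0 + inverse (Y n) * s)))"
      by (rule lborel_integral_real_affine) (use Y[of n] in simp)
    also have "\<dots> = inverse (Y n) * (LBINT s. indicator {0..} s * (exp (- s) * g (inverse (Y n) * s)))"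
    proof -
      have c: "Y n * (inverse (Y n) * s) = s" for s using Y[of n] by simp
      have i: "indicator {0..} (inverse (Y n) * s) = (indicator {0..} s :: real)" for s
        using Y[of n] by (simp add: indicator_def zero_le_mult_iff)
      show ?thesis using Y[of n] by (simp only: add_0_left i mult_minus_left c real_scaleR_def) simp
    qed
    finally show ?thesis using Y[of n] by simp
  qed
  have "(\<lambda>n. LBINT s. indicator {0..} s * (exp (- s) * g (inverse (Y n) * s))) \<longlonglongrightarrow> (LBINT s. indicator {0..} s * (exp (- s) * g0))"
  proof (rule integral_dominated_convergence[where w = "\<lambda>s. indicator {0..} s * (K * exp (- 1 * s))"])
    show "(\<lambda>s. indicator {0..} s * (exp (- s) * g (inverse (Y n) * s))) \<in> borel_measurable lborel" for n
    proof -
      have "(\<lambda>s. (indicator {0..} (inverse (Y n) * s) * g (inverse (Y n) * s)) * exp (- s)) \<in> borel_measurable borel"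
        by (intro borel_measurable_times measurable_compose[OF _ g]) auto
      also have "(\<lambda>s. (indicator {0..} (inverse (Y n) * s) * g (inverse (Y n) * s)) * exp (- s)) = (\<lambda>s. indicator {0..} s * (exp (- s) * g (inverse (Y n) * s)))"
        using Y[of n] by (auto simp: fun_eq_iff indicator_def zero_le_mult_iff)
      finally show ?thesis by simp
    qed
    show "integrable lborel (\<lambda>s. indicator {0..} s * (K * exp (- 1 * s)))" by (rule integrable_exp_decay) simp
    show "AE s in lborel. (\<lambda>n. indicator {0..} s * (exp (- s) * g (inverse (Y n) * s))) \<longlonglongrightarrow> indicator {0..} s * (exp (- s) * g0)"
    proof (intro AE_I2)
      fix s :: real
      show "(\<lambda>n. indicator {0..} s * (exp (- s) * g (inverse (Y n) * s))) \<longlonglongrightarrow> indicator {0..} s * (exp (- s) * g0)"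
      proof (cases "0 \<le> s")
        case True
        have "(\<lambda>n. inverse (Y n) * s) \<longlonglongrightarrow> 0 * s" by (intro tendsto_mult inv tendsto_const)
        then have "(\<lambda>n. g (inverse (Y n) * s)) \<longlonglongrightarrow> g0"
          using True Y by (intro lim) (auto simp: less_imp_le)
        then show ?thesis by (intro tendsto_mult tendsto_const)
      qed simp
    qed
    show "AE s in lborel. norm (indicator {0..} s * (exp (- s) * g (inverse (Y n) * s))) \<le> indicator {0..} s * (K * exp (- 1 * s))" for n
    proof (intro AE_I2)
      fix s :: real
      have "\<bar>g (inverse (Y n) * s)\<bar> \<le> K" if "0 \<le> s" using that Y[of n] by (intro K) (simp add: less_imp_le)
      then show "norm (indicator {0..} s * (exp (- s) * g (inverse (Y n) * s))) \<le> indicator {0..} s * (K * exp (- 1 * s))"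
        by (auto simp: indicator_def abs_mult mult.commute mult_left_mono)
    qed
  qed simp
  moreover have "(LBINT s. indicator {0..} s * (exp (- s) * g0)) = g0"
    using integral_exp_neg by (simp flip: mult.assoc)
  ultimately have "(\<lambda>n. Y n * (LBINT t. indicator {0..} t * (exp (- Y n * t) * g t))) \<longlonglongrightarrow> g0" by (simp only: eq)
  then show "(\<lambda>n. X n * (LBINT t. indicator {0..} t * (exp (- X n * t) * g t))) \<longlonglongrightarrow> g0"
    by (rule Lim_transform_eventually) (use ev in \<open>auto elim: eventually_mono\<close>)
qed

lemma static_disc_update [simp]:
  "sig_gap (E\<lparr>disc := \<rho>\<rparr>) = sig_gap E" "post_H (E\<lparr>disc := \<rho>\<rparr>) = post_H E" "post_L (E\<lparr>disc := \<rho>\<rparr>) = post_L E"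
  "buy_H (E\<lparr>disc := \<rho>\<rparr>) = buy_H E" "buy_L (E\<lparr>disc := \<rho>\<rparr>) = buy_L E" "A_H (E\<lparr>disc := \<rho>\<rparr>) = A_H E"
  "A_L (E\<lparr>disc := \<rho>\<rparr>) = A_L E" "D0 (E\<lparr>disc := \<rho>\<rparr>) = D0 E" "A_bar (E\<lparr>disc := \<rho>\<rparr>) = A_bar E"
  "J0 (E\<lparr>disc := \<rho>\<rparr>) = J0 E" "price_D (E\<lparr>disc := \<rho>\<rparr>) = price_D E" "speed (E\<lparr>disc := \<rho>\<rparr>) = speed E"
  "clock (E\<lparr>disc := \<rho>\<rparr>) = clock E" "unclock (E\<lparr>disc := \<rho>\<rparr>) = unclock E" "flow (E\<lparr>disc := \<rho>\<rparr>) = flow E"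
  by (simp_all add: fun_eq_iff sig_gap_def post_H_def post_L_def buy_H_def buy_L_def A_H_def A_L_def D0_def A_bar_def
      J0_def price_D_def speed_def clock_def unclock_def flow_def)

lemma valid_disc_update: "valid_economy E \<Longrightarrow> 0 < \<rho> \<Longrightarrow> valid_economy (E\<lparr>disc := \<rho>\<rparr>)"
  by (simp add: valid_economy_def)

text \<open>Continuation values are of order \<open>1/\<rho>\<close> and are themselves discounted by a factor \<open>1/\<rho>\<close>.\<close>

lemma gross_value_large_disc:
  assumes E: "valid_economy E" and \<mu>: "\<mu> \<in> {0..1}" and p: "p \<in> menu E"
  shows "((\<lambda>\<rho>. \<rho> * gross_value (E\<lparr>disc := \<rho>\<rparr>) \<mu> p) \<longlongrightarrow> arrival E * (p * A_bar E \<mu> p)) at_top"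
proof -
  note v = valid_economyD[OF E]
  have dem: "demand A_bar" by (simp add: demand_def)
  \<comment> \<open>Revenue rate times the probability that no event has occurred: the part of the
    integrand free of \<rho>.\<close>
  define g where "g t = exp (- (LBINT s:{0..t}. hazard A_bar E p (flow E p s \<mu>))) * (arrival E * p * A_bar E (flow E p t \<mu>) p)" for t
  interpret P: silence_path E p "hazard A_bar E p" "reset E + arrival E" by (rule path_hazard[OF dem E])
  have meas_A: "set_borel_measurable borel {0..1} (\<lambda>\<phi>. arrival E * p * A_bar E \<phi> p)"
    by (intro set_borel_measurable_continuous continuous_intros continuous_on_demand[OF dem E])
  have main: "((\<lambda>\<rho>. \<rho> * (LBINT t. indicator {0..} t * (exp (- \<rho> * t) * g t))) \<longlongrightarrow> arrival E * p * A_bar E \<mu> p) at_top"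
  proof (rule abelian_limit[where K = "arrival E * p"])
    \<comment> \<open>Measurability is inherited from the discounted integrand by multiplying its
      discount factor away.\<close>
    have "(\<lambda>t. exp (disc E * t) * (indicator {0..} t *\<^sub>R (P.weight \<mu> t * (arrival E * p * A_bar E (flow E p t \<mu>) p)))) \<in> borel_measurable borel"
      using P.integrand_measurable_fixed[OF meas_A \<mu>] by (intro borel_measurable_times) auto
    also have "(\<lambda>t. exp (disc E * t) * (indicator {0..} t *\<^sub>R (P.weight \<mu> t * (arrival E * p * A_bar E (flow E p t \<mu>) p)))) = (\<lambda>t. indicator {0..} t * g t)"
      by (auto simp: fun_eq_iff g_def indicator_def exp_diff exp_minus field_simps)
    finally show "(\<lambda>t. indicator {0..} t * g t) \<in> borel_measurable borel" .
    fix t :: real assume t: "0 \<le> t"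
    have "0 \<le> A_bar E (flow E p t \<mu>) p" "A_bar E (flow E p t \<mu>) p \<le> 1"
      using A_bar_bounds[OF E flow_range[OF E \<mu>], of p t p] by (auto simp: less_imp_le)
    then have "\<bar>arrival E * p * A_bar E (flow E p t \<mu>) p\<bar> \<le> arrival E * p"
      using v(2) v(11)[OF p] by (simp add: abs_mult mult_left_le)
    moreover have "exp (- (LBINT s:{0..t}. hazard A_bar E p (flow E p s \<mu>))) \<le> 1"
      using P.hazard_bounds(1)[OF \<mu> t] by simp
    ultimately show "\<bar>g t\<bar> \<le> arrival E * p"
      unfolding g_def abs_mult[of "exp _"] abs_exp_cancel using mult_mono[of "exp _" 1] by fastforce
  next
    fix ts :: "nat \<Rightarrow> real" assume ts: "\<And>n. 0 \<le> ts n" "ts \<longlonglongrightarrow> 0"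
    have "(\<lambda>n. LBINT s:{0..ts n}. hazard A_bar E p (flow E p s \<mu>)) \<longlonglongrightarrow> 0"
    proof (rule tendsto_sandwich[where f = "\<lambda>_. 0" and h = "\<lambda>n. (reset E + arrival E) * ts n"])
      show "(\<lambda>n. (reset E + arrival E) * ts n) \<longlonglongrightarrow> 0" using tendsto_mult[OF tendsto_const ts(2)] by simp
    qed (use P.hazard_bounds[OF \<mu> ts(1)] in auto)
    moreover have "(\<lambda>n. A_bar E (flow E p (ts n) \<mu>) p) \<longlonglongrightarrow> A_bar E (flow E p 0 \<mu>) p"
      by (intro tendsto_A_bar[OF _ E] isCont_tendsto_compose[OF isCont_flow[OF E] ts(2)] flow_range[OF E \<mu>]) auto
    ultimately have "(\<lambda>n. g (ts n)) \<longlonglongrightarrow> exp (- 0) * (arrival E * p * A_bar E (flow E p 0 \<mu>) p)"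
      unfolding g_def by (intro tendsto_intros)
    then show "(\<lambda>n. g (ts n)) \<longlonglongrightarrow> arrival E * p * A_bar E \<mu> p" by (simp add: flow_0[OF E])
  qed
  define P where "P = Max (menu E)"
  define C where "C = (reset E + arrival E) * (arrival E * P)"
  \<comment> \<open>The contraction factor is at most (\<kappa> + \<nu>) / \<rho> and values are at
    most \<nu> P / \<rho>; multiplied by \<rho>, this gives C / \<rho>.\<close>
  have err: "norm (\<rho> * gross_value (E\<lparr>disc := \<rho>\<rparr>) \<mu> p - \<rho> * (LBINT t. indicator {0..} t * (exp (- \<rho> * t) * g t))) \<le> C / \<rho>"
    if \<rho>: "0 < \<rho>" for \<rho>
  proof -
    define E' where "E' = E\<lparr>disc := \<rho>\<rparr>"
    have E': "valid_economy E'" unfolding E'_def by (rule valid_disc_update[OF E \<rho>])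
    have upd: "disc E' = \<rho>" "arrival E' = arrival E" "reset E' = reset E" "menu E' = menu E" "flow E' = flow E" "A_bar E' = A_bar E"
      "J0 E' = J0 E" by (simp_all add: E'_def)
    interpret S: silence_path E' p "hazard A_bar E' p" "reset E + arrival E"
      using path_hazard[OF dem E'] by (simp add: upd)
    interpret V: valuation A_bar "max_agg E'" E' by (rule valuation_gross[OF E'])
    define U where "U = gross_value E'"
    have U: "is_value A_bar (max_agg E') E' U" "\<And>\<mu> p. \<mu> \<in> {0..1} \<Longrightarrow> p \<in> menu E' \<Longrightarrow> \<bar>U \<mu> p\<bar> \<le> arrival E * P / \<rho>"
      using gross_value[OF E'] by (auto simp: U_def value_bound_def upd P_def)
    have bU: "bounded_value E' U" using U(1) by (simp add: is_value_def)
    have b0: "bounded_value E' (\<lambda>_ _. 0)" by (auto simp: bounded_value_def set_borel_measurable_def)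
    have p': "p \<in> menu E'" using p by (simp add: upd)
    obtain K where K: "\<And>\<phi>. \<phi> \<in> {0..1} \<Longrightarrow> \<bar>reward A_bar (max_agg E') E' U p \<phi>\<bar> \<le> K" using V.reward_bounded[OF bU p'] by blast
    obtain K' where K': "\<And>\<phi>. \<phi> \<in> {0..1} \<Longrightarrow> \<bar>reward A_bar (max_agg E') E' (\<lambda>_ _. 0) p \<phi>\<bar> \<le> K'" using V.reward_bounded[OF b0 p'] by blast
    have r0: "reward A_bar (max_agg E') E' (\<lambda>_ _. 0) p \<phi> = arrival E * p * A_bar E \<phi> p" for \<phi>
      using valid_economyD(9,10)[OF E'] by (simp add: reward_def max_agg_def upd)
    have c0: "0 \<le> arrival E * P / \<rho>" using U(2)[OF \<mu> p'] by linarith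
    have "\<bar>path_value E' p (hazard A_bar E' p) (reward A_bar (max_agg E') E' U p) \<mu>
         - path_value E' p (hazard A_bar E' p) (reward A_bar (max_agg E') E' (\<lambda>_ _. 0) p) \<mu>\<bar>
        \<le> (reset E + arrival E) / (disc E' + (reset E + arrival E)) * (arrival E * P / \<rho>)"
    proof (rule S.path_value_contraction[OF V.reward_measurable[OF bU p'] V.reward_measurable[OF b0 p'] \<mu> K K' c0])
      show "\<bar>reward A_bar (max_agg E') E' U p \<phi> - reward A_bar (max_agg E') E' (\<lambda>_ _. 0) p \<phi>\<bar> \<le> arrival E * P / \<rho> * hazard A_bar E' p \<phi>"
        if "\<phi> \<in> {0..1}" for \<phi>
        by (rule V.reward_diff_le[OF _ p' that]) (use U(2) in auto)
    qed
    also have "\<dots> \<le> (reset E + arrival E) / \<rho> * (arrival E * P / \<rho>)"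
      using v(2,3) \<rho> c0 by (intro mult_right_mono frac_le) (auto simp: upd)
    finally have 1: "\<bar>U \<mu> p - path_value E' p (hazard A_bar E' p) (reward A_bar (max_agg E') E' (\<lambda>_ _. 0) p) \<mu>\<bar> \<le> (reset E + arrival E) / \<rho> * (arrival E * P / \<rho>)"
      using U(1) \<mu> p' by (simp add: is_value_def val_op_def)
    have 2: "path_value E' p (hazard A_bar E' p) (reward A_bar (max_agg E') E' (\<lambda>_ _. 0) p) \<mu> = (LBINT t. indicator {0..} t * (exp (- \<rho> * t) * g t))"
      unfolding path_value_wt r0
    proof (intro Bochner_Integration.integral_cong refl)
      fix t
      have h: "hazard A_bar E' p = hazard A_bar E p" by (simp add: fun_eq_iff hazard_def upd)
      have e: "exp (- \<rho> * t - y) = exp (- \<rho> * t) * exp (- y)" for y by (simp flip: exp_add)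
      show "wt E' p (hazard A_bar E' p) \<mu> t * (arrival E * p * A_bar E (flow E' p t \<mu>) p) = indicator {0..} t * (exp (- \<rho> * t) * g t)"
        unfolding wt_def g_def h upd e by (simp only: mult.assoc)
    qed
    have "\<bar>\<rho> * U \<mu> p - \<rho> * (LBINT t. indicator {0..} t * (exp (- \<rho> * t) * g t))\<bar> = \<rho> * \<bar>U \<mu> p - (LBINT t. indicator {0..} t * (exp (- \<rho> * t) * g t))\<bar>"
      using \<rho> by (simp add: abs_mult flip: right_diff_distrib)
    also have "\<dots> \<le> \<rho> * ((reset E + arrival E) / \<rho> * (arrival E * P / \<rho>))"
      using 1 \<rho> unfolding 2 by (intro mult_left_mono) auto
    also have "\<dots> = C / \<rho>" using \<rho> by (simp add: C_def)
    finally show ?thesis by (simp add: U_def E'_def)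
  qed
  have "((\<lambda>\<rho>. \<rho> * gross_value (E\<lparr>disc := \<rho>\<rparr>) \<mu> p - \<rho> * (LBINT t. indicator {0..} t * (exp (- \<rho> * t) * g t))) \<longlongrightarrow> 0) at_top"
  proof (rule Lim_null_comparison)
    show "eventually (\<lambda>\<rho>. norm (\<rho> * gross_value (E\<lparr>disc := \<rho>\<rparr>) \<mu> p - \<rho> * (LBINT t. indicator {0..} t * (exp (- \<rho> * t) * g t))) \<le> C / \<rho>) at_top"
      using eventually_gt_at_top[of 0] by (rule eventually_mono) (rule err)
    show "((\<lambda>\<rho>. C / \<rho>) \<longlongrightarrow> 0) at_top"
      by (intro tendsto_divide_0[OF tendsto_const] filterlim_at_top_imp_at_infinity filterlim_ident)
  qed
  from tendsto_add[OF this main] show ?thesis by (simp add: mult.assoc)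
qed

text \<open>Scaling by \<rho> preserves the ranking of gross values, and the scaled values converge
  to \<nu> times the expected revenues, whose ranking is strict on a finite menu.\<close>

lemma eventually_reset_optimal_large_disc:
  assumes E: "valid_economy E" and \<mu>: "\<mu> \<in> {0..1}" and m: "uniquely_myopic_optimal E \<mu> p"
  shows "p \<in> menu E" "eventually (\<lambda>\<rho>. uniquely_reset_optimal (E\<lparr>disc := \<rho>\<rparr>) \<mu> p) at_top"
proof -
  have am: "argmax_on (\<lambda>p'. p' * A_bar E \<mu> p') (menu E) = {p}" using m by (simp add: uniquely_myopic_optimal_def)
  then have "p \<in> argmax_on (\<lambda>p'. p' * A_bar E \<mu> p') (menu E)" by simp
  then have pm: "p \<in> menu E" and le: "\<And>y. y \<in> menu E \<Longrightarrow> y * A_bar E \<mu> y \<le> p * A_bar E \<mu> p"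
    by (auto simp: is_arg_max_on_iff)
  show "p \<in> menu E" by (rule pm)
  have lt: "y * A_bar E \<mu> y < p * A_bar E \<mu> p" if y: "y \<in> menu E" "y \<noteq> p" for y
  proof (rule ccontr)
    assume "\<not> y * A_bar E \<mu> y < p * A_bar E \<mu> p"
    then have "y \<in> argmax_on (\<lambda>p'. p' * A_bar E \<mu> p') (menu E)"
      using le y(1) by (force simp: is_arg_max_on_iff)
    then show False using am y(2) by simp
  qed
  have "eventually (\<lambda>\<rho>. \<forall>y\<in>menu E - {p}. \<rho> * gross_value (E\<lparr>disc := \<rho>\<rparr>) \<mu> y < \<rho> * gross_value (E\<lparr>disc := \<rho>\<rparr>) \<mu> p) at_top"
  proof (rule eventually_ball_finite)
    show "finite (menu E - {p})" using valid_economyD(9)[OF E] by simp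
    show "\<forall>y\<in>menu E - {p}. eventually (\<lambda>\<rho>. \<rho> * gross_value (E\<lparr>disc := \<rho>\<rparr>) \<mu> y < \<rho> * gross_value (E\<lparr>disc := \<rho>\<rparr>) \<mu> p) at_top"
      using lt valid_economyD(2)[OF E]
      by (intro ballI eventually_less_of_tendsto[OF gross_value_large_disc[OF E \<mu>] gross_value_large_disc[OF E \<mu> pm]]) auto
  qed
  with eventually_gt_at_top[of 0]
  show "eventually (\<lambda>\<rho>. uniquely_reset_optimal (E\<lparr>disc := \<rho>\<rparr>) \<mu> p) at_top"
  proof eventually_elim
    fix \<rho> :: real assume \<rho>: "0 < \<rho>" and "\<forall>y\<in>menu E - {p}. \<rho> * gross_value (E\<lparr>disc := \<rho>\<rparr>) \<mu> y < \<rho> * gross_value (E\<lparr>disc := \<rho>\<rparr>) \<mu> p"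
    then have *: "\<And>y. y \<in> menu E \<Longrightarrow> y \<noteq> p \<Longrightarrow> gross_value (E\<lparr>disc := \<rho>\<rparr>) \<mu> y < gross_value (E\<lparr>disc := \<rho>\<rparr>) \<mu> p" by simp
    then have "\<And>y. y \<in> menu E \<Longrightarrow> gross_value (E\<lparr>disc := \<rho>\<rparr>) \<mu> y \<le> gross_value (E\<lparr>disc := \<rho>\<rparr>) \<mu> p"
      using less_imp_le order_refl by blast
    then have "x \<in> argmax_on (gross_value (E\<lparr>disc := \<rho>\<rparr>) \<mu>) (menu E) \<longleftrightarrow> x = p" for x
      using * pm unfolding is_arg_max_on_iff by (meson leD)
    then show "uniquely_reset_optimal (E\<lparr>disc := \<rho>\<rparr>) \<mu> p" by (auto simp: uniquely_reset_optimal_def)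
  qed
qed

text \<open>Whatever the selector, each benefit is within 2 C / \<rho> of its price. The thresholds
  (\<open>p_i\<close> - \<open>p_r\<close>) / 4 and \<open>p_r\<close> / 2 count the four value
  terms of the comparison and the two of the positivity claim.\<close>

lemma inherited_price_cond_large_disc:
  assumes E: "valid_economy E" and \<mu>: "\<mu> \<in> {0..1}" and p: "p_i \<in> menu E" "p_r \<in> menu E" "p_r < p_i" "p_i \<le> price_D E \<mu>"
  shows "eventually (\<lambda>\<rho>. \<forall>r. desk_selector (E\<lparr>disc := \<rho>\<rparr>) r \<longrightarrow> inherited_price_cond (E\<lparr>disc := \<rho>\<rparr>) r \<mu> p_i p_r) at_top"
proof -
  define C where "C = arrival E * Max (menu E)"
  have "((\<lambda>\<rho>. C / \<rho>) \<longlongrightarrow> 0) at_top"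
    by (intro tendsto_divide_0[OF tendsto_const] filterlim_at_top_imp_at_infinity filterlim_ident)
  moreover have "0 < min ((p_i - p_r) / 4) (p_r / 2)" using p valid_economyD(11)[OF E] by simp
  ultimately have "eventually (\<lambda>\<rho>. C / \<rho> < min ((p_i - p_r) / 4) (p_r / 2)) at_top" by (rule order_tendstoD(2))
  with eventually_gt_at_top[of 0] show ?thesis
  proof eventually_elim
    fix \<rho> :: real assume \<rho>: "0 < \<rho>" and small: "C / \<rho> < min ((p_i - p_r) / 4) (p_r / 2)"
    show "\<forall>r. desk_selector (E\<lparr>disc := \<rho>\<rparr>) r \<longrightarrow> inherited_price_cond (E\<lparr>disc := \<rho>\<rparr>) r \<mu> p_i p_r"
    proof (intro allI impI)
      fix r assume r: "desk_selector (E\<lparr>disc := \<rho>\<rparr>) r"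
      define b where "b = C / \<rho>"
      have V: "\<bar>strategic_value (E\<lparr>disc := \<rho>\<rparr>) r y q\<bar> \<le> b" if "y \<in> {0..1}" "q \<in> menu E" for y q
        using strategic_value(2)[OF valid_disc_update[OF E \<rho>] r that(1), of q] that(2) by (simp add: value_bound_def C_def b_def)
      have J: "J0 E \<mu> q \<in> {0..1}" for q by (rule J0_range[OF E \<mu>])
      have sm: "b < (p_i - p_r) / 4" "b < p_r / 2" using small unfolding b_def[symmetric] by simp_all
      note Vs = V[OF J p(1), of p_i] V[OF J p(2), of p_r] V[OF \<mu> p(1)] V[OF \<mu> p(2)]
      have "B0 (E\<lparr>disc := \<rho>\<rparr>) r p_r \<mu> \<le> B0 (E\<lparr>disc := \<rho>\<rparr>) r p_i \<mu>"
        unfolding B0_def static_disc_update using Vs sm by (simp add: abs_le_iff)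
      moreover have "0 < B0 (E\<lparr>disc := \<rho>\<rparr>) r p_r \<mu>"
        unfolding B0_def static_disc_update using Vs sm by linarith
      ultimately
      show "inherited_price_cond (E\<lparr>disc := \<rho>\<rparr>) r \<mu> p_i p_r"
        using p by (simp add: inherited_price_cond_def)
    qed
  qed
qed

lemma myopic_rankings_large_disc:
  assumes E: "valid_economy E" and \<mu>: "\<mu>\<^sub>0 \<in> {0..1}" and up: "upstream E p_i \<mu>' \<mu>\<^sub>0"
    and m: "uniquely_myopic_optimal E \<mu>' p_i" "uniquely_myopic_optimal E \<mu>\<^sub>0 p_r"
    and p: "p_r < p_i" "p_i \<le> price_D E \<mu>\<^sub>0"
  shows "\<exists>\<rho>\<^sub>0>0. \<forall>\<rho>>\<rho>\<^sub>0.
             uniquely_reset_optimal (E\<lparr>disc := \<rho>\<rparr>) \<mu>' p_i \<and>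
             uniquely_reset_optimal (E\<lparr>disc := \<rho>\<rparr>) \<mu>\<^sub>0 p_r \<and>
             (\<forall>r. desk_selector (E\<lparr>disc := \<rho>\<rparr>) r \<longrightarrow>
                inherited_price_cond (E\<lparr>disc := \<rho>\<rparr>) r \<mu>\<^sub>0 p_i p_r \<and>
                Gain0 (E\<lparr>disc := \<rho>\<rparr>) r \<mu>\<^sub>0 p_i > Gain0 (E\<lparr>disc := \<rho>\<rparr>) r \<mu>\<^sub>0 p_r)"
proof -
  have \<mu>': "\<mu>' \<in> {0..1}" using up by (simp add: upstream_def)
  note i = eventually_reset_optimal_large_disc[OF E \<mu>' m(1)] and r = eventually_reset_optimal_large_disc[OF E \<mu> m(2)]
  \<comment> \<open>Belief 1 is upstream only of itself and cannot have two different unique myopic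
    optima.\<close>
  have \<mu>1: "\<mu>\<^sub>0 < 1"
  proof (rule ccontr)
    assume "\<not> \<mu>\<^sub>0 < 1"
    then have "\<mu>\<^sub>0 = 1" "\<mu>' = 1" using \<mu> upstream_1[OF E] up by auto
    then show False using m p(1) by (simp add: uniquely_myopic_optimal_def)
  qed
  from eventually_gt_at_top[of 0] i(2) r(2) inherited_price_cond_large_disc[OF E \<mu> i(1) r(1) p]
  have "eventually (\<lambda>\<rho>. uniquely_reset_optimal (E\<lparr>disc := \<rho>\<rparr>) \<mu>' p_i \<and>
             uniquely_reset_optimal (E\<lparr>disc := \<rho>\<rparr>) \<mu>\<^sub>0 p_r \<and>
             (\<forall>r. desk_selector (E\<lparr>disc := \<rho>\<rparr>) r \<longrightarrow>
                inherited_price_cond (E\<lparr>disc := \<rho>\<rparr>) r \<mu>\<^sub>0 p_i p_r \<and>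
                Gain0 (E\<lparr>disc := \<rho>\<rparr>) r \<mu>\<^sub>0 p_i > Gain0 (E\<lparr>disc := \<rho>\<rparr>) r \<mu>\<^sub>0 p_r)) at_top"
  proof eventually_elim
    case (elim \<rho>)
    then show ?case
      using Gain0_inherited[OF valid_disc_update[OF E elim(1)] _ \<mu>1, of p_i _ p_r] \<mu> i(1) by auto
  qed
  then obtain \<rho>1 where "\<forall>\<rho>\<ge>\<rho>1. uniquely_reset_optimal (E\<lparr>disc := \<rho>\<rparr>) \<mu>' p_i \<and>
             uniquely_reset_optimal (E\<lparr>disc := \<rho>\<rparr>) \<mu>\<^sub>0 p_r \<and>
             (\<forall>r. desk_selector (E\<lparr>disc := \<rho>\<rparr>) r \<longrightarrow>
                inherited_price_cond (E\<lparr>disc := \<rho>\<rparr>) r \<mu>\<^sub>0 p_i p_r \<and>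
                Gain0 (E\<lparr>disc := \<rho>\<rparr>) r \<mu>\<^sub>0 p_i > Gain0 (E\<lparr>disc := \<rho>\<rparr>) r \<mu>\<^sub>0 p_r)"
    unfolding eventually_at_top_linorder by blast
  then show ?thesis by (intro exI[of _ "max 1 \<rho>1"]) auto
qed

theorem proposition6:
  shows
    "(\<forall>E r \<mu>\<^sub>0 p_i p_r.
        valid_economy E \<and> desk_selector E r \<and> 0 \<le> \<mu>\<^sub>0 \<and> \<mu>\<^sub>0 < 1 \<and> p_r \<in> menu E \<and> p_i \<in> menu E \<and>
        uniquely_reset_optimal E \<mu>\<^sub>0 p_r \<and> inherited_price_cond E r \<mu>\<^sub>0 p_i p_r \<longrightarrow>
          Gain0 E r \<mu>\<^sub>0 p_i > Gain0 E r \<mu>\<^sub>0 p_r \<and>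
          (\<forall>c. Gain0 E r \<mu>\<^sub>0 p_r < c \<and> c < Gain0 E r \<mu>\<^sub>0 p_i \<longrightarrow>
             profitable (E\<lparr>cost := c\<rparr>) r \<mu>\<^sub>0 p_i \<and> unprofitable (E\<lparr>cost := c\<rparr>) r \<mu>\<^sub>0 p_r) \<and>
          (\<forall>\<mu>'. upstream E p_i \<mu>' \<mu>\<^sub>0 \<and> uniquely_reset_optimal E \<mu>' p_i \<longrightarrow>
             (\<forall>N. open N \<and> (\<mu>\<^sub>0, p_i) \<in> N \<longrightarrow> reached_with_positive_prob E r (\<mu>', p_i) N)))
     \<and>
     (\<forall>\<mu>\<^sub>0\<in>{0..1}. \<forall>(i::'k::finite) j.
        open {e :: 'k econ_param. robust_conditions e \<mu>\<^sub>0 i j} \<and>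
        (\<forall>\<mu>'. open {e :: 'k econ_param. robust_upstream_conditions e \<mu>' \<mu>\<^sub>0 i j}))
     \<and>
     (\<forall>E \<mu>' \<mu>\<^sub>0 p_i p_r.
        valid_economy E \<and> \<mu>\<^sub>0 \<in> {0..1} \<and> upstream E p_i \<mu>' \<mu>\<^sub>0 \<and>
        uniquely_myopic_optimal E \<mu>' p_i \<and> uniquely_myopic_optimal E \<mu>\<^sub>0 p_r \<and>
        p_r < p_i \<and> p_i \<le> price_D E \<mu>\<^sub>0 \<longrightarrow>
          (\<exists>\<rho>\<^sub>0>0. \<forall>\<rho>>\<rho>\<^sub>0.
             uniquely_reset_optimal (E\<lparr>disc := \<rho>\<rparr>) \<mu>' p_i \<and>
             uniquely_reset_optimal (E\<lparr>disc := \<rho>\<rparr>) \<mu>\<^sub>0 p_r \<and>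
             (\<forall>r. desk_selector (E\<lparr>disc := \<rho>\<rparr>) r \<longrightarrow>
                inherited_price_cond (E\<lparr>disc := \<rho>\<rparr>) r \<mu>\<^sub>0 p_i p_r \<and>
                Gain0 (E\<lparr>disc := \<rho>\<rparr>) r \<mu>\<^sub>0 p_i > Gain0 (E\<lparr>disc := \<rho>\<rparr>) r \<mu>\<^sub>0 p_r)))"
proof (intro conjI)
  show "\<forall>E r \<mu>\<^sub>0 p_i p_r.
        valid_economy E \<and> desk_selector E r \<and> 0 \<le> \<mu>\<^sub>0 \<and> \<mu>\<^sub>0 < 1 \<and> p_r \<in> menu E \<and> p_i \<in> menu E \<and>
        uniquely_reset_optimal E \<mu>\<^sub>0 p_r \<and> inherited_price_cond E r \<mu>\<^sub>0 p_i p_r \<longrightarrow>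
          Gain0 E r \<mu>\<^sub>0 p_i > Gain0 E r \<mu>\<^sub>0 p_r \<and>
          (\<forall>c. Gain0 E r \<mu>\<^sub>0 p_r < c \<and> c < Gain0 E r \<mu>\<^sub>0 p_i \<longrightarrow>
             profitable (E\<lparr>cost := c\<rparr>) r \<mu>\<^sub>0 p_i \<and> unprofitable (E\<lparr>cost := c\<rparr>) r \<mu>\<^sub>0 p_r) \<and>
          (\<forall>\<mu>'. upstream E p_i \<mu>' \<mu>\<^sub>0 \<and> uniquely_reset_optimal E \<mu>' p_i \<longrightarrow>
             (\<forall>N. open N \<and> (\<mu>\<^sub>0, p_i) \<in> N \<longrightarrow> reached_with_positive_prob E r (\<mu>', p_i) N))"
    using Gain0_inherited inherited_state_reached
    by (auto simp: profitable_def unprofitable_def Gain0_cost_update)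
  show "\<forall>\<mu>\<^sub>0\<in>{0..1}. \<forall>(i::'k::finite) j.
        open {e :: 'k econ_param. robust_conditions e \<mu>\<^sub>0 i j} \<and>
        (\<forall>\<mu>'. open {e :: 'k econ_param. robust_upstream_conditions e \<mu>' \<mu>\<^sub>0 i j})"
    using open_robust_conditions open_robust_upstream_conditions by auto
qed (use myopic_rankings_large_disc in blast)

end
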